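(* Let $\alpha,\beta\in\mathbb{C}\setminus\{-1,-2,-3,\ldots\}$ with $\alpha+\beta\notin\{-2,-3,-4,\ldots\}$, and let $n\ge1$ be an integer. The following Riemann-Hilbert problem on $\mathbb{C}\setminus[0,1]$ for a $2\times2$ complex matrix valued function $Y(z)$: (I') $Y$ is analytic on $\mathbb{C}\setminus[0,1]$ and the following limits exist for $x\in(0,1)$: $$Y^+(x)=\lim_{z\to x;\ \Im z>0}Y(z),\qquad Y^-(x)=\lim_{z\to x;\ \Im z<0}Y(z);$$ (II') $Y^+(x)=Y^-(x)\begin{pmatrix}1& x^\alpha(1-x)^\beta\\0&1\end{pmatrix}$ for $x\in(0,1)$; (III'$_\infty$) $Y(z)=\left(I+O(z^{-1})\right)\begin{pmatrix}z^n&0\\0&z^{-n}\end{pmatrix}$ for $z\to\infty$; (III'$_0$) $Y(z)=\begin{pmatrix}O(1)& z^\alpha\mathcal{O}_0+O(1)\\ O(1)& z^\alpha\mathcal{O}_0+O(1)\end{pmatrix}$ for $z\to0$; (III'$_1$) $Y(z)=\begin{pmatrix}O(1)& (z-1)^\beta\mathcal{O}_1+O(1)\\ O(1)& (z-1)^\beta\mathcal{O}_1+O(1)\end{pmatrix}$ for $z\to1$, has the unique solution $$Y=\begin{pmatrix}\pi_n&\mathcal{C}_{\alpha,\beta}[\pi_n]\\ c_n\pi_{n-1}&c_n\mathcal{C}_{\alpha,\beta}[\pi_{n-1}]\end{pmatrix},$$ where $\mathcal{C}_{\alpha,\beta}[p](z)=\dfrac{1}{2\pi i}\,\mathrm{f.p.}\!\displaystyle\int_0^1\frac{t^\alpha(1-t)^\beta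 p(t)}{t-z}\,dt$ (Hadamard finite part), $\pi_m=C_m^{-1}P_m^{(\alpha,\beta)}$ are the monic Jacobi polynomials on $[0,1]$, $C_m=(-1)^m\prod_{k=1}^m(k+m+\alpha+\beta)$, and $$c_n=(-1)^n\,2\pi i\,C_{n-1}\left[(n-1)!\,B(\alpha+n,\beta+n)\right]^{-1},\qquad B(r,s)=\frac{\Gamma(r)\Gamma(s)}{\Gamma(r+s)}.$$
   Context: Jacobi polynomials on $[0,1]$ are normalized by $P_m^{(\alpha,\beta)}(x)=w(x)^{-1}\frac{d^m}{dx^m}[(x-x^2)^m w(x)]$ with $w(x)=x^\alpha(1-x)^\beta$; the coefficient of $x^m$ in $P_m^{(\alpha,\beta)}$ is $C_m$. Hadamard finite part on $[0,1]$: let $\alpha,\beta\in\mathbb{C}\setminus\{-1,-2,\ldots\}$ and let $F$ be analytic on $[0,1]$. Write the Taylor expansions at $0$: $(1-t)^\beta F(t)=\sum_{m\ge0}a_m t^m$ and $(1-s)^\alpha F(1-s)=\sum_{m\ge0}b_m s^m$. Then $$\mathrm{f.p.}\!\int_0^1 t^\alpha(1-t)^\beta F(t)\,dt:=\sum_{m\ge0}\frac{a_m}{m+\alpha+1}\,\xi_0^{m+\alpha+1}+\int_{\xi_0}^{\xi_1}t^\alpha(1-t)^\beta F(t)\,dt+\sum_{m\ge0}\frac{b_m}{m+\beta+1}\,(1-\xi_1)^{m+\beta+1},$$ where $0<\xi_0\le\xi_1<1$ are any numbers such that $\xi_0$ and $1-\xi_1$ are smaller than the radii of convergence of the respective series (the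 value does not depend on them), and for $t\in(0,1)$ the usual branches $t^\alpha=e^{\alpha\ln t}$, $(1-t)^\beta=e^{\beta\ln(1-t)}$ are used. In $\mathcal{C}_{\alpha,\beta}[p](z)$, $z\in\mathbb{C}\setminus[0,1]$ and $F(t)=p(t)/(t-z)$. Notation: $\mathcal{O}_0$, $\mathcal{O}_1$ are the sets of germs of analytic functions at $0$, respectively at $1$. One writes $f(z)=z^\alpha\mathcal{O}_0+O(1)$ for $z\to0$ if there is $f_0\in\mathcal{O}_0$ such that $f(z)-z^\alpha f_0(z)=O(1)$ as $z\to0$, and $f(z)=(z-1)^\beta\mathcal{O}_1+O(1)$ for $z\to1$ if there is $f_1\in\mathcal{O}_1$ such that $f(z)-(z-1)^\beta f_1(z)=O(1)$ as $z\to1$. Here $z\in\mathbb{C}\setminus[0,1]$, and $z^\alpha$, $(z-1)^\beta$ are any fixed analytic branches in a small disk around $0$, respectively $1$, slit along $[0,1]$ (different branches differ by constant factors).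
   Formalization: That the displayed Y solves the problem is claimed only for α≠0 and β≠0: for α=0 (β=0) the second column has a logarithmic singularity at 0 (at 1), violating (III'_0) (resp. (III'_1)), so no solution exists; uniqueness covers the full parameter range. *)

theory Defs
  imports "HOL-Complex_Analysis.Complex_Analysis" "HOL-Library.Landau_Symbols"
begin

definition slit_plane :: "complex set" where
  "slit_plane = UNIV - complex_of_real ` {0..1}"

text \<open>Principal powers: for \<open>t\<close> in \<open>(0,1)\<close> these are the usual branches
  \<open>exp (\<alpha> ln t)\<close> and \<open>exp (\<beta> ln (1 - t))\<close>, and the product is holomorphic
  in a neighbourhood of \<open>(0,1)\<close>.\<close>

definition jacobi_weight :: "complex \<Rightarrow> complex \<Rightarrow> complex \<Rightarrow> complex" where
  "jacobi_weight \<alpha> \<beta> t = t powr \<alpha> * (1 - t) powr \<beta>"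

text \<open>The polynomial given by the Rodrigues formula on \<open>(0,1)\<close>.\<close>

definition jacobi_poly :: "complex \<Rightarrow> complex \<Rightarrow> nat \<Rightarrow> complex poly" where
  "jacobi_poly \<alpha> \<beta> m = (THE p. \<forall>x::real. 0 < x \<and> x < 1 \<longrightarrow>
     poly p (of_real x) = inverse (jacobi_weight \<alpha> \<beta> (of_real x)) *
       (deriv ^^ m) (\<lambda>t. (t - t\<^sup>2) ^ m * jacobi_weight \<alpha> \<beta> t) (of_real x))"

definition jacobi_C :: "complex \<Rightarrow> complex \<Rightarrow> nat \<Rightarrow> complex" where
  "jacobi_C \<alpha> \<beta> m = (-1) ^ m * (\<Prod>k=1..m. of_nat k + of_nat m + \<alpha> + \<beta>)"

definition monic_jacobi :: "complex \<Rightarrow> complex \<Rightarrow> nat \<Rightarrow> complex poly" where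
  "monic_jacobi \<alpha> \<beta> m = smult (inverse (jacobi_C \<alpha> \<beta> m)) (jacobi_poly \<alpha> \<beta> m)"

definition jacobi_c :: "complex \<Rightarrow> complex \<Rightarrow> nat \<Rightarrow> complex" where
  "jacobi_c \<alpha> \<beta> n = (-1) ^ n * (2 * of_real pi * \<i>) * jacobi_C \<alpha> \<beta> (n - 1) *
     inverse (fact (n - 1) * Beta (\<alpha> + of_nat n) (\<beta> + of_nat n))"

text \<open>Taylor coefficients at \<open>0\<close> of \<open>(1 - t)\<^sup>\<gamma> G(t)\<close>.\<close>

definition fp_coeff :: "complex \<Rightarrow> (complex \<Rightarrow> complex) \<Rightarrow> nat \<Rightarrow> complex" where
  "fp_coeff \<gamma> G m = (deriv ^^ m) (\<lambda>t. (1 - t) powr \<gamma> * G t) 0 / fact m"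

definition fp_admissible ::
  "complex \<Rightarrow> complex \<Rightarrow> (complex \<Rightarrow> complex) \<Rightarrow> real \<Rightarrow> real \<Rightarrow> bool" where
  "fp_admissible \<alpha> \<beta> F \<xi>0 \<xi>1 \<longleftrightarrow>
     0 < \<xi>0 \<and> \<xi>0 \<le> \<xi>1 \<and> \<xi>1 < 1 \<and>
     ereal \<xi>0 < conv_radius (fp_coeff \<beta> F) \<and>
     ereal (1 - \<xi>1) < conv_radius (fp_coeff \<alpha> (\<lambda>s. F (1 - s)))"

definition fp_value ::
  "complex \<Rightarrow> complex \<Rightarrow> (complex \<Rightarrow> complex) \<Rightarrow> real \<Rightarrow> real \<Rightarrow> complex" where
  "fp_value \<alpha> \<beta> F \<xi>0 \<xi>1 =
     (\<Sum>m. fp_coeff \<beta> F m / (of_nat m + \<alpha> + 1) * of_real \<xi>0 powr (of_nat m + \<alpha> + 1))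
     + integral {\<xi>0..\<xi>1} (\<lambda>t. jacobi_weight \<alpha> \<beta> (of_real t) * F (of_real t))
     + (\<Sum>m. fp_coeff \<alpha> (\<lambda>s. F (1 - s)) m / (of_nat m + \<beta> + 1) *
            of_real (1 - \<xi>1) powr (of_nat m + \<beta> + 1))"

text \<open>Hadamard finite part of the integral of \<open>t\<^sup>\<alpha> (1 - t)\<^sup>\<beta> F(t)\<close> over \<open>[0,1]\<close>: the
  common value of the expression above for all admissible pairs of cut points.\<close>

definition fp_integral :: "complex \<Rightarrow> complex \<Rightarrow> (complex \<Rightarrow> complex) \<Rightarrow> complex" where
  "fp_integral \<alpha> \<beta> F =
     (THE I. \<forall>\<xi>0 \<xi>1. fp_admissible \<alpha> \<beta> F \<xi>0 \<xi>1 \<longrightarrow> fp_value \<alpha> \<beta> F \<xi>0 \<xi>1 = I)"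

definition jacobi_cauchy :: "complex \<Rightarrow> complex \<Rightarrow> complex poly \<Rightarrow> complex \<Rightarrow> complex" where
  "jacobi_cauchy \<alpha> \<beta> p z =
     1 / (2 * of_real pi * \<i>) * fp_integral \<alpha> \<beta> (\<lambda>t. poly p t / (t - z))"

definition jacobi_Y :: "complex \<Rightarrow> complex \<Rightarrow> nat \<Rightarrow> complex \<Rightarrow> complex^2^2" where
  "jacobi_Y \<alpha> \<beta> n z = vector
     [vector [poly (monic_jacobi \<alpha> \<beta> n) z,
              jacobi_cauchy \<alpha> \<beta> (monic_jacobi \<alpha> \<beta> n) z],
      vector [jacobi_c \<alpha> \<beta> n * poly (monic_jacobi \<alpha> \<beta> (n - 1)) z,
              jacobi_c \<alpha> \<beta> n * jacobi_cauchy \<alpha> \<beta> (monic_jacobi \<alpha> \<beta> (n - 1)) z]]"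

definition upper_at :: "real \<Rightarrow> complex filter" where
  "upper_at x = at (of_real x) within {z. Im z > 0}"

definition lower_at :: "real \<Rightarrow> complex filter" where
  "lower_at x = at (of_real x) within {z. Im z < 0}"

definition rh_analytic :: "(complex \<Rightarrow> complex^2^2) \<Rightarrow> bool" where
  "rh_analytic Y \<longleftrightarrow>
     (\<forall>i j. (\<lambda>z. Y z $ i $ j) analytic_on slit_plane) \<and>
     (\<forall>x::real. 0 < x \<and> x < 1 \<longrightarrow>
        (\<exists>L. (Y \<longlongrightarrow> L) (upper_at x)) \<and> (\<exists>L. (Y \<longlongrightarrow> L) (lower_at x)))"

definition rh_jump :: "complex \<Rightarrow> complex \<Rightarrow> (complex \<Rightarrow> complex^2^2) \<Rightarrow> bool" where
  "rh_jump \<alpha> \<beta> Y \<longleftrightarrow> (\<forall>x::real. 0 < x \<and> x < 1 \<longrightarrow>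
     Lim (upper_at x) Y = Lim (lower_at x) Y **
       vector [vector [1, jacobi_weight \<alpha> \<beta> (of_real x)], vector [0, 1]])"

definition rh_infinity :: "nat \<Rightarrow> (complex \<Rightarrow> complex^2^2) \<Rightarrow> bool" where
  "rh_infinity n Y \<longleftrightarrow> (\<exists>E :: complex \<Rightarrow> complex^2^2.
     (\<forall>i j. (\<lambda>z. E z $ i $ j) \<in> O[at_infinity](\<lambda>z. inverse z)) \<and>
     (\<forall>\<^sub>F z in at_infinity. Y z = (mat 1 + E z) **
        vector [vector [z ^ n, 0], vector [0, z powi (- int n)]]))"

text \<open>Branches analytic off \<open>[0,1]\<close> near the endpoint: \<open>(-z) powr \<alpha>\<close> has its cut along
  \<open>[0,\<infinity>)\<close> and is a branch of \<open>z\<^sup>\<alpha>\<close> up to a nonzero constant, which the germ absorbs;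
  \<open>(z - 1) powr \<beta>\<close> has its cut along \<open>(-\<infinity>,1]\<close>.
  Pitfall: for \<open>\<alpha> = 0\<close> the first condition just says that \<open>f\<close> is bounded, which excludes
  the logarithmic singularity that the Cauchy transform then has at \<open>0\<close>; likewise at \<open>1\<close>
  for \<open>\<beta> = 0\<close>.\<close>

definition sing_at_0 :: "complex \<Rightarrow> (complex \<Rightarrow> complex) \<Rightarrow> bool" where
  "sing_at_0 \<alpha> f \<longleftrightarrow> (\<exists>g. g analytic_on {0} \<and>
     (\<lambda>z. f z - (- z) powr \<alpha> * g z) \<in> O[at 0 within slit_plane](\<lambda>_. 1))"

definition sing_at_1 :: "complex \<Rightarrow> (complex \<Rightarrow> complex) \<Rightarrow> bool" where
  "sing_at_1 \<beta> f \<longleftrightarrow> (\<exists>g. g analytic_on {1} \<and>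
     (\<lambda>z. f z - (z - 1) powr \<beta> * g z) \<in> O[at 1 within slit_plane](\<lambda>_. 1))"

definition rh_zero :: "complex \<Rightarrow> (complex \<Rightarrow> complex^2^2) \<Rightarrow> bool" where
  "rh_zero \<alpha> Y \<longleftrightarrow> (\<forall>i.
     (\<lambda>z. Y z $ i $ 1) \<in> O[at 0 within slit_plane](\<lambda>_. 1) \<and> sing_at_0 \<alpha> (\<lambda>z. Y z $ i $ 2))"

definition rh_one :: "complex \<Rightarrow> (complex \<Rightarrow> complex^2^2) \<Rightarrow> bool" where
  "rh_one \<beta> Y \<longleftrightarrow> (\<forall>i.
     (\<lambda>z. Y z $ i $ 1) \<in> O[at 1 within slit_plane](\<lambda>_. 1) \<and> sing_at_1 \<beta> (\<lambda>z. Y z $ i $ 2))"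

definition rh_solution ::
  "complex \<Rightarrow> complex \<Rightarrow> nat \<Rightarrow> (complex \<Rightarrow> complex^2^2) \<Rightarrow> bool" where
  "rh_solution \<alpha> \<beta> n Y \<longleftrightarrow>
     rh_analytic Y \<and> rh_jump \<alpha> \<beta> Y \<and> rh_infinity n Y \<and> rh_zero \<alpha> Y \<and> rh_one \<beta> Y"

end

theory Submission
  imports Defs
begin

text \<open>
  Let \<open>\<Phi>(z) = f.p. \<integral> t\<^sup>\<alpha> (1 - t)\<^sup>\<beta> / (t - z) dt\<close>, and let \<open>M\<close> be the moment \<open>f.p. \<integral> t\<^sup>\<alpha> (1 - t)\<^sup>\<beta> dt\<close>.
  Multiplying the integrand by \<open>t\<close> or \<open>1 - t\<close> raises an exponent by one, so
  \<open>\<Phi>\<^bsub>\<alpha>+1,\<beta>\<^esub> = z \<Phi>\<^bsub>\<alpha>,\<beta>\<^esub> + M\<close> and \<open>\<Phi>\<^bsub>\<alpha>,\<beta>+1\<^esub> = (1 - z) \<Phi>\<^bsub>\<alpha>,\<beta>\<^esub> - M\<close>. These recurrences carry every property of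
  finite parts down from exponents with large real part, where the integral converges: the value
  \<open>M = B(\<alpha> + 1, \<beta> + 1)\<close>, a first-order differential equation for \<open>\<Phi>\<close>, its jump across \<open>(0,1)\<close>, and the
  form \<open>(-z)\<^sup>\<alpha> \<times> germ + germ\<close> at \<open>0\<close>, where a logarithm is possible only for \<open>\<alpha> = 0, 1, 2, \<dots>\<close>.
  The finite part of a total derivative vanishes, so the Rodrigues formula gives orthogonality of the
  Jacobi polynomials also for finite parts; since no norm is zero, they span, and orthogonality
  determines them.

  In each row of a solution, the first entry has no jump and is bounded at the endpoints, hence it is
  a polynomial \<open>p\<close>; the second entry minus the Cauchy transform of \<open>p\<close> has no jump either. At an
  endpoint it may a priori behave like \<open>z\<^sup>\<alpha>\<close>, but a function that is single-valued around \<open>0\<close> cannot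
  contain a nontrivial branch of \<open>z\<^sup>\<alpha>\<close>, so it is entire and vanishes by Liouville. The decay at infinity of
  the Cauchy transform of \<open>p\<close> is then orthogonality of \<open>p\<close> to all polynomials of degree below \<open>n\<close>
  (below \<open>n - 1\<close> in the second row, with the next moment prescribed).\<close>

text \<open>The finite part is not manipulated through its defining series. A primitive of the
  weighted integrand with its regularized boundary values makes linearity, reflection, exponent
  shifts and total derivatives immediate; the series appear only where the two descriptions are
  identified.

  Descending from large exponents divides by z or 1 - z. Off the slit this is harmless, but at 0 the
  regular part of the transform could acquire a pole. The differential equation excludes that: its
  limit at 0 forces the constant term of the regular part to be the moment.

  The condition on \<alpha> + \<beta> enters twice: it keeps the leading coefficients C_m away from
  zero, and it keeps 1/Gamma(\<alpha> + \<beta> + 2m + 2), hence the norms, away from zero. For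
  complex exponents no positivity is available, and nonzero norms take its place.

  Existence is claimed for nonzero exponents only, since a logarithm violates the boundedness
  conditions. Uniqueness holds in all cases: it needs the transform near an endpoint only up to
  o(1/z), which tolerates a logarithm.\<close>

definition regular_exponent :: "complex \<Rightarrow> bool" where
  "regular_exponent \<gamma> \<longleftrightarrow> \<gamma> + 1 \<notin> \<int>\<^sub>\<le>\<^sub>0"

text \<open>The defining form says that \<gamma> + 1 is not a pole of Gamma, which is what the Beta
  function rules ask for; the other form is the one in the theorem.\<close>

lemma regular_exponent_iff: "regular_exponent \<gamma> \<longleftrightarrow> (\<forall>k::nat. k \<ge> 1 \<longrightarrow> \<gamma> \<noteq> - of_nat k)"
proof
  assume "regular_exponent \<gamma>"
  show "\<forall>k::nat. k \<ge> 1 \<longrightarrow> \<gamma> \<noteq> - of_nat k"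
  proof (intro allI impI notI)
    fix k :: nat assume "k \<ge> 1" "\<gamma> = - of_nat k"
    then have "\<gamma> + 1 = - of_nat (k - 1)" by (simp add: of_nat_diff)
    then have "\<gamma> + 1 \<in> \<int>\<^sub>\<le>\<^sub>0" by (simp del: of_nat_diff)
    with \<open>regular_exponent \<gamma>\<close> show False by (simp add: regular_exponent_def)
  qed
next
  assume *: "\<forall>k::nat. k \<ge> 1 \<longrightarrow> \<gamma> \<noteq> - of_nat k"
  show "regular_exponent \<gamma>" unfolding regular_exponent_def
  proof
    assume "\<gamma> + 1 \<in> \<int>\<^sub>\<le>\<^sub>0"
    then obtain n where "\<gamma> + 1 = - of_nat n" by (auto elim: nonpos_Ints_cases')
    then have "\<gamma> = - of_nat (Suc n)" by (simp add: algebra_simps eq_neg_iff_add_eq_0)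
    with * show False by (metis le_add1 plus_1_eq_Suc)
  qed
qed

lemma regular_exponent_add_ne_0:
  assumes "regular_exponent \<gamma>"
  shows "of_nat m + \<gamma> + 1 \<noteq> 0"
proof
  assume "of_nat m + \<gamma> + 1 = 0"
  then have "\<gamma> = - of_nat (Suc m)" by (simp add: algebra_simps eq_neg_iff_add_eq_0)
  with assms show False unfolding regular_exponent_iff by (metis le_add1 plus_1_eq_Suc)
qed

lemma regular_exponent_plus_nat:
  assumes "regular_exponent \<gamma>"
  shows "regular_exponent (\<gamma> + of_nat k)"
  unfolding regular_exponent_iff
proof (intro allI impI notI)
  fix j :: nat assume "1 \<le> j" "\<gamma> + of_nat k = - of_nat j"
  then have "\<gamma> = - of_nat (j + k)" by (simp add: algebra_simps eq_neg_iff_add_eq_0)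
  moreover have "1 \<le> j + k" using \<open>1 \<le> j\<close> by simp
  ultimately show False using assms unfolding regular_exponent_iff by blast
qed

lemma regular_exponent_plus_1: "regular_exponent \<gamma> \<Longrightarrow> regular_exponent (\<gamma> + 1)"
  using regular_exponent_plus_nat[of \<gamma> 1] by simp

lemma regular_exponent_plus_1_ne_0: "regular_exponent \<gamma> \<Longrightarrow> \<gamma> + 1 \<noteq> 0"
  using regular_exponent_add_ne_0[of \<gamma> 0] by simp

section \<open>Complex powers times analytic germs at an endpoint\<close>

text \<open>The neighbourhood is the Minkowski sum of the segment and a small disc. Convexity is
  wanted later for primitives and for connected intersections with discs.\<close>

lemma analytic_on_segment_convex_nhd:
  assumes "F analytic_on complex_of_real ` {0..1}"
  obtains T where "open T" "convex T" "complex_of_real ` {0..1} \<subseteq> T" "F holomorphic_on T"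
proof -
  let ?s = "complex_of_real ` {0..1}"
  obtain U where U: "open U" "?s \<subseteq> U" "F holomorphic_on U"
    using assms by (auto simp: analytic_on_holomorphic)
  have seg: "?s = closed_segment 0 1"
    by (auto simp: closed_segment_def image_iff scaleR_conv_of_real)
  have "compact ?s" by (simp add: seg)
  then obtain e where e: "e > 0" "(\<Union>x\<in>?s. ball x e) \<subseteq> U"
    using compact_subset_open_imp_ball_epsilon_subset U by blast
  let ?T = "\<Union>x\<in>?s. \<Union>y\<in>ball 0 e. {x + y}"
  have "?T \<subseteq> (\<Union>x\<in>?s. ball x e)"
    by (auto simp: dist_norm)
  then have "?T \<subseteq> U" using e by blast
  moreover have "open ?T" by (intro open_sums) auto
  moreover have "convex ?T" by (intro convex_sums) (auto simp: seg)
  moreover have "?s \<subseteq> ?T"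
  proof
    fix x assume "x \<in> ?s"
    then show "x \<in> ?T" using e by (intro UN_I[of x] UN_I[of 0]) auto
  qed
  ultimately show ?thesis using U holomorphic_on_subset by (intro that[of ?T]) auto
qed

text \<open>The equation for \<open>U\<close> says that z^(\<alpha>+1) U(z) is a formal primitive of
  z^\<alpha> times the series of \<open>a\<close>. The factors 1/(m + \<alpha> + 1) are bounded in
  m, so the radius of convergence does not shrink.\<close>

lemma fps_divide_shifted_index:
  fixes a :: "nat \<Rightarrow> complex"
  assumes "regular_exponent \<alpha>"
  defines "U \<equiv> Abs_fps (\<lambda>m. a m / (of_nat m + \<alpha> + 1))"
  shows "fps_conv_radius U \<ge> conv_radius a"
    and "fps_const (\<alpha> + 1) * U + fps_X * fps_deriv U = Abs_fps a"
proof -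
  have "((\<lambda>m. inverse (of_nat m + (\<alpha> + 1))) \<longlongrightarrow> 0) sequentially"
    by (rule filterlim_compose[OF tendsto_inverse_0 tendsto_add_filterlim_at_infinity'[OF tendsto_of_nat tendsto_const]])
  then have "Bseq (\<lambda>m. inverse (of_nat m + (\<alpha> + 1)))"
    by (intro convergent_imp_Bseq) (auto simp: convergent_def)
  then obtain K where K: "K > 0" "\<And>m. norm (inverse (of_nat m + (\<alpha> + 1))) \<le> K"
    unfolding Bseq_def by auto
  show "fps_conv_radius U \<ge> conv_radius a" unfolding fps_conv_radius_def
  proof (rule conv_radius_geI_ex')
    fix r assume r: "0 < r" "ereal r < conv_radius a"
    then have "summable (\<lambda>n. norm (a n * of_real r ^ n))"
      by (intro abs_summable_in_conv_radius) auto
    then have s: "summable (\<lambda>n. K * norm (a n * of_real r ^ n))" by (rule summable_mult)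
    show "summable (\<lambda>n. fps_nth U n * of_real r ^ n)"
    proof (rule summable_comparison_test'[OF s, of 0])
      fix n
      have "norm (fps_nth U n * of_real r ^ n) = norm (inverse (of_nat n + (\<alpha> + 1))) * norm (a n * of_real r ^ n)"
        by (simp add: U_def norm_mult norm_divide field_simps norm_inverse)
      also have "\<dots> \<le> K * norm (a n * of_real r ^ n)" by (intro mult_right_mono K) auto
      finally show "norm (fps_nth U n * of_real r ^ n) \<le> K * norm (a n * of_real r ^ n)" .
    qed
  qed
  show "fps_const (\<alpha> + 1) * U + fps_X * fps_deriv U = Abs_fps a"
  proof (rule fps_ext)
    fix n
    have "of_nat n + \<alpha> + 1 \<noteq> 0" using assms(1) by (rule regular_exponent_add_ne_0)
    moreover have "fps_nth (fps_const (\<alpha> + 1) * U + fps_X * fps_deriv U) n = (of_nat n + \<alpha> + 1) * (a n / (of_nat n + \<alpha> + 1))"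
      by (cases n) (auto simp: U_def algebra_simps add_divide_distrib)
    ultimately show "fps_nth (fps_const (\<alpha> + 1) * U + fps_X * fps_deriv U) n = fps_nth (Abs_fps a) n"
      by simp
  qed
qed

lemma has_vector_derivative_powr_times:
  fixes \<gamma> :: complex
  assumes "(u has_field_derivative u') (at (complex_of_real t))" "t > 0"
  shows "((\<lambda>t. of_real t powr \<gamma> * u (of_real t)) has_vector_derivative
           of_real t powr (\<gamma> - 1) * (\<gamma> * u (of_real t) + of_real t * u')) (at t)"
proof -
  have "((\<lambda>z. z powr \<gamma> * u z) has_field_derivative
      \<gamma> * of_real t powr (\<gamma> - 1) * u (of_real t) + u' * of_real t powr \<gamma>) (at (of_real t))"
    using assms by (intro DERIV_mult has_field_derivative_powr) (auto simp: complex_nonpos_Reals_iff)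
  also have "of_real t powr \<gamma> = of_real t powr (\<gamma> - 1) * (of_real t :: complex)"
    using assms(2) by (simp add: powr_diff)
  finally have "((\<lambda>z. z powr \<gamma> * u z) has_field_derivative
      of_real t powr (\<gamma> - 1) * (\<gamma> * u (of_real t) + of_real t * u')) (at (of_real t))"
    by (simp add: algebra_simps)
  then show ?thesis by (rule has_vector_derivative_real_field)
qed

lemma analytic_at_0_factor:
  assumes "u analytic_on {0::complex}"
  obtains "\<forall>\<^sub>F z in nhds 0. u z = 0"
  | j v where "v analytic_on {0}" "v 0 \<noteq> 0" "\<forall>\<^sub>F z in nhds 0. u z = z ^ j * v z"
proof -
  obtain r where r: "r > 0" "u holomorphic_on ball 0 r"
    using assms by (auto simp: analytic_on_def)
  show thesis
  proof (cases "\<exists>w\<in>ball 0 r. u w \<noteq> 0")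
    case False
    have "\<forall>\<^sub>F z in nhds 0. z \<in> ball 0 r" using r(1) by (intro eventually_nhds_in_open) auto
    then have "\<forall>\<^sub>F z in nhds 0. u z = 0" by (rule eventually_mono) (use False in auto)
    then show thesis by (rule that(1))
  next
    case True
    obtain s where s: "s > 0" "zor_poly u 0 holomorphic_on cball 0 s"
      "\<forall>w\<in>cball 0 s. u w = zor_poly u 0 w * (w - 0) ^ nat (zorder u 0) \<and> zor_poly u 0 w \<noteq> 0"
    proof -
      have "connected (ball (0::complex) r)" "(0::complex) \<in> ball 0 r" using r(1) by (auto intro: convex_connected)
      from zorder_exist_zero[OF r(2) open_ball this True] show thesis using that by blast
    qed
    have "\<forall>\<^sub>F z in nhds 0. z \<in> ball 0 s" using s(1) by (intro eventually_nhds_in_open) auto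
    then have "\<forall>\<^sub>F z in nhds 0. u z = z ^ nat (zorder u 0) * zor_poly u 0 z"
      by (rule eventually_mono) (use s in auto)
    moreover have "zor_poly u 0 analytic_on {0}"
      unfolding analytic_on_def using s holomorphic_on_subset[OF s(2) ball_subset_cball] by auto
    ultimately show thesis using s by (intro that(2)) auto
  qed
qed

lemma eventually_at_right_0_of_real:
  assumes "\<forall>\<^sub>F z in nhds (0::complex). P z"
  shows "\<forall>\<^sub>F t in at_right 0. P (complex_of_real t)"
proof -
  have "filterlim complex_of_real (nhds 0) (at_right 0)"
    using tendsto_of_real[OF tendsto_ident_at[of 0 "{0<..}"], where 'a=complex] by simp
  then show ?thesis using assms by (auto simp: filterlim_iff)
qed

text \<open>This makes regularized boundary values unique. If u = z^j v with v(0) nonzero, then c =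
  t^\<gamma> v(t) with \<gamma> = j + \<alpha> + 1, which is nonzero by regularity. Differentiating
  gives \<gamma> v(t) + t v'(t) = 0, and t tending to 0 contradicts v(0) \<noteq> 0.\<close>

lemma constant_powr_times_analytic:
  assumes "regular_exponent \<alpha>" "u analytic_on {0}"
    and ev: "\<forall>\<^sub>F t in at_right 0. c = of_real t powr (\<alpha> + 1) * u (of_real t)"
  shows "c = 0"
  using assms(2)
proof (cases rule: analytic_at_0_factor)
  case 1
  from eventually_at_right_0_of_real[OF 1] ev have "\<forall>\<^sub>F t::real in at_right 0. c = 0"
    by eventually_elim auto
  then show ?thesis by simp
next
  case (2 j v)
  define \<gamma> where "\<gamma> = of_nat j + \<alpha> + 1"
  have "\<gamma> \<noteq> 0" using regular_exponent_add_ne_0[OF assms(1)] by (simp add: \<gamma>_def)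
  obtain r where r: "r > 0" "v holomorphic_on ball 0 r"
    using 2 by (auto simp: analytic_on_def)
  have "\<forall>\<^sub>F t::real in at_right 0. t > 0" by (simp add: eventually_at_right_less)
  with eventually_at_right_0_of_real[OF 2(3)] ev
  have "\<forall>\<^sub>F t in at_right 0. c = of_real t powr \<gamma> * v (of_real t)"
    by eventually_elim (simp add: \<gamma>_def powr_add mult_ac)
  then obtain e where e: "e > 0" "\<And>t. 0 < t \<Longrightarrow> t < e \<Longrightarrow> c = of_real t powr \<gamma> * v (of_real t)"
    by (auto simp: eventually_at_right_field)
  have der: "\<gamma> * v (of_real t) + of_real t * deriv v (of_real t) = 0" if t: "0 < t" "t < min r e" for t
  proof -
    have "(v has_field_derivative deriv v (of_real t)) (at (of_real t))"
      using r t by (intro holomorphic_derivI[OF r(2)]) auto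
    from has_vector_derivative_powr_times[OF this t(1), of \<gamma>]
    have "((\<lambda>t. c) has_vector_derivative of_real t powr (\<gamma> - 1) * (\<gamma> * v (of_real t) + of_real t * deriv v (of_real t))) (at t)"
      by (rule has_vector_derivative_transform_within_open[where S="{0<..<e}"]) (use t e in auto)
    moreover have "((\<lambda>t. c) has_vector_derivative 0) (at t)" by (rule has_vector_derivative_const)
    ultimately have "of_real t powr (\<gamma> - 1) * (\<gamma> * v (of_real t) + of_real t * deriv v (of_real t)) = 0"
      by (rule vector_derivative_unique_at)
    then show ?thesis using t by simp
  qed
  have "continuous_on (ball 0 r) v" "continuous_on (ball 0 r) (deriv v)"
    using r holomorphic_deriv[OF r(2)] by (auto intro: holomorphic_on_imp_continuous_on)
  then have cont: "isCont v 0" "isCont (deriv v) 0"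
    using r by (auto simp: continuous_on_eq_continuous_at)
  have lim: "filterlim complex_of_real (nhds 0) (at_right 0)"
    using tendsto_of_real[OF tendsto_ident_at[of 0 "{0<..}"], where 'a=complex] by simp
  have "((\<lambda>t. \<gamma> * v (of_real t) + of_real t * deriv v (of_real t)) \<longlongrightarrow> \<gamma> * v 0 + 0 * deriv v 0) (at_right 0)"
    by (intro tendsto_intros lim isCont_tendsto_compose[OF cont(1) lim] isCont_tendsto_compose[OF cont(2) lim])
  moreover have "\<forall>\<^sub>F t in at_right 0. \<gamma> * v (of_real t) + of_real t * deriv v (of_real t) = 0"
    unfolding eventually_at_right_field using der r(1) e(1) by (intro exI[of _ "min r e"]) auto
  ultimately have "((\<lambda>t. 0) \<longlongrightarrow> \<gamma> * v 0 + 0 * deriv v 0) (at_right (0::real))"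
    by (rule Lim_transform_eventually)
  then have "\<gamma> * v 0 = 0" by (simp add: tendsto_const_iff)
  with \<open>\<gamma> \<noteq> 0\<close> 2(2) show ?thesis by simp
qed

text \<open>Termwise integration of the Taylor series yields a primitive z^(\<alpha>+1) U(z) without
  constant term. It differs from \<open>A\<close> by a constant \<open>L\<close>, the regularized
  value at 0, so the series in the definition of the finite part is A(\<xi>) - L.\<close>

lemma sums_fp_tail:
  fixes A :: "real \<Rightarrow> complex"
  assumes \<alpha>: "regular_exponent \<alpha>"
    and T: "open T" "convex T" "complex_of_real ` {0..<1} \<subseteq> T" "f holomorphic_on T"
    and A: "\<And>t. 0 < t \<Longrightarrow> t < 1 \<Longrightarrow> (A has_vector_derivative of_real t powr \<alpha> * f (of_real t)) (at t)"
  obtains L u where "u analytic_on {0}" "\<forall>\<^sub>F t in at_right 0. A t = L + of_real t powr (\<alpha> + 1) * u (of_real t)"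
    "\<And>\<xi>. 0 < \<xi> \<Longrightarrow> \<xi> < 1 \<Longrightarrow> ereal \<xi> < conv_radius (\<lambda>m. (deriv ^^ m) f 0 / fact m) \<Longrightarrow>
      (\<lambda>m. (deriv ^^ m) f 0 / fact m / (of_nat m + \<alpha> + 1) * of_real \<xi> powr (of_nat m + \<alpha> + 1)) sums (A \<xi> - L)"
    "conv_radius (\<lambda>m. (deriv ^^ m) f 0 / fact m) > 0"
proof -
  define a where "a = (\<lambda>m. (deriv ^^ m) f 0 / fact m)"
  define R where "R = conv_radius a"
  define U where "U = Abs_fps (\<lambda>m. a m / (of_nat m + \<alpha> + 1))"
  note U = fps_divide_shifted_index[OF \<alpha>, of a, folded U_def R_def]
  have "0 \<in> T" using T(3) by force
  then obtain r where r: "r > 0" "ball 0 r \<subseteq> T" using T(1) openE by blast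
  have ps: "(\<lambda>m. a m * z ^ m) sums f z" if "z \<in> ball 0 r" for z
    using holomorphic_power_series[OF holomorphic_on_subset[OF T(4) r(2)] that] by (simp add: a_def)
  have "R \<ge> r" unfolding R_def
  proof (rule conv_radius_geI_ex')
    fix r' assume "0 < r'" "ereal r' < ereal r"
    then have "complex_of_real r' \<in> ball 0 r" by auto
    from ps[OF this] show "summable (\<lambda>n. a n * complex_of_real r' ^ n)" by (rule sums_summable)
  qed
  then have R0: "R > 0" using r(1) by (metis ereal_less(2) less_le_trans)
  \<comment> \<open>An admissible cut point may lie anywhere below the radius \<open>R\<close>,
    whereas the series is known to represent \<open>f\<close> only on a small ball. The identity
    theorem on the connected set \<open>S\<close> carries the representation along the
    interval.\<close>
  define S where "S = T \<inter> eball 0 R"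
  have "convex (eball (0::complex) R)" by (cases R) (auto simp: eball_def convex_ball ball_def[symmetric] dist_norm intro: convex_ball[of 0, unfolded ball_def dist_norm, simplified])
  then have S: "open S" "connected S" "0 \<in> S" "f holomorphic_on S" "eval_fps (Abs_fps a) holomorphic_on S"
    using T R0 \<open>0 \<in> T\<close> unfolding S_def
    by (auto intro!: convex_connected convex_Int open_Int holomorphic_intros
          intro: holomorphic_on_subset simp: fps_conv_radius_def R_def zero_ereal_def)
  have f_eq: "f z = eval_fps (Abs_fps a) z" if "z \<in> S" for z
  proof (rule analytic_continuation_open[OF _ S(1) _ S(2) _ S(4,5) _ that])
    show "open (ball 0 r \<inter> S)" using S by auto
    show "ball 0 r \<inter> S \<noteq> {}" using S(3) r(1) by (metis IntI centre_in_ball empty_iff)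
    show "f z = eval_fps (Abs_fps a) z" if "z \<in> ball 0 r \<inter> S" for z
      using ps[of z] that by (auto simp: eval_fps_def sums_iff)
  qed auto
  \<comment> \<open>By the equation for \<open>U\<close> the derivative of \<open>B\<close>
    vanishes; its constant value is \<open>L\<close>.\<close>
  define B where "B = (\<lambda>t. A t - of_real t powr (\<alpha> + 1) * eval_fps U (of_real t))"
  have B': "(B has_vector_derivative 0) (at t)" if t: "0 < t" "t < 1" "ereal t < R" for t
  proof -
    have n: "ereal (norm (complex_of_real t)) < fps_conv_radius U" "ereal (norm (complex_of_real t)) < R"
      using t less_le_trans[OF t(3) U(1)] by simp_all
    have n': "ereal (norm (complex_of_real t)) < fps_conv_radius (fps_deriv U)"
      by (rule less_le_trans[OF n(1) fps_conv_radius_deriv])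
    have m: "ereal (norm (complex_of_real t)) < fps_conv_radius (fps_const (\<alpha> + 1) * U)"
      "ereal (norm (complex_of_real t)) < fps_conv_radius (fps_X * fps_deriv U)"
      using n n' by (auto intro!: less_le_trans[OF _ fps_conv_radius_mult])
    have "of_real t \<in> S" using t T(3) n by (force simp: S_def in_eball_iff)
    have "Abs_fps a = fps_const (\<alpha> + 1) * U + fps_X * fps_deriv U" by (simp add: U(2))
    then have "f (of_real t) = eval_fps (fps_const (\<alpha> + 1) * U + fps_X * fps_deriv U) (of_real t)"
      using f_eq[OF \<open>of_real t \<in> S\<close>] by simp
    also have "\<dots> = (\<alpha> + 1) * eval_fps U (of_real t) + of_real t * eval_fps (fps_deriv U) (of_real t)"
      using n n' m by (simp add: eval_fps_add eval_fps_mult)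
    finally have feq: "f (of_real t) = (\<alpha> + 1) * eval_fps U (of_real t) + of_real t * eval_fps (fps_deriv U) (of_real t)" .
    have "(eval_fps U has_field_derivative eval_fps (fps_deriv U) (of_real t)) (at (of_real t))"
      using n(1) by (rule has_field_derivative_eval_fps)
    from has_vector_derivative_diff[OF A[OF t(1,2)] has_vector_derivative_powr_times[OF this t(1), of "\<alpha> + 1"]]
    show ?thesis by (simp add: B_def feq)
  qed
  obtain L where L: "\<And>t. 0 < t \<Longrightarrow> t < 1 \<Longrightarrow> ereal t < R \<Longrightarrow> B t = L"
  proof -
    obtain c where c: "\<And>t. t \<in> {t. 0 < t \<and> t < 1 \<and> ereal t < R} \<Longrightarrow> B t = c"
    proof (rule has_vector_derivative_zero_constant[of "{t. 0 < t \<and> t < 1 \<and> ereal t < R}" B])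
      show "convex {t. 0 < t \<and> t < 1 \<and> ereal t < R}"
      proof -
        have "is_interval {t. 0 < t \<and> t < 1 \<and> ereal t < R}"
          unfolding is_interval_1 by clarsimp (metis ereal_less_eq(3) le_less_trans)
        then show ?thesis by (rule is_interval_convex)
      qed
      show "(B has_vector_derivative 0) (at x within {t. 0 < t \<and> t < 1 \<and> ereal t < R})"
        if "x \<in> {t. 0 < t \<and> t < 1 \<and> ereal t < R}" for x
        using B' that by (auto intro: has_vector_derivative_at_within)
    qed auto
    then show ?thesis by (intro that[of c]) auto
  qed
  have AL: "A t = L + of_real t powr (\<alpha> + 1) * eval_fps U (of_real t)" if "0 < t" "t < 1" "ereal t < R" for t
    using L[OF that] by (simp add: B_def algebra_simps)
  show thesis
  proof (rule that[of "eval_fps U" L])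
    have "ereal r \<le> fps_conv_radius U" using \<open>R \<ge> r\<close> U(1) by (rule order_trans)
    then have "eval_fps U holomorphic_on ball 0 r"
      by (intro holomorphic_intros) (auto simp: in_eball_iff intro!: less_le_trans[OF _ \<open>ereal r \<le> fps_conv_radius U\<close>])
    then show "eval_fps U analytic_on {0}" using r(1) by (auto simp: analytic_on_def)
    show "\<forall>\<^sub>F t in at_right 0. A t = L + of_real t powr (\<alpha> + 1) * eval_fps U (of_real t)"
      unfolding eventually_at_right_field
    proof (intro exI[of _ "min r 1"] conjI ballI impI allI)
      show "min r 1 > 0" using r(1) by simp
      fix t assume "0 < t" "t < min r 1"
      then show "A t = L + of_real t powr (\<alpha> + 1) * eval_fps U (of_real t)"
        using less_le_trans[OF _ \<open>R \<ge> r\<close>, of "ereal t"] by (intro AL) auto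
    qed
    show "conv_radius (\<lambda>m. (deriv ^^ m) f 0 / fact m) > 0" using R0 by (simp add: R_def a_def)
  next
    fix \<xi> :: real assume \<xi>: "0 < \<xi>" "\<xi> < 1" "ereal \<xi> < conv_radius (\<lambda>m. (deriv ^^ m) f 0 / fact m)"
    have "(\<lambda>m. fps_nth U m * of_real \<xi> ^ m) sums eval_fps U (of_real \<xi>)"
      using less_le_trans[OF \<xi>(3)[folded a_def, folded R_def] U(1)] \<xi>(1) by (intro sums_eval_fps) simp
    from sums_mult[OF this, of "of_real \<xi> powr (\<alpha> + 1)"]
    have "(\<lambda>m. of_real \<xi> powr (\<alpha> + 1) * (a m / (of_nat m + \<alpha> + 1) * of_real \<xi> ^ m)) sums
        (of_real \<xi> powr (\<alpha> + 1) * eval_fps U (of_real \<xi>))" by (simp add: U_def)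
    moreover have "of_real \<xi> powr (\<alpha> + 1) * (a m / (of_nat m + \<alpha> + 1) * of_real \<xi> ^ m)
        = a m / (of_nat m + \<alpha> + 1) * of_real \<xi> powr (of_nat m + \<alpha> + 1)" for m
      using \<xi> by (simp add: powr_add powr_nat' mult_ac)
    moreover have "of_real \<xi> powr (\<alpha> + 1) * eval_fps U (of_real \<xi>) = A \<xi> - L"
      using AL[of \<xi>] \<xi> by (simp add: R_def a_def)
    ultimately show "(\<lambda>m. (deriv ^^ m) f 0 / fact m / (of_nat m + \<alpha> + 1) * of_real \<xi> powr (of_nat m + \<alpha> + 1)) sums (A \<xi> - L)"
      unfolding a_def by (simp only:)
  qed
qed

section \<open>Hadamard finite parts\<close>

text \<open>\<open>A\<close> is a primitive of the weighted integrand, and \<open>L0\<close>, \<open>L1\<close> are its regularized boundary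
  values: what is left at an endpoint once the non-integer power is split off.\<close>

definition has_fp :: "complex \<Rightarrow> complex \<Rightarrow> (complex \<Rightarrow> complex) \<Rightarrow> complex \<Rightarrow> bool" where
  "has_fp \<alpha> \<beta> F I \<longleftrightarrow> (\<exists>(A :: real \<Rightarrow> complex) L0 L1 u v.
     (\<forall>t. 0 < t \<and> t < 1 \<longrightarrow>
        (A has_vector_derivative jacobi_weight \<alpha> \<beta> (of_real t) * F (of_real t)) (at t)) \<and>
     u analytic_on {0} \<and> v analytic_on {0} \<and>
     (\<forall>\<^sub>F t in at_right 0. A t = L0 + of_real t powr (\<alpha> + 1) * u (of_real t)) \<and>
     (\<forall>\<^sub>F t in at_right 0. A (1 - t) = L1 + of_real t powr (\<beta> + 1) * v (of_real t)) \<and>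
     I = L1 - L0)"

lemma has_fpI:
  assumes "\<And>t. 0 < t \<Longrightarrow> t < 1 \<Longrightarrow>
        (A has_vector_derivative jacobi_weight \<alpha> \<beta> (of_real t) * F (of_real t)) (at t)"
    "u analytic_on {0}" "v analytic_on {0}"
    "\<forall>\<^sub>F t in at_right 0. A t = L0 + of_real t powr (\<alpha> + 1) * u (of_real t)"
    "\<forall>\<^sub>F t in at_right 0. A (1 - t) = L1 + of_real t powr (\<beta> + 1) * v (of_real t)"
    "I = L1 - L0"
  shows "has_fp \<alpha> \<beta> F I"
  unfolding has_fp_def using assms by blast

lemma has_fpE:
  assumes "has_fp \<alpha> \<beta> F I"
  obtains A L0 L1 u v where
    "\<And>t. 0 < t \<Longrightarrow> t < 1 \<Longrightarrow>
        (A has_vector_derivative jacobi_weight \<alpha> \<beta> (of_real t) * F (of_real t)) (at t)"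
    "u analytic_on {0}" "v analytic_on {0}"
    "\<forall>\<^sub>F t in at_right 0. A t = L0 + of_real t powr (\<alpha> + 1) * u (of_real t)"
    "\<forall>\<^sub>F t in at_right 0. A (1 - t) = L1 + of_real t powr (\<beta> + 1) * v (of_real t)"
    "I = L1 - L0"
  using assms unfolding has_fp_def by blast

lemma regularized_value_unique:
  assumes "regular_exponent \<alpha>" "u analytic_on {0}" "v analytic_on {0}"
    "\<forall>\<^sub>F t in at_right 0. A t = L + of_real t powr (\<alpha> + 1) * u (of_real t)"
    "\<forall>\<^sub>F t in at_right 0. A t = M + of_real t powr (\<alpha> + 1) * v (of_real t)"
  shows "L = (M :: complex)"
proof -
  have "\<forall>\<^sub>F t in at_right 0. M - L = of_real t powr (\<alpha> + 1) * (u (of_real t) - v (of_real t))"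
    using assms(4,5) by eventually_elim (simp add: algebra_simps)
  then have "M - L = 0"
    using assms by (intro constant_powr_times_analytic[where u="\<lambda>z. u z - v z"] analytic_intros) auto
  then show ?thesis by simp
qed

section \<open>Agreement with the definition by series\<close>

lemma one_minus_in_segment: "z \<in> complex_of_real ` {0..1} \<Longrightarrow> 1 - z \<in> complex_of_real ` {0..1}"
proof -
  assume "z \<in> complex_of_real ` {0..1}"
  then obtain x where "x \<in> {0..1}" "z = of_real x" by auto
  then have "1 - z = of_real (1 - x)" "1 - x \<in> {0..1}" by auto
  then show ?thesis by blast
qed

lemma analytic_on_segment_reflect:
  assumes "F analytic_on complex_of_real ` {0..1}"
  shows "(\<lambda>z. F (1 - z)) analytic_on complex_of_real ` {0..1}"
proof -
  have "(\<lambda>z. 1 - z) analytic_on complex_of_real ` {0..1}" by (intro analytic_intros)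
  from analytic_on_compose_gen[OF this assms] one_minus_in_segment show ?thesis
    by (simp add: o_def)
qed

lemma weight_factor_0:
  assumes "F analytic_on complex_of_real ` {0..1}"
  obtains T where "open T" "convex T" "complex_of_real ` {0..<1} \<subseteq> T"
    "(\<lambda>t. (1 - t) powr \<beta> * F t) holomorphic_on T"
proof -
  obtain T where T: "open T" "convex T" "complex_of_real ` {0..1} \<subseteq> T" "F holomorphic_on T"
    by (rule analytic_on_segment_convex_nhd[OF assms])
  have "(\<lambda>t. (1 - t) powr \<beta> * F t) holomorphic_on T \<inter> {z. Re z < 1}"
    using T(4) by (intro holomorphic_intros) (auto simp: complex_nonpos_Reals_iff intro: holomorphic_on_subset)
  moreover have "complex_of_real ` {0..<1} \<subseteq> T \<inter> {z. Re z < 1}" using T(3) by auto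
  moreover have "open (T \<inter> {z. Re z < 1})" "convex (T \<inter> {z. Re z < 1})"
    using T by (auto intro!: open_Int convex_Int open_halfspace_Re_lt convex_halfspace_Re_lt)
  ultimately show ?thesis by (intro that)
qed

text \<open>The three pieces of \<open>fp_value\<close> are A(\<xi>0) - L0, A(\<xi>1) - A(\<xi>0)
  and L1 - A(\<xi>1). They telescope, which is why the cut points do not matter.\<close>

lemma fp_data:
  assumes F: "F analytic_on complex_of_real ` {0..1}"
    and reg: "regular_exponent \<alpha>" "regular_exponent \<beta>"
    and A: "\<And>t. 0 < t \<Longrightarrow> t < 1 \<Longrightarrow>
        (A has_vector_derivative jacobi_weight \<alpha> \<beta> (of_real t) * F (of_real t)) (at t)"
  obtains L0 L1 u v where "u analytic_on {0}" "v analytic_on {0}"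
    "\<forall>\<^sub>F t in at_right 0. A t = L0 + of_real t powr (\<alpha> + 1) * u (of_real t)"
    "\<forall>\<^sub>F t in at_right 0. A (1 - t) = L1 + of_real t powr (\<beta> + 1) * v (of_real t)"
    "\<And>\<xi>0 \<xi>1. fp_admissible \<alpha> \<beta> F \<xi>0 \<xi>1 \<Longrightarrow> fp_value \<alpha> \<beta> F \<xi>0 \<xi>1 = L1 - L0"
    "\<exists>\<xi>0 \<xi>1. fp_admissible \<alpha> \<beta> F \<xi>0 \<xi>1"
proof -
  let ?f = "\<lambda>t. (1 - t) powr \<beta> * F t" and ?g = "\<lambda>t. (1 - t) powr \<alpha> * F (1 - t)"
  obtain S where S: "open S" "convex S" "complex_of_real ` {0..<1} \<subseteq> S" "?f holomorphic_on S"
    by (rule weight_factor_0[OF F])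
  obtain T where T: "open T" "convex T" "complex_of_real ` {0..<1} \<subseteq> T" "?g holomorphic_on T"
    by (rule weight_factor_0[OF analytic_on_segment_reflect[OF F]])
  have A0: "(A has_vector_derivative of_real t powr \<alpha> * ?f (of_real t)) (at t)" if "0 < t" "t < 1" for t
    using A[OF that] by (simp add: jacobi_weight_def mult.assoc)
  \<comment> \<open>The right endpoint is treated as a left endpoint after t \<mapsto> 1 - t. The
    reflection reverses orientation, hence the minus sign here and the negated \<open>L1\<close> and
    \<open>v\<close> below.\<close>
  define B where "B = (\<lambda>s. - A (1 - s))"
  have A1: "(B has_vector_derivative of_real t powr \<beta> * ?g (of_real t)) (at t)"
    if "0 < t" "t < 1" for t
  proof -
    have "((\<lambda>s. 1 - s) has_vector_derivative -1) (at t)" by (auto intro!: derivative_eq_intros)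
    moreover have "(A has_vector_derivative jacobi_weight \<alpha> \<beta> (of_real (1 - t)) * F (of_real (1 - t))) (at (1 - t))"
      using A[of "1 - t"] that by simp
    ultimately have "((A \<circ> (\<lambda>s. 1 - s)) has_vector_derivative
        -1 *\<^sub>R (jacobi_weight \<alpha> \<beta> (of_real (1 - t)) * F (of_real (1 - t)))) (at t)"
      by (rule vector_diff_chain_at)
    from has_vector_derivative_minus[OF this] show ?thesis
      by (simp add: o_def jacobi_weight_def mult_ac B_def)
  qed
  obtain L0 u where L0: "u analytic_on {0}"
      "\<forall>\<^sub>F t in at_right 0. A t = L0 + of_real t powr (\<alpha> + 1) * u (of_real t)"
      "\<And>\<xi>. 0 < \<xi> \<Longrightarrow> \<xi> < 1 \<Longrightarrow> ereal \<xi> < conv_radius (\<lambda>m. (deriv ^^ m) ?f 0 / fact m) \<Longrightarrow>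
      (\<lambda>m. (deriv ^^ m) ?f 0 / fact m / (of_nat m + \<alpha> + 1) * of_real \<xi> powr (of_nat m + \<alpha> + 1)) sums (A \<xi> - L0)"
      "conv_radius (\<lambda>m. (deriv ^^ m) ?f 0 / fact m) > 0"
    by (rule sums_fp_tail[OF reg(1) S A0]) (assumption | rule that)+
  obtain L1 v where L1: "v analytic_on {0}"
      "\<forall>\<^sub>F t in at_right 0. B t = L1 + of_real t powr (\<beta> + 1) * v (of_real t)"
      "\<And>\<xi>. 0 < \<xi> \<Longrightarrow> \<xi> < 1 \<Longrightarrow> ereal \<xi> < conv_radius (\<lambda>m. (deriv ^^ m) ?g 0 / fact m) \<Longrightarrow>
      (\<lambda>m. (deriv ^^ m) ?g 0 / fact m / (of_nat m + \<beta> + 1) * of_real \<xi> powr (of_nat m + \<beta> + 1)) sums (B \<xi> - L1)"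
      "conv_radius (\<lambda>m. (deriv ^^ m) ?g 0 / fact m) > 0"
    by (rule sums_fp_tail[OF reg(2) T A1]) (assumption | rule that)+
  have cf: "fp_coeff \<beta> F = (\<lambda>m. (deriv ^^ m) ?f 0 / fact m)"
     "fp_coeff \<alpha> (\<lambda>s. F (1 - s)) = (\<lambda>m. (deriv ^^ m) ?g 0 / fact m)"
    by (auto simp: fp_coeff_def)
  show thesis
  proof (rule that[of u "\<lambda>z. - v z" L0 "- L1"])
    show "u analytic_on {0}" "(\<lambda>z. - v z) analytic_on {0}" using L0 L1 by (auto intro!: analytic_intros)
    show "\<forall>\<^sub>F t in at_right 0. A t = L0 + of_real t powr (\<alpha> + 1) * u (of_real t)" by (rule L0(2))
    show "\<forall>\<^sub>F t in at_right 0. A (1 - t) = - L1 + of_real t powr (\<beta> + 1) * - v (of_real t)"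
      using L1(2)
    proof eventually_elim
      case (elim t)
      from arg_cong[OF elim, of uminus] show ?case by (simp add: B_def)
    qed
  next
    fix \<xi>0 \<xi>1 assume "fp_admissible \<alpha> \<beta> F \<xi>0 \<xi>1"
    then have \<xi>: "0 < \<xi>0" "\<xi>0 \<le> \<xi>1" "\<xi>1 < 1" "ereal \<xi>0 < conv_radius (fp_coeff \<beta> F)"
      "ereal (1 - \<xi>1) < conv_radius (fp_coeff \<alpha> (\<lambda>s. F (1 - s)))" by (auto simp: fp_admissible_def)
    have "((\<lambda>t. jacobi_weight \<alpha> \<beta> (of_real t) * F (of_real t)) has_integral A \<xi>1 - A \<xi>0) {\<xi>0..\<xi>1}"
    proof (rule fundamental_theorem_of_calculus)
      fix t assume "t \<in> {\<xi>0..\<xi>1}"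
      with \<xi> have "0 < t" "t < 1" by auto
      from A[OF this] show "(A has_vector_derivative jacobi_weight \<alpha> \<beta> (of_real t) * F (of_real t)) (at t within {\<xi>0..\<xi>1})"
        by (rule has_vector_derivative_at_within)
    qed (use \<xi> in auto)
    then have "integral {\<xi>0..\<xi>1} (\<lambda>t. jacobi_weight \<alpha> \<beta> (of_real t) * F (of_real t)) = A \<xi>1 - A \<xi>0"
      by (rule integral_unique)
    moreover have "(\<Sum>m. fp_coeff \<beta> F m / (of_nat m + \<alpha> + 1) * of_real \<xi>0 powr (of_nat m + \<alpha> + 1)) = A \<xi>0 - L0"
      using sums_unique[OF L0(3)[OF \<xi>(1) _ \<xi>(4)[unfolded cf(1)]]] \<xi>(2,3) unfolding cf(1) by simp
    moreover have "(\<Sum>m. fp_coeff \<alpha> (\<lambda>s. F (1 - s)) m / (of_nat m + \<beta> + 1) *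
            of_real (1 - \<xi>1) powr (of_nat m + \<beta> + 1)) = B (1 - \<xi>1) - L1"
      using sums_unique[OF L1(3)[OF _ _ \<xi>(5)[unfolded cf(2)]]] \<xi>(1-3) unfolding cf(2) by simp
    ultimately show "fp_value \<alpha> \<beta> F \<xi>0 \<xi>1 = - L1 - L0" by (simp add: fp_value_def B_def)
  next
    \<comment> \<open>An admissible pair must exist: otherwise the condition inside
      \<open>fp_integral\<close> would be vacuous and \<open>THE\<close> would not determine a
      value.\<close>
    obtain r0 where "0 < ereal r0" and r0: "ereal r0 < conv_radius (fp_coeff \<beta> F)"
      using ereal_dense2[OF L0(4)] unfolding cf(1) by blast
    obtain r1 where "0 < ereal r1" and r1: "ereal r1 < conv_radius (fp_coeff \<alpha> (\<lambda>s. F (1 - s)))"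
      using ereal_dense2[OF L1(4)] unfolding cf(2) by blast
    have pos: "0 < r0" "0 < r1" using \<open>0 < ereal r0\<close> \<open>0 < ereal r1\<close> by simp_all
    \<comment> \<open>Capping both radii at 1/2 ensures \<xi>0 \<le> 1/2 \<le> \<xi>1.\<close>
    have "ereal (min r0 (1/2)) \<le> ereal r0" "ereal (min r1 (1/2)) \<le> ereal r1" by auto
    note le_less_trans[OF this(1) r0] le_less_trans[OF this(2) r1]
    then have "fp_admissible \<alpha> \<beta> F (min r0 (1/2)) (1 - min r1 (1/2))"
      unfolding fp_admissible_def using pos by (simp add: min_def)
    then show "\<exists>\<xi>0 \<xi>1. fp_admissible \<alpha> \<beta> F \<xi>0 \<xi>1" by blast
  qed
qed

lemma has_fp_exists:
  assumes F: "F analytic_on complex_of_real ` {0..1}"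
    and reg: "regular_exponent \<alpha>" "regular_exponent \<beta>"
  shows "\<exists>I. has_fp \<alpha> \<beta> F I"
proof -
  obtain T where T: "open T" "convex T" "complex_of_real ` {0..1} \<subseteq> T" "F holomorphic_on T"
    by (rule analytic_on_segment_convex_nhd[OF F])
  \<comment> \<open>On this convex part of the strip both power factors stay off their branch cuts,
    so a holomorphic primitive exists; its restriction to (0,1) serves as \<open>A\<close>.\<close>
  let ?S = "T \<inter> {z. Re z > 0} \<inter> {z. Re z < 1}"
  have "(\<lambda>t. jacobi_weight \<alpha> \<beta> t * F t) holomorphic_on ?S"
    unfolding jacobi_weight_def using T(4)
    by (intro holomorphic_intros) (auto simp: complex_nonpos_Reals_iff intro: holomorphic_on_subset)
  moreover have "open ?S" "convex ?S"
    using T by (auto intro!: open_Int convex_Int open_halfspace_Re_lt convex_halfspace_Re_lt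
        open_halfspace_Re_gt convex_halfspace_Re_gt)
  ultimately obtain G where G: "\<And>x. x \<in> ?S \<Longrightarrow> (G has_field_derivative jacobi_weight \<alpha> \<beta> x * F x) (at x within ?S)"
    using holomorphic_convex_primitive'[of ?S] by blast
  have "((\<lambda>t. G (of_real t)) has_vector_derivative jacobi_weight \<alpha> \<beta> (of_real t) * F (of_real t)) (at t)"
    if "0 < t" "t < 1" for t
  proof -
    have "of_real t \<in> ?S" using that T(3) by force
    from G[OF this] have "(G has_field_derivative jacobi_weight \<alpha> \<beta> (of_real t) * F (of_real t)) (at (of_real t))"
      using at_within_open[OF \<open>of_real t \<in> ?S\<close> \<open>open ?S\<close>] by simp
    then show ?thesis by (rule has_vector_derivative_real_field)
  qed
  note der = this
  obtain L0 L1 u v where "u analytic_on {0}" "v analytic_on {0}"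
    "\<forall>\<^sub>F t in at_right 0. G (of_real t) = L0 + of_real t powr (\<alpha> + 1) * u (of_real t)"
    "\<forall>\<^sub>F t in at_right 0. G (of_real (1 - t)) = L1 + of_real t powr (\<beta> + 1) * v (of_real t)"
    by (rule fp_data[OF F reg der]) (assumption | rule that)+
  then have "has_fp \<alpha> \<beta> F (L1 - L0)"
    by (intro has_fpI[where A="\<lambda>t. G (of_real t)", OF der]) auto
  then show ?thesis by blast
qed

lemma fp_integral_eqI:
  assumes F: "F analytic_on complex_of_real ` {0..1}"
    and reg: "regular_exponent \<alpha>" "regular_exponent \<beta>" and I: "has_fp \<alpha> \<beta> F I"
  shows "fp_integral \<alpha> \<beta> F = I"
proof -
  obtain A L0 L1 u v where A:
    "\<And>t. 0 < t \<Longrightarrow> t < 1 \<Longrightarrow>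
        (A has_vector_derivative jacobi_weight \<alpha> \<beta> (of_real t) * F (of_real t)) (at t)"
    "u analytic_on {0}" "v analytic_on {0}"
    "\<forall>\<^sub>F t in at_right 0. A t = L0 + of_real t powr (\<alpha> + 1) * u (of_real t)"
    "\<forall>\<^sub>F t in at_right 0. A (1 - t) = L1 + of_real t powr (\<beta> + 1) * v (of_real t)"
    "I = L1 - L0"
    using I by (rule has_fpE) (rule that)
  obtain M0 M1 u' v' where M: "u' analytic_on {0}" "v' analytic_on {0}"
    "\<forall>\<^sub>F t in at_right 0. A t = M0 + of_real t powr (\<alpha> + 1) * u' (of_real t)"
    "\<forall>\<^sub>F t in at_right 0. A (1 - t) = M1 + of_real t powr (\<beta> + 1) * v' (of_real t)"
    "\<And>\<xi>0 \<xi>1. fp_admissible \<alpha> \<beta> F \<xi>0 \<xi>1 \<Longrightarrow> fp_value \<alpha> \<beta> F \<xi>0 \<xi>1 = M1 - M0"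
    "\<exists>\<xi>0 \<xi>1. fp_admissible \<alpha> \<beta> F \<xi>0 \<xi>1"
    by (rule fp_data[OF F reg A(1)]) (assumption | rule that)+
  have "L0 = M0" using regularized_value_unique[OF reg(1) A(2) M(1) A(4) M(3)] .
  moreover have "L1 = M1" using regularized_value_unique[OF reg(2) A(3) M(2) A(5) M(4)] .
  ultimately have v: "\<And>\<xi>0 \<xi>1. fp_admissible \<alpha> \<beta> F \<xi>0 \<xi>1 \<Longrightarrow> fp_value \<alpha> \<beta> F \<xi>0 \<xi>1 = I"
    using M(5) A(6) by simp
  show ?thesis unfolding fp_integral_def
    by (rule the_equality) (use v M(6) in blast)+
qed

lemma has_fp_fp_integral:
  assumes "F analytic_on complex_of_real ` {0..1}" "regular_exponent \<alpha>" "regular_exponent \<beta>"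
  shows "has_fp \<alpha> \<beta> F (fp_integral \<alpha> \<beta> F)"
  using has_fp_exists[OF assms] fp_integral_eqI[OF assms] by metis

section \<open>Calculation rules for finite parts\<close>

lemma has_fp_cong:
  assumes "\<And>t. 0 < t \<Longrightarrow> t < 1 \<Longrightarrow> F (complex_of_real t) = G (of_real t)" "has_fp \<alpha> \<beta> F I"
  shows "has_fp \<alpha> \<beta> G I"
  using assms(2)
proof (rule has_fpE)
  fix A L0 L1 u v
  assume A: "\<And>t. 0 < t \<Longrightarrow> t < 1 \<Longrightarrow>
        (A has_vector_derivative jacobi_weight \<alpha> \<beta> (of_real t) * F (of_real t)) (at t)"
    "u analytic_on {0}" "v analytic_on {0}"
    "\<forall>\<^sub>F t in at_right 0. A t = L0 + of_real t powr (\<alpha> + 1) * u (of_real t)"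
    "\<forall>\<^sub>F t in at_right 0. A (1 - t) = L1 + of_real t powr (\<beta> + 1) * v (of_real t)"
    "I = L1 - L0"
  show ?thesis by (rule has_fpI[OF _ A(2-6)]) (use A(1) assms(1) in auto)
qed

lemma has_fp_linear:
  assumes "has_fp \<alpha> \<beta> F I" "has_fp \<alpha> \<beta> G J"
  shows "has_fp \<alpha> \<beta> (\<lambda>t. a * F t + b * G t) (a * I + b * J)"
proof -
  from assms(1) obtain A L0 L1 u v where A:
    "\<And>t. 0 < t \<Longrightarrow> t < 1 \<Longrightarrow>
        (A has_vector_derivative jacobi_weight \<alpha> \<beta> (of_real t) * F (of_real t)) (at t)"
    "u analytic_on {0}" "v analytic_on {0}"
    "\<forall>\<^sub>F t in at_right 0. A t = L0 + of_real t powr (\<alpha> + 1) * u (of_real t)"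
    "\<forall>\<^sub>F t in at_right 0. A (1 - t) = L1 + of_real t powr (\<beta> + 1) * v (of_real t)"
    "I = L1 - L0"
    by (rule has_fpE) (rule that)
  from assms(2) obtain B M0 M1 x y where B:
    "\<And>t. 0 < t \<Longrightarrow> t < 1 \<Longrightarrow>
        (B has_vector_derivative jacobi_weight \<alpha> \<beta> (of_real t) * G (of_real t)) (at t)"
    "x analytic_on {0}" "y analytic_on {0}"
    "\<forall>\<^sub>F t in at_right 0. B t = M0 + of_real t powr (\<alpha> + 1) * x (of_real t)"
    "\<forall>\<^sub>F t in at_right 0. B (1 - t) = M1 + of_real t powr (\<beta> + 1) * y (of_real t)"
    "J = M1 - M0"
    by (rule has_fpE) (rule that)
  show ?thesis
  proof (rule has_fpI[where A="\<lambda>t. a * A t + b * B t" and u="\<lambda>t. a * u t + b * x t"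
        and v="\<lambda>t. a * v t + b * y t" and ?L0.0="a * L0 + b * M0" and ?L1.0="a * L1 + b * M1"])
    show "((\<lambda>t. a * A t + b * B t) has_vector_derivative
        jacobi_weight \<alpha> \<beta> (of_real t) * (a * F (of_real t) + b * G (of_real t))) (at t)" if "0 < t" "t < 1" for t
      using has_vector_derivative_add[OF has_vector_derivative_mult_right[OF A(1)[OF that], of a]
          has_vector_derivative_mult_right[OF B(1)[OF that], of b]]
      by (simp add: algebra_simps)
    show "\<forall>\<^sub>F t in at_right 0. a * A t + b * B t = a * L0 + b * M0 +
       of_real t powr (\<alpha> + 1) * (a * u (of_real t) + b * x (of_real t))"
      using A(4) B(4) by eventually_elim (simp add: algebra_simps)
    show "\<forall>\<^sub>F t in at_right 0. a * A (1 - t) + b * B (1 - t) = a * L1 + b * M1 +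
       of_real t powr (\<beta> + 1) * (a * v (of_real t) + b * y (of_real t))"
      using A(5) B(5) by eventually_elim (simp add: algebra_simps)
    show "a * I + b * J = a * L1 + b * M1 - (a * L0 + b * M0)" unfolding A(6) B(6) by (simp add: algebra_simps)
  qed (use A B in \<open>auto intro!: analytic_intros\<close>)
qed

text \<open>The same primitive works for both exponents: at 0 the additional factor t of the power
  is absorbed into the germ, which becomes t u(t).\<close>

lemma has_fp_shift_left:
  assumes "has_fp (\<alpha> + 1) \<beta> F I"
  shows "has_fp \<alpha> \<beta> (\<lambda>t. t * F t) I"
proof -
  from assms obtain A L0 L1 u v where A:
    "\<And>t. 0 < t \<Longrightarrow> t < 1 \<Longrightarrow>
        (A has_vector_derivative jacobi_weight (\<alpha> + 1) \<beta> (of_real t) * F (of_real t)) (at t)"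
    "u analytic_on {0}" "v analytic_on {0}"
    "\<forall>\<^sub>F t in at_right 0. A t = L0 + of_real t powr ((\<alpha> + 1) + 1) * u (of_real t)"
    "\<forall>\<^sub>F t in at_right 0. A (1 - t) = L1 + of_real t powr (\<beta> + 1) * v (of_real t)"
    "I = L1 - L0"
    by (rule has_fpE) (rule that)
  show ?thesis
  proof (rule has_fpI[where A=A and u="\<lambda>t. t * u t" and v=v and ?L0.0=L0 and ?L1.0=L1])
    show "(A has_vector_derivative
        jacobi_weight \<alpha> \<beta> (of_real t) * (of_real t * F (of_real t))) (at t)" if "0 < t" "t < 1" for t
      using A(1)[OF that] that by (simp add: jacobi_weight_def powr_add mult_ac)
    show "\<forall>\<^sub>F t in at_right 0. A t = L0 + of_real t powr (\<alpha> + 1) * (of_real t * u (of_real t))"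
      using A(4) eventually_at_right_less[of "0::real"]
    proof eventually_elim
      case (elim t)
      have "complex_of_real t powr ((\<alpha> + 1) + 1) = of_real t powr (\<alpha> + 1) * of_real t"
        using elim by (subst powr_add) auto
      with elim show ?case by (simp only: mult.assoc)
    qed
  qed (use A in \<open>auto intro!: analytic_intros\<close>)
qed

lemma has_fp_reflect:
  assumes "has_fp \<alpha> \<beta> F I"
  shows "has_fp \<beta> \<alpha> (\<lambda>t. F (1 - t)) I"
proof -
  from assms obtain A L0 L1 u v where A:
    "\<And>t. 0 < t \<Longrightarrow> t < 1 \<Longrightarrow>
        (A has_vector_derivative jacobi_weight \<alpha> \<beta> (of_real t) * F (of_real t)) (at t)"
    "u analytic_on {0}" "v analytic_on {0}"
    "\<forall>\<^sub>F t in at_right 0. A t = L0 + of_real t powr (\<alpha> + 1) * u (of_real t)"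
    "\<forall>\<^sub>F t in at_right 0. A (1 - t) = L1 + of_real t powr (\<beta> + 1) * v (of_real t)"
    "I = L1 - L0"
    by (rule has_fpE) (rule that)
  show ?thesis
  proof (rule has_fpI[where A="\<lambda>t. - A (1 - t)" and u="\<lambda>t. - v t" and v="\<lambda>t. - u t" and ?L0.0="- L1" and ?L1.0="-L0"])
    show "((\<lambda>t. - A (1 - t)) has_vector_derivative
        jacobi_weight \<beta> \<alpha> (of_real t) * (F (1 - of_real t))) (at t)" if "0 < t" "t < 1" for t
    proof -
      have "((\<lambda>s. 1 - s) has_vector_derivative -1) (at t)" by (auto intro!: derivative_eq_intros)
      moreover have "(A has_vector_derivative jacobi_weight \<alpha> \<beta> (of_real (1 - t)) * F (of_real (1 - t))) (at (1 - t))"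
        using A(1)[of "1 - t"] that by simp
      ultimately have "((A \<circ> (\<lambda>s. 1 - s)) has_vector_derivative
          -1 *\<^sub>R (jacobi_weight \<alpha> \<beta> (of_real (1 - t)) * F (of_real (1 - t)))) (at t)"
        by (rule vector_diff_chain_at)
      from has_vector_derivative_minus[OF this] show ?thesis
        by (simp add: o_def jacobi_weight_def mult_ac)
    qed
    show "\<forall>\<^sub>F t in at_right 0. - A (1 - t) = - L1 + of_real t powr (\<beta> + 1) * - v (of_real t)"
      using A(5) by eventually_elim (simp add: algebra_simps)
    show "\<forall>\<^sub>F t in at_right 0. - A (1 - (1 - t)) = - L0 + of_real t powr (\<alpha> + 1) * - u (of_real t)"
      using A(4) by eventually_elim (simp add: algebra_simps)
  qed (use A in \<open>auto intro!: analytic_intros\<close>)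
qed

text \<open>The primitive is t^(\<alpha>+1) (1-t)^(\<beta>+1) F(t) itself. At either end it is
  purely a power times a germ, so both regularized values are 0.\<close>

lemma has_fp_derivative:
  assumes F: "F analytic_on complex_of_real ` {0..1}"
  shows "has_fp \<alpha> \<beta> (\<lambda>t. ((\<alpha> + 1) * (1 - t) - (\<beta> + 1) * t) * F t + t * (1 - t) * deriv F t) 0"
proof -
  let ?A = "\<lambda>t. (complex_of_real t) powr (\<alpha> + 1) * ((1 - of_real t) powr (\<beta> + 1) * F (of_real t))"
  have F0: "F analytic_on {0}" "F analytic_on {1}"
    using F by (auto intro: analytic_on_subset)
  obtain T where T: "open T" "complex_of_real ` {0..1} \<subseteq> T" "F holomorphic_on T"
    using F by (auto simp: analytic_on_holomorphic)
  show ?thesis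
  proof (rule has_fpI[where A="?A" and u="\<lambda>t. (1 - t) powr (\<beta> + 1) * F t"
        and v="\<lambda>t. (1 - t) powr (\<alpha> + 1) * F (1 - t)" and ?L0.0=0 and ?L1.0=0])
    show "(?A has_vector_derivative jacobi_weight \<alpha> \<beta> (of_real t) *
        (((\<alpha> + 1) * (1 - of_real t) - (\<beta> + 1) * of_real t) * F (of_real t) + of_real t * (1 - of_real t) * deriv F (of_real t))) (at t)"
      if t: "0 < t" "t < 1" for t
    proof -
      have "of_real t \<in> T" using t T(2) by force
      then have "(F has_field_derivative deriv F (of_real t)) (at (of_real t))"
        using T by (metis holomorphic_derivI)
      moreover have "1 - complex_of_real t \<notin> \<real>\<^sub>\<le>\<^sub>0" using t by (auto simp: complex_nonpos_Reals_iff)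
      ultimately have "((\<lambda>z. (1 - z) powr (\<beta> + 1) * F z) has_field_derivative
          - (\<beta> + 1) * (1 - of_real t) powr \<beta> * F (of_real t) + (1 - of_real t) powr (\<beta> + 1) * deriv F (of_real t)) (at (of_real t))"
        by (auto intro!: derivative_eq_intros simp: algebra_simps)
      from has_vector_derivative_powr_times[OF this t(1), of "\<alpha> + 1"]
      have "(?A has_vector_derivative
        of_real t powr \<alpha> * ((\<alpha> + 1) * ((1 - of_real t) powr (\<beta> + 1) * F (of_real t)) +
        of_real t * (- (\<beta> + 1) * (1 - of_real t) powr \<beta> * F (of_real t) + (1 - of_real t) powr (\<beta> + 1) * deriv F (of_real t)))) (at t)"
        by simp
      also have "(1 - complex_of_real t) powr (\<beta> + 1) = (1 - of_real t) powr \<beta> * (1 - of_real t)"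
        using t by (simp add: powr_add)
      finally show ?thesis
        by (simp add: jacobi_weight_def algebra_simps)
    qed
    show "(\<lambda>t. (1 - t) powr (\<beta> + 1) * F t) analytic_on {0}"
      using F0 by (auto intro!: analytic_intros)
    have "(\<lambda>t. F (1 - t)) analytic_on {0}"
      using analytic_on_segment_reflect[OF F] by (rule analytic_on_subset) auto
    then show "(\<lambda>t. (1 - t) powr (\<alpha> + 1) * F (1 - t)) analytic_on {0}"
      by (auto intro!: analytic_intros)
  qed (auto simp: mult_ac)
qed

section \<open>The Stieltjes transform of the weight\<close>

text \<open>Raising both exponents by large integers reaches the base region, and the two step rules
  lead back. The threshold \<open>r\<close> is a parameter because the expansion at 0 needs a base
  region with one unit to spare, while the other applications start from positive real
  parts.\<close>

lemma exponent_induct [consumes 2, case_names base left right]: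
  assumes "regular_exponent \<alpha>" "regular_exponent \<beta>"
    and base: "\<And>\<alpha> \<beta>. regular_exponent \<alpha> \<Longrightarrow> regular_exponent \<beta> \<Longrightarrow> Re \<alpha> > r \<Longrightarrow> Re \<beta> > r \<Longrightarrow> P \<alpha> \<beta>"
    and left: "\<And>\<alpha> \<beta>. regular_exponent \<alpha> \<Longrightarrow> regular_exponent \<beta> \<Longrightarrow> P (\<alpha> + 1) \<beta> \<Longrightarrow> P \<alpha> \<beta>"
    and right: "\<And>\<alpha> \<beta>. regular_exponent \<alpha> \<Longrightarrow> regular_exponent \<beta> \<Longrightarrow> P \<alpha> (\<beta> + 1) \<Longrightarrow> P \<alpha> \<beta>"
  shows "P \<alpha> \<beta>"
proof -
  have l: "P (\<alpha> + of_nat n) \<beta> \<Longrightarrow> P \<alpha> \<beta>" if "regular_exponent \<alpha>" "regular_exponent \<beta>" for \<alpha> \<beta> n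
  proof (induction n)
    case (Suc n)
    have "P (\<alpha> + of_nat n) \<beta>"
      by (rule left) (use Suc.prems that in \<open>simp_all add: algebra_simps regular_exponent_plus_nat\<close>)
    then show ?case by (rule Suc.IH)
  qed simp
  have r: "P \<alpha> (\<beta> + of_nat n) \<Longrightarrow> P \<alpha> \<beta>" if "regular_exponent \<alpha>" "regular_exponent \<beta>" for \<alpha> \<beta> n
  proof (induction n)
    case (Suc n)
    have "P \<alpha> (\<beta> + of_nat n)"
      by (rule right) (use Suc.prems that in \<open>simp_all add: algebra_simps regular_exponent_plus_nat\<close>)
    then show ?case by (rule Suc.IH)
  qed simp
  obtain n where n: "real n > r - Re \<alpha>" using reals_Archimedean2 by blast
  obtain m where m: "real m > r - Re \<beta>" using reals_Archimedean2 by blast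
  have "P (\<alpha> + of_nat n) (\<beta> + of_nat m)"
    by (rule base) (use n m assms(1,2) in \<open>auto intro: regular_exponent_plus_nat\<close>)
  then show ?thesis
    using l[OF assms(1) regular_exponent_plus_nat[OF assms(2)]] r[OF assms(1,2)] by blast
qed

context
  fixes \<alpha> \<beta> :: complex
  assumes reg: "regular_exponent \<alpha>" "regular_exponent \<beta>"
begin

lemma fp_integral_linear:
  assumes "F analytic_on complex_of_real ` {0..1}" "G analytic_on complex_of_real ` {0..1}"
  shows "fp_integral \<alpha> \<beta> (\<lambda>t. a * F t + b * G t) = a * fp_integral \<alpha> \<beta> F + b * fp_integral \<alpha> \<beta> G"
  using assms reg by (intro fp_integral_eqI has_fp_linear has_fp_fp_integral analytic_intros)

lemma fp_integral_cong:
  assumes "F analytic_on complex_of_real ` {0..1}" "G analytic_on complex_of_real ` {0..1}"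
    and "\<And>t. 0 < t \<Longrightarrow> t < 1 \<Longrightarrow> F (complex_of_real t) = G (of_real t)"
  shows "fp_integral \<alpha> \<beta> F = fp_integral \<alpha> \<beta> G"
  by (rule fp_integral_eqI[OF assms(1) reg has_fp_cong[OF _ has_fp_fp_integral[OF assms(2) reg]]])
     (use assms(3) in auto)

lemma fp_integral_reflect:
  assumes "F analytic_on complex_of_real ` {0..1}"
  shows "fp_integral \<beta> \<alpha> (\<lambda>t. F (1 - t)) = fp_integral \<alpha> \<beta> F"
  by (rule fp_integral_eqI[OF analytic_on_segment_reflect[OF assms] reg(2,1) has_fp_reflect[OF has_fp_fp_integral[OF assms reg]]])

lemma fp_integral_shift_left:
  assumes "F analytic_on complex_of_real ` {0..1}"
  shows "fp_integral \<alpha> \<beta> (\<lambda>t. t * F t) = fp_integral (\<alpha> + 1) \<beta> F"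
  by (rule fp_integral_eqI[OF _ reg has_fp_shift_left[OF has_fp_fp_integral[OF assms regular_exponent_plus_1[OF reg(1)] reg(2)]]])
     (use assms in \<open>intro analytic_intros\<close>)

lemma fp_integral_derivative:
  assumes "F analytic_on complex_of_real ` {0..1}"
  shows "fp_integral \<alpha> \<beta> (\<lambda>t. ((\<alpha> + 1) * (1 - t) - (\<beta> + 1) * t) * F t + t * (1 - t) * deriv F t) = 0"
  by (rule fp_integral_eqI[OF _ reg has_fp_derivative[OF assms]])
     (use assms in \<open>auto intro!: analytic_intros analytic_deriv\<close>)

end

section \<open>Large exponents: the ordinary integral\<close>

lemma continuous_on_jacobi_weight:
  assumes "Re \<alpha> > 0" "Re \<beta> > 0"
  shows "continuous_on {z. 0 \<le> Re z \<and> Re z \<le> 1} (jacobi_weight \<alpha> \<beta>)"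
  unfolding jacobi_weight_def using assms by (auto intro!: continuous_intros)

text \<open>Here t^(\<gamma>+1) times a germ tends to 0, so the regularized values are genuine
  limits of the primitive and the fundamental theorem of calculus applies on the closed
  interval.\<close>

lemma has_integral_fp_integral:
  assumes "Re \<alpha> > 0" "Re \<beta> > 0" "regular_exponent \<alpha>" "regular_exponent \<beta>"
    and F: "F analytic_on complex_of_real ` {0..1}"
  shows "((\<lambda>t. jacobi_weight \<alpha> \<beta> (of_real t) * F (of_real t)) has_integral fp_integral \<alpha> \<beta> F) {0..1}"
proof -
  obtain A L0 L1 u v where A:
    "\<And>t. 0 < t \<Longrightarrow> t < 1 \<Longrightarrow>
        (A has_vector_derivative jacobi_weight \<alpha> \<beta> (of_real t) * F (of_real t)) (at t)"
    "u analytic_on {0}" "v analytic_on {0}"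
    "\<forall>\<^sub>F t in at_right 0. A t = L0 + of_real t powr (\<alpha> + 1) * u (of_real t)"
    "\<forall>\<^sub>F t in at_right 0. A (1 - t) = L1 + of_real t powr (\<beta> + 1) * v (of_real t)"
    "fp_integral \<alpha> \<beta> F = L1 - L0"
    using has_fp_fp_integral[OF F assms(3,4)] by (rule has_fpE) (rule that)
  have lim: "((\<lambda>t. L + of_real t powr (\<gamma> + 1) * g (of_real t)) \<longlongrightarrow> L) (at_right (0::real))"
    if "g analytic_on {0}" "Re \<gamma> > 0" for g \<gamma> L
  proof -
    have of: "filterlim complex_of_real (nhds 0) (at_right 0)"
      using tendsto_of_real[OF tendsto_ident_at[of 0 "{0<..}"], where 'a=complex] by simp
    have "isCont g 0" using that(1) by (simp add: analytic_at_imp_isCont)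
    from isCont_tendsto_compose[OF this of] have g: "((\<lambda>t. g (of_real t)) \<longlongrightarrow> g 0) (at_right (0::real))" .
    have "((\<lambda>t. complex_of_real t powr (\<gamma> + 1)) \<longlongrightarrow> 0) (at_right 0)"
    proof (rule tendsto_norm_zero_cancel)
      have "((\<lambda>t::real. t powr (Re \<gamma> + 1)) \<longlongrightarrow> 0 powr (Re \<gamma> + 1)) (at_right 0)"
        using that(2) by (intro tendsto_powr2 tendsto_ident_at tendsto_const) (auto simp: eventually_at_right_less eventually_at_filter)
      then have "((\<lambda>t::real. t powr (Re \<gamma> + 1)) \<longlongrightarrow> 0) (at_right 0)" by simp
      moreover have "\<forall>\<^sub>F t in at_right 0. t powr (Re \<gamma> + 1) = norm (complex_of_real t powr (\<gamma> + 1))"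
        using eventually_at_right_less[of "0::real"]
        by eventually_elim (simp add: norm_powr_real_powr)
      ultimately show "((\<lambda>t. norm (complex_of_real t powr (\<gamma> + 1))) \<longlongrightarrow> 0) (at_right 0)"
        by (rule Lim_transform_eventually)
    qed
    from tendsto_add[OF tendsto_const[of L] tendsto_mult[OF this g]] show ?thesis by simp
  qed
  have l0: "(A \<longlongrightarrow> L0) (at_right 0)"
    by (rule Lim_transform_eventually[OF lim[OF A(2) assms(1)] eventually_mono[OF A(4)]]) simp
  have "((\<lambda>t. A (1 - t)) \<longlongrightarrow> L1) (at_right 0)"
    by (rule Lim_transform_eventually[OF lim[OF A(3) assms(2)] eventually_mono[OF A(5)]]) simp
  moreover have "filterlim (\<lambda>t. 1 - t) (at_right 0) (at_left (1::real))"
    by (rule filterlim_at_withinI) (auto intro!: tendsto_eq_intros simp: eventually_at_left_field intro: exI[of _ 0])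
  ultimately have l1: "(A \<longlongrightarrow> L1) (at_left 1)"
    by (auto dest: filterlim_compose)
  \<comment> \<open>\<open>B\<close> extends the primitive continuously to the endpoints by its
    limits.\<close>
  define B where "B = (\<lambda>t. if t \<le> 0 then L0 else if t \<ge> 1 then L1 else A t)"
  have "((\<lambda>t. jacobi_weight \<alpha> \<beta> (of_real t) * F (of_real t)) has_integral B 1 - B 0) {0..1}"
  proof (rule fundamental_theorem_of_calculus_interior)
    have der: "(B has_vector_derivative jacobi_weight \<alpha> \<beta> (of_real t) * F (of_real t)) (at t)"
      if "t \<in> {0<..<1}" for t
    proof (rule has_vector_derivative_transform_within_open[where S="{0<..<1}"])
      show "(A has_vector_derivative jacobi_weight \<alpha> \<beta> (of_real t) * F (of_real t)) (at t)"
        using A(1) that by auto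
    qed (use that in \<open>auto simp: B_def\<close>)
    then show "(B has_vector_derivative jacobi_weight \<alpha> \<beta> (of_real t) * F (of_real t)) (at t)"
      if "t \<in> {0<..<1}" for t using that .
    show "continuous_on {0..1} B"
      unfolding continuous_on_eq_continuous_within
    proof
      fix t :: real assume "t \<in> {0..1}"
      then consider "t = 0" | "t = 1" | "t \<in> {0<..<1}" by fastforce
      then show "continuous (at t within {0..1}) B"
      proof cases
        case 1
        have "\<forall>\<^sub>F s in at_right 0. A s = B s"
          unfolding eventually_at_right_field by (intro exI[of _ 1]) (auto simp: B_def)
        from Lim_transform_eventually[OF l0 this] show ?thesis
          unfolding 1 by (simp add: continuous_within at_within_Icc_at_right B_def)
      next
        case 2
        have "\<forall>\<^sub>F s in at_left 1. A s = B s"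
          unfolding eventually_at_left_field by (intro exI[of _ 0]) (auto simp: B_def)
        from Lim_transform_eventually[OF l1 this] show ?thesis
          unfolding 2 by (simp add: continuous_within at_within_Icc_at_left B_def)
      next
        case 3
        then show ?thesis using der has_vector_derivative_continuous continuous_at_imp_continuous_at_within by blast
      qed
    qed
  qed simp
  then show ?thesis by (simp add: B_def A(6))
qed

section \<open>Moment and Stieltjes transform: recurrences in the exponents\<close>

lemma analytic_cauchy_kernel [analytic_intros]:
  "z \<in> slit_plane \<Longrightarrow> (\<lambda>t. 1 / (t - z)) analytic_on complex_of_real ` {0..1}"
  by (auto intro!: analytic_intros simp: slit_plane_def)

lemma open_slit_plane [simp]: "open slit_plane"
proof -
  have "complex_of_real ` {0..1} = closed_segment 0 1"
    by (auto simp: closed_segment_def image_iff scaleR_conv_of_real)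
  then show ?thesis
    unfolding slit_plane_def by (metis Compl_eq_Diff_UNIV closed_segment open_Compl)
qed

lemma slit_plane_ne_0: "z \<in> slit_plane \<Longrightarrow> z \<noteq> 0" and slit_plane_ne_1: "z \<in> slit_plane \<Longrightarrow> z \<noteq> 1"
  and slit_plane_ne_of_real: "z \<in> slit_plane \<Longrightarrow> 0 \<le> t \<Longrightarrow> t \<le> 1 \<Longrightarrow> complex_of_real t - z \<noteq> 0"
  unfolding slit_plane_def
  by (auto simp: image_iff dest: bspec[of _ _ 0] bspec[of _ _ 1])

lemma one_minus_slit_plane: "z \<in> slit_plane \<Longrightarrow> 1 - z \<in> slit_plane"
  using one_minus_in_segment[of "1 - z"] by (auto simp: slit_plane_def)

definition jacobi_moment :: "complex \<Rightarrow> complex \<Rightarrow> complex" where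
  "jacobi_moment \<alpha> \<beta> = fp_integral \<alpha> \<beta> (\<lambda>_. 1)"

definition stieltjes :: "complex \<Rightarrow> complex \<Rightarrow> complex \<Rightarrow> complex" where
  "stieltjes \<alpha> \<beta> z = fp_integral \<alpha> \<beta> (\<lambda>t. 1 / (t - z))"

context
  fixes \<alpha> \<beta> :: complex
  assumes reg: "regular_exponent \<alpha>" "regular_exponent \<beta>"
begin

lemma jacobi_moment_commute: "jacobi_moment \<beta> \<alpha> = jacobi_moment \<alpha> \<beta>"
  using fp_integral_reflect[OF reg, of "\<lambda>_. 1"] by (simp add: jacobi_moment_def)

text \<open>The total derivative with F = 1 has the density (\<alpha> + 1) - (\<alpha> + \<beta> +
  2) t, whose finite part is 0.\<close>

lemma jacobi_moment_plus_1_left: "(\<alpha> + \<beta> + 2) * jacobi_moment (\<alpha> + 1) \<beta> = (\<alpha> + 1) * jacobi_moment \<alpha> \<beta>"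
proof -
  have "0 = fp_integral \<alpha> \<beta> (\<lambda>t. ((\<alpha> + 1) * (1 - t) - (\<beta> + 1) * t) * 1 + t * (1 - t) * deriv (\<lambda>_. 1) t)"
    by (rule fp_integral_derivative[OF reg, symmetric]) auto
  also have "\<dots> = fp_integral \<alpha> \<beta> (\<lambda>t. (\<alpha> + 1) * 1 + (- (\<alpha> + \<beta> + 2)) * (t * 1))"
    by (rule arg_cong[of _ _ "fp_integral \<alpha> \<beta>"]) (auto simp: algebra_simps)
  also have "\<dots> = (\<alpha> + 1) * jacobi_moment \<alpha> \<beta> + (- (\<alpha> + \<beta> + 2)) * jacobi_moment (\<alpha> + 1) \<beta>"
    unfolding jacobi_moment_def fp_integral_shift_left[OF reg, symmetric, OF analytic_on_const]
    by (rule fp_integral_linear[OF reg]) (auto intro!: analytic_intros)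
  finally show ?thesis by (simp add: algebra_simps)
qed

lemma stieltjes_plus_1_left:
  assumes "z \<in> slit_plane"
  shows "stieltjes (\<alpha> + 1) \<beta> z = z * stieltjes \<alpha> \<beta> z + jacobi_moment \<alpha> \<beta>"
proof -
  have "stieltjes (\<alpha> + 1) \<beta> z = fp_integral \<alpha> \<beta> (\<lambda>t. t * (1 / (t - z)))"
    unfolding stieltjes_def using assms by (intro fp_integral_shift_left[OF reg, symmetric] analytic_intros)
  also have "\<dots> = fp_integral \<alpha> \<beta> (\<lambda>t. z * (1 / (t - z)) + 1 * 1)"
    using assms slit_plane_ne_of_real[OF assms]
    by (intro fp_integral_cong[OF reg] analytic_intros) (auto simp: field_simps)
  also have "\<dots> = z * stieltjes \<alpha> \<beta> z + 1 * jacobi_moment \<alpha> \<beta>"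
    unfolding stieltjes_def jacobi_moment_def
    using assms by (intro fp_integral_linear[OF reg] analytic_intros)
  finally show ?thesis by simp
qed

lemma stieltjes_reflect:
  assumes "z \<in> slit_plane"
  shows "stieltjes \<beta> \<alpha> (1 - z) = - stieltjes \<alpha> \<beta> z"
proof -
  have "stieltjes \<alpha> \<beta> z = fp_integral \<beta> \<alpha> (\<lambda>t. 1 / (1 - t - z))"
    unfolding stieltjes_def using assms by (intro fp_integral_reflect[OF reg, symmetric] analytic_intros)
  \<comment> \<open>The vanishing second term only brings the integrand into the two-term form of
    \<open>fp_integral_linear\<close>.\<close>
  also have "\<dots> = fp_integral \<beta> \<alpha> (\<lambda>t. (-1) * (1 / (t - (1 - z))) + 0 * 1)"
    by (rule arg_cong[of _ _ "fp_integral \<beta> \<alpha>"]) (auto simp: fun_eq_iff divide_simps; algebra)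
  also have "\<dots> = (-1) * stieltjes \<beta> \<alpha> (1 - z) + 0 * jacobi_moment \<beta> \<alpha>"
    unfolding stieltjes_def jacobi_moment_def
    using one_minus_slit_plane[OF assms] by (intro fp_integral_linear[OF reg(2,1)] analytic_intros)
  finally show ?thesis by simp
qed

end

lemma jacobi_moment_plus_1_right:
  assumes "regular_exponent \<alpha>" "regular_exponent \<beta>"
  shows "(\<alpha> + \<beta> + 2) * jacobi_moment \<alpha> (\<beta> + 1) = (\<beta> + 1) * jacobi_moment \<alpha> \<beta>"
  using jacobi_moment_plus_1_left[OF assms(2,1)] jacobi_moment_commute[OF assms]
    jacobi_moment_commute[OF assms(1) regular_exponent_plus_1[OF assms(2)]]
  by (simp add: algebra_simps)

lemma stieltjes_plus_1_right:
  assumes "regular_exponent \<alpha>" "regular_exponent \<beta>" "z \<in> slit_plane"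
  shows "stieltjes \<alpha> (\<beta> + 1) z = (1 - z) * stieltjes \<alpha> \<beta> z - jacobi_moment \<alpha> \<beta>"
  using stieltjes_plus_1_left[OF assms(2,1) one_minus_slit_plane[OF assms(3)]] stieltjes_reflect[OF assms]
    stieltjes_reflect[OF assms(1) regular_exponent_plus_1[OF assms(2)] assms(3)]
    jacobi_moment_commute[OF assms(1,2)]
  by (simp add: algebra_simps)

section \<open>The differential equation\<close>

lemma path_image_linepath_0_1: "path_image (linepath 0 1) = complex_of_real ` {0..1}"
  by (auto simp: closed_segment_def image_iff scaleR_conv_of_real)

lemma has_contour_integral_fp_integral:
  assumes "Re \<alpha> > 0" "Re \<beta> > 0" "regular_exponent \<alpha>" "regular_exponent \<beta>"
    and F: "F analytic_on complex_of_real ` {0..1}"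
  shows "((\<lambda>t. jacobi_weight \<alpha> \<beta> t * F t) has_contour_integral fp_integral \<alpha> \<beta> F) (linepath 0 1)"
  unfolding has_contour_integral_linepath using has_integral_fp_integral[OF assms]
  by (simp add: linepath_def scaleR_conv_of_real)

text \<open>The transform is read as a Cauchy-type integral along the path from 0 to 1, so
  differentiation under the integral sign is the general fact about such integrals with continuous
  density.\<close>

lemma stieltjes_derivative_large:
  assumes "Re \<alpha> > 0" "Re \<beta> > 0" "regular_exponent \<alpha>" "regular_exponent \<beta>" "z \<in> slit_plane"
  shows "(stieltjes \<alpha> \<beta> has_field_derivative fp_integral \<alpha> \<beta> (\<lambda>t. (1 / (t - z)) ^ 2)) (at z)"
proof -
  have cont: "continuous_on (path_image (linepath 0 1)) (jacobi_weight \<alpha> \<beta>)"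
    unfolding path_image_linepath_0_1
    by (rule continuous_on_subset[OF continuous_on_jacobi_weight]) (use assms in auto)
  have int: "((\<lambda>u. jacobi_weight \<alpha> \<beta> u / (u - w) ^ 1) has_contour_integral stieltjes \<alpha> \<beta> w) (linepath 0 1)"
    if "w \<in> slit_plane - path_image (linepath 0 1)" for w
    using has_contour_integral_fp_integral[OF assms(1-4) analytic_cauchy_kernel[of w]] that
    by (simp add: stieltjes_def)
  have "z \<in> slit_plane - path_image (linepath 0 1)"
    using assms(5) unfolding path_image_linepath_0_1 slit_plane_def by simp
  from Cauchy_next_derivative(2)[OF cont, of "norm (1::complex)", OF _ int _ open_slit_plane _ this]
  have "(stieltjes \<alpha> \<beta> has_field_derivative
      contour_integral (linepath 0 1) (\<lambda>u. jacobi_weight \<alpha> \<beta> u / (u - z) ^ Suc 1)) (at z)"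
    by (simp add: vector_derivative_linepath_at)
  also have "contour_integral (linepath 0 1) (\<lambda>u. jacobi_weight \<alpha> \<beta> u / (u - z) ^ Suc 1) =
      fp_integral \<alpha> \<beta> (\<lambda>t. (1 / (t - z)) ^ 2)"
  proof (rule contour_integral_unique)
    have "(\<lambda>t. (1 / (t - z)) ^ 2) analytic_on complex_of_real ` {0..1}"
      by (intro analytic_intros assms)
    from has_contour_integral_fp_integral[OF assms(1-4) this]
    show "((\<lambda>u. jacobi_weight \<alpha> \<beta> u / (u - z) ^ Suc 1) has_contour_integral
        fp_integral \<alpha> \<beta> (\<lambda>t. (1 / (t - z)) ^ 2)) (linepath 0 1)"
      by (simp add: power_divide power2_eq_square)
  qed
  finally show ?thesis .
qed

text \<open>Integrating the total derivative of \<open>t powr (\<alpha> + 1) * (1 - t) powr (\<beta> + 1) / (t - z)\<close> yields a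
  first-order equation for the Stieltjes transform.\<close>

lemma stieltjes_ode:
  assumes "regular_exponent \<alpha>" "regular_exponent \<beta>"
  shows "\<forall>z\<in>slit_plane. \<exists>D. (stieltjes \<alpha> \<beta> has_field_derivative D) (at z) \<and>
    z * (1 - z) * D = (\<alpha> - (\<alpha> + \<beta>) * z) * stieltjes \<alpha> \<beta> z - (\<alpha> + \<beta> + 1) * jacobi_moment \<alpha> \<beta>"
  using assms
proof (induct rule: exponent_induct[where r=0])
  case (base \<alpha> \<beta>)
  note reg = base(1,2)
  show ?case
  proof
    fix z assume z: "z \<in> slit_plane"
    let ?k = "\<lambda>t. 1 / (t - z)"
    let ?D = "fp_integral \<alpha> \<beta> (\<lambda>t. (?k t) ^ 2)"
    have an: "?k analytic_on complex_of_real ` {0..1}" using z by (rule analytic_cauchy_kernel)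
    have "0 = fp_integral \<alpha> \<beta> (\<lambda>t. ((\<alpha> + 1) * (1 - t) - (\<beta> + 1) * t) * ?k t + t * (1 - t) * deriv ?k t)"
      by (rule fp_integral_derivative[OF reg an, symmetric])
    also have "\<dots> = fp_integral \<alpha> \<beta> (\<lambda>t. (- (z * (1 - z))) * (?k t) ^ 2 + 1 * ((\<alpha> - (\<alpha> + \<beta>) * z) * ?k t + (- (\<alpha> + \<beta> + 1)) * 1))"
    proof (rule fp_integral_cong[OF reg])
      show "(\<lambda>t. ((\<alpha> + 1) * (1 - t) - (\<beta> + 1) * t) * ?k t + t * (1 - t) * deriv ?k t) analytic_on complex_of_real ` {0..1}"
        by (intro analytic_intros analytic_deriv an)
      show "(\<lambda>t. (- (z * (1 - z))) * (?k t) ^ 2 + 1 * ((\<alpha> - (\<alpha> + \<beta>) * z) * ?k t + (- (\<alpha> + \<beta> + 1)) * 1)) analytic_on complex_of_real ` {0..1}"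
        using z by (intro analytic_intros)
    next
      fix t :: real assume t: "0 < t" "t < 1"
      then have ne: "complex_of_real t - z \<noteq> 0" using slit_plane_ne_of_real[OF z, of t] by simp
      then have "(?k has_field_derivative - ((?k (of_real t)) ^ 2)) (at (of_real t))"
        by (auto intro!: derivative_eq_intros simp: power2_eq_square)
      then have d: "deriv ?k (of_real t) = - ((?k (of_real t)) ^ 2)" by (rule DERIV_imp_deriv)
      \<comment> \<open>The relation t s = 1 + z s eliminates t from both sides, after which only a
        polynomial identity in s and z remains.\<close>
      define s where "s = ?k (of_real t)"
      have s: "of_real t * s = 1 + z * s" using ne by (simp add: s_def field_simps)
      have "of_real t * (of_real t * s\<^sup>2) = (of_real t * s)\<^sup>2" "of_real t * s\<^sup>2 = (of_real t * s) * s"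
        by (simp_all add: power2_eq_square)
      then have "of_real t * (of_real t * s\<^sup>2) = (1 + z * s)\<^sup>2" "of_real t * s\<^sup>2 = (1 + z * s) * s"
        unfolding s by simp_all
      with s show "((\<alpha> + 1) * (1 - of_real t) - (\<beta> + 1) * of_real t) * ?k (of_real t) + of_real t * (1 - of_real t) * deriv ?k (of_real t) =
        (- (z * (1 - z))) * (?k (of_real t)) ^ 2 + 1 * ((\<alpha> - (\<alpha> + \<beta>) * z) * ?k (of_real t) + (- (\<alpha> + \<beta> + 1)) * 1)"
        unfolding d s_def[symmetric] by algebra
    qed
    also have "\<dots> = (- (z * (1 - z))) * ?D + 1 * fp_integral \<alpha> \<beta> (\<lambda>t. (\<alpha> - (\<alpha> + \<beta>) * z) * ?k t + (- (\<alpha> + \<beta> + 1)) * 1)"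
      using z by (intro fp_integral_linear[OF reg] analytic_intros)
    also have "fp_integral \<alpha> \<beta> (\<lambda>t. (\<alpha> - (\<alpha> + \<beta>) * z) * ?k t + (- (\<alpha> + \<beta> + 1)) * 1) =
        (\<alpha> - (\<alpha> + \<beta>) * z) * stieltjes \<alpha> \<beta> z + (- (\<alpha> + \<beta> + 1)) * jacobi_moment \<alpha> \<beta>"
      unfolding stieltjes_def jacobi_moment_def using z by (intro fp_integral_linear[OF reg] analytic_intros)
    finally have "z * (1 - z) * ?D = (\<alpha> - (\<alpha> + \<beta>) * z) * stieltjes \<alpha> \<beta> z - (\<alpha> + \<beta> + 1) * jacobi_moment \<alpha> \<beta>"
      by (simp add: algebra_simps)
    with stieltjes_derivative_large[OF base(3,4) reg z]
    show "\<exists>D. (stieltjes \<alpha> \<beta> has_field_derivative D) (at z) \<and>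
      z * (1 - z) * D = (\<alpha> - (\<alpha> + \<beta>) * z) * stieltjes \<alpha> \<beta> z - (\<alpha> + \<beta> + 1) * jacobi_moment \<alpha> \<beta>"
      by blast
  qed
next
  case (left \<alpha> \<beta>)
  note reg = left(1,2)
  show ?case
  proof
    fix z assume z: "z \<in> slit_plane"
    then have z0: "z \<noteq> 0" by (rule slit_plane_ne_0)
    obtain D where D: "(stieltjes (\<alpha> + 1) \<beta> has_field_derivative D) (at z)"
      "z * (1 - z) * D = (\<alpha> + 1 - (\<alpha> + 1 + \<beta>) * z) * stieltjes (\<alpha> + 1) \<beta> z - (\<alpha> + 1 + \<beta> + 1) * jacobi_moment (\<alpha> + 1) \<beta>"
      using left(3) z by blast
    \<comment> \<open>Differentiating the recurrence z \<Phi>(z) + M gives D = \<Phi>(z) + z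
      \<Phi>'(z), so this is the only candidate for \<Phi>'(z).\<close>
    define E where "E = (D - stieltjes \<alpha> \<beta> z) / z"
    have "((\<lambda>z. (stieltjes (\<alpha> + 1) \<beta> z - jacobi_moment \<alpha> \<beta>) / z) has_field_derivative
        (D * z - (stieltjes (\<alpha> + 1) \<beta> z - jacobi_moment \<alpha> \<beta>)) / (z * z)) (at z)"
      using D(1) z0 by (auto intro!: derivative_eq_intros)
    also have "(D * z - (stieltjes (\<alpha> + 1) \<beta> z - jacobi_moment \<alpha> \<beta>)) / (z * z) = E"
      unfolding E_def stieltjes_plus_1_left[OF reg z] using z0 by (simp add: field_simps)
    finally have "(stieltjes \<alpha> \<beta> has_field_derivative E) (at z)"
      by (rule has_field_derivative_transform_within_open[OF _ open_slit_plane z])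
         (auto simp: stieltjes_plus_1_left[OF reg] slit_plane_ne_0)
    moreover have "z * (1 - z) * E = (\<alpha> - (\<alpha> + \<beta>) * z) * stieltjes \<alpha> \<beta> z - (\<alpha> + \<beta> + 1) * jacobi_moment \<alpha> \<beta>"
    proof -
      \<comment> \<open>The equation is verified after multiplication by z. The recurrence for the
        moment turns the constant for exponent \<alpha> + 1 into the one for \<alpha>.\<close>
      have "z * E = D - stieltjes \<alpha> \<beta> z" using z0 by (simp add: E_def)
      with D(2) jacobi_moment_plus_1_left[OF reg] have "z * (z * (1 - z) * E) =
        z * ((\<alpha> - (\<alpha> + \<beta>) * z) * stieltjes \<alpha> \<beta> z - (\<alpha> + \<beta> + 1) * jacobi_moment \<alpha> \<beta>)"
        unfolding stieltjes_plus_1_left[OF reg z] by algebra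
      then show ?thesis using z0 by simp
    qed
    ultimately show "\<exists>D. (stieltjes \<alpha> \<beta> has_field_derivative D) (at z) \<and>
      z * (1 - z) * D = (\<alpha> - (\<alpha> + \<beta>) * z) * stieltjes \<alpha> \<beta> z - (\<alpha> + \<beta> + 1) * jacobi_moment \<alpha> \<beta>"
      by blast
  qed
next
  case (right \<alpha> \<beta>)
  note reg = right(1,2)
  show ?case
  proof
    fix z assume z: "z \<in> slit_plane"
    then have z0: "1 - z \<noteq> 0" using slit_plane_ne_1 by auto
    obtain D where D: "(stieltjes \<alpha> (\<beta> + 1) has_field_derivative D) (at z)"
      "z * (1 - z) * D = (\<alpha> - (\<alpha> + (\<beta> + 1)) * z) * stieltjes \<alpha> (\<beta> + 1) z - (\<alpha> + (\<beta> + 1) + 1) * jacobi_moment \<alpha> (\<beta> + 1)"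
      using right(3) z by blast
    define E where "E = (D + stieltjes \<alpha> \<beta> z) / (1 - z)"
    have "((\<lambda>z. (stieltjes \<alpha> (\<beta> + 1) z + jacobi_moment \<alpha> \<beta>) / (1 - z)) has_field_derivative
        (D * (1 - z) + (stieltjes \<alpha> (\<beta> + 1) z + jacobi_moment \<alpha> \<beta>)) / ((1 - z) * (1 - z))) (at z)"
      using D(1) z0 by (auto intro!: derivative_eq_intros)
    also have "(D * (1 - z) + (stieltjes \<alpha> (\<beta> + 1) z + jacobi_moment \<alpha> \<beta>)) / ((1 - z) * (1 - z)) = E"
      unfolding E_def stieltjes_plus_1_right[OF reg z] using z0 by (simp add: divide_simps; algebra)
    finally have "(stieltjes \<alpha> \<beta> has_field_derivative E) (at z)"
      by (rule has_field_derivative_transform_within_open[OF _ open_slit_plane z])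
         (use slit_plane_ne_1 in \<open>force simp: stieltjes_plus_1_right[OF reg]\<close>)
    moreover have "z * (1 - z) * E = (\<alpha> - (\<alpha> + \<beta>) * z) * stieltjes \<alpha> \<beta> z - (\<alpha> + \<beta> + 1) * jacobi_moment \<alpha> \<beta>"
    proof -
      have "(1 - z) * E = D + stieltjes \<alpha> \<beta> z" using z0 by (simp add: E_def)
      with D(2) jacobi_moment_plus_1_right[OF reg] have "(1 - z) * (z * (1 - z) * E) =
        (1 - z) * ((\<alpha> - (\<alpha> + \<beta>) * z) * stieltjes \<alpha> \<beta> z - (\<alpha> + \<beta> + 1) * jacobi_moment \<alpha> \<beta>)"
        unfolding stieltjes_plus_1_right[OF reg z] by algebra
      then show ?thesis using z0 by simp
    qed
    ultimately show "\<exists>D. (stieltjes \<alpha> \<beta> has_field_derivative D) (at z) \<and>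
      z * (1 - z) * D = (\<alpha> - (\<alpha> + \<beta>) * z) * stieltjes \<alpha> \<beta> z - (\<alpha> + \<beta> + 1) * jacobi_moment \<alpha> \<beta>"
      by blast
  qed
qed

lemma stieltjes_holomorphic:
  assumes "regular_exponent \<alpha>" "regular_exponent \<beta>"
  shows "stieltjes \<alpha> \<beta> holomorphic_on slit_plane"
  using stieltjes_ode[OF assms] unfolding holomorphic_on_open[OF open_slit_plane] by blast

section \<open>Decay at infinity\<close>

lemma eventually_slit_plane_at_infinity: "\<forall>\<^sub>F z in at_infinity. z \<in> slit_plane"
  unfolding eventually_at_infinity
proof (intro exI[of _ 2] allI impI)
  fix z :: complex assume "2 \<le> norm z"
  then show "z \<in> slit_plane" by (auto simp: slit_plane_def)
qed

text \<open>For large exponents |t - z| \<ge> |z| - 1 gives the decay. In the descent it comes from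
  dividing a bounded quantity by z or 1 - z.\<close>

lemma stieltjes_at_infinity:
  assumes "regular_exponent \<alpha>" "regular_exponent \<beta>"
  shows "(stieltjes \<alpha> \<beta> \<longlongrightarrow> 0) at_infinity"
  using assms
proof (induct rule: exponent_induct[where r=0])
  case (base \<alpha> \<beta>)
  have "compact (jacobi_weight \<alpha> \<beta> ` complex_of_real ` {0..1})"
    by (intro compact_continuous_image continuous_on_subset[OF continuous_on_jacobi_weight] continuous_intros)
       (use base in auto)
  then obtain B where B: "B > 0" "\<And>t. t \<in> {0..1} \<Longrightarrow> norm (jacobi_weight \<alpha> \<beta> (of_real t)) \<le> B"
    by (auto dest!: compact_imp_bounded simp: bounded_pos)
  have "norm (stieltjes \<alpha> \<beta> z) \<le> B / (norm z - 1)" if "norm z \<ge> 2" for z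
  proof -
    have z: "z \<in> slit_plane" using that by (auto simp: slit_plane_def)
    have "norm (stieltjes \<alpha> \<beta> z) \<le> B / (norm z - 1) * measure lborel (cbox 0 (1::real))"
    proof (rule has_integral_bound)
      show "0 \<le> B / (norm z - 1)" using B that by simp
      show "((\<lambda>t. jacobi_weight \<alpha> \<beta> (of_real t) * (1 / (of_real t - z))) has_integral stieltjes \<alpha> \<beta> z) (cbox 0 1)"
        unfolding stieltjes_def using has_integral_fp_integral[OF base(3,4,1,2) analytic_cauchy_kernel[OF z]] by simp
      fix t :: real assume t: "t \<in> cbox 0 1"
      have "norm z - norm (complex_of_real t) \<le> norm (of_real t - z)"
        using norm_triangle_ineq2[of z "of_real t"] by (simp add: norm_minus_commute)
      then have "norm z - 1 \<le> norm (of_real t - z)" using t by simp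
      then have "norm (jacobi_weight \<alpha> \<beta> (of_real t)) / norm (of_real t - z) \<le> B / (norm z - 1)"
        using B(2)[of t] B(1) t that by (intro frac_le) auto
      then show "norm (jacobi_weight \<alpha> \<beta> (of_real t) * (1 / (of_real t - z))) \<le> B / (norm z - 1)"
        by (simp add: norm_mult norm_divide)
    qed
    then show ?thesis by simp
  qed
  then have "\<forall>\<^sub>F z in at_infinity. norm (stieltjes \<alpha> \<beta> z) \<le> B / (norm z - 1)"
    unfolding eventually_at_infinity by blast
  moreover have "((\<lambda>z::complex. B / (norm z - 1)) \<longlongrightarrow> 0) at_infinity"
  proof -
    have "filterlim (\<lambda>x::real. -1 + x) at_infinity at_top"
      by (intro filterlim_at_top_imp_at_infinity filterlim_tendsto_add_at_top[OF tendsto_const filterlim_ident])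
    then have "((\<lambda>x::real. B / (x - 1)) \<longlongrightarrow> 0) at_top"
      by (intro tendsto_divide_0[OF tendsto_const]) simp
    from filterlim_compose[OF this filterlim_norm_at_top] show ?thesis .
  qed
  ultimately show ?case by (rule Lim_null_comparison)
next
  case (left \<alpha> \<beta>)
  have "((\<lambda>z. (stieltjes (\<alpha> + 1) \<beta> z - jacobi_moment \<alpha> \<beta>) * inverse z) \<longlongrightarrow> (0 - jacobi_moment \<alpha> \<beta>) * 0) at_infinity"
    by (intro tendsto_intros left(3) tendsto_inverse_0)
  moreover have "\<forall>\<^sub>F z in at_infinity. (stieltjes (\<alpha> + 1) \<beta> z - jacobi_moment \<alpha> \<beta>) * inverse z = stieltjes \<alpha> \<beta> z"
    using eventually_slit_plane_at_infinity
    by eventually_elim (use slit_plane_ne_0 in \<open>auto simp: stieltjes_plus_1_left[OF left(1,2)]\<close>)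
  ultimately have "(stieltjes \<alpha> \<beta> \<longlongrightarrow> (0 - jacobi_moment \<alpha> \<beta>) * 0) at_infinity"
    by (rule Lim_transform_eventually)
  then show ?case by simp
next
  case (right \<alpha> \<beta>)
  have "filterlim (\<lambda>z::complex. 1 + - z) at_infinity at_infinity"
    by (intro tendsto_add_filterlim_at_infinity[OF tendsto_const])
       (simp add: filterlim_at_infinity_conv_norm_at_top filterlim_norm_at_top)
  then have "filterlim (\<lambda>z::complex. inverse (1 - z)) (nhds 0) at_infinity"
    using filterlim_compose[OF tendsto_inverse_0] by simp
  then have "((\<lambda>z. (stieltjes \<alpha> (\<beta> + 1) z + jacobi_moment \<alpha> \<beta>) * inverse (1 - z)) \<longlongrightarrow> (0 + jacobi_moment \<alpha> \<beta>) * 0) at_infinity"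
    by (intro tendsto_intros right(3))
  moreover have "\<forall>\<^sub>F z in at_infinity. (stieltjes \<alpha> (\<beta> + 1) z + jacobi_moment \<alpha> \<beta>) * inverse (1 - z) = stieltjes \<alpha> \<beta> z"
    using eventually_slit_plane_at_infinity
    by eventually_elim (use slit_plane_ne_1 in \<open>force simp: stieltjes_plus_1_right[OF right(1,2)]\<close>)
  ultimately have "(stieltjes \<alpha> \<beta> \<longlongrightarrow> (0 + jacobi_moment \<alpha> \<beta>) * 0) at_infinity"
    by (rule Lim_transform_eventually)
  then show ?case by simp
qed

section \<open>The moment as a Beta function\<close>

lemma regular_exponent_Re_pos: "Re \<gamma> > 0 \<Longrightarrow> regular_exponent \<gamma>"
  unfolding regular_exponent_iff by auto

text \<open>Substituting t = s/k with k = Suc n turns the scaled moment into the integral of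
  s^\<alpha> (1 - s/k)^(b+k) over [0,k]. The integrand tends to s^\<alpha> e^(-s), the integrand of
  Euler's integral for Gamma.\<close>

lemma jacobi_moment_asymptotic:
  assumes "Re \<alpha> > 0" "Re b > 0"
  shows "(\<lambda>n. of_nat (Suc n) powr (\<alpha> + 1) * jacobi_moment \<alpha> (b + of_nat (Suc n))) \<longlonglongrightarrow> Gamma (\<alpha> + 1)"
proof -
  define f where "f = (\<lambda>n (s::real). if s \<in> {0..real (Suc n)} then
     complex_of_real s powr \<alpha> * (1 - of_real (s / real (Suc n))) powr (b + of_nat (Suc n)) else 0)"
  have int: "(f n has_integral of_nat (Suc n) powr (\<alpha> + 1) * jacobi_moment \<alpha> (b + of_nat (Suc n))) {0..}" for n
  proof -
    define k where "k = Suc n"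
    have k: "k > 0" by (simp add: k_def)
    have "((\<lambda>t. jacobi_weight \<alpha> (b + of_nat k) (of_real t) * 1) has_integral jacobi_moment \<alpha> (b + of_nat k)) (cbox 0 1)"
      unfolding jacobi_moment_def cbox_interval using assms
      by (intro has_integral_fp_integral regular_exponent_Re_pos) auto
    from has_integral_affinity'[OF this, of "1 / real k" 0] k
    have "((\<lambda>s. jacobi_weight \<alpha> (b + of_nat k) (of_real (s / real k))) has_integral
        of_nat k * jacobi_moment \<alpha> (b + of_nat k)) {0..real k}"
      by (simp add: scaleR_conv_of_real)
    from has_integral_mult_right[OF this, of "of_nat k powr \<alpha>"]
    have "((\<lambda>s. of_nat k powr \<alpha> * jacobi_weight \<alpha> (b + of_nat k) (of_real (s / real k))) has_integral
        of_nat k powr (\<alpha> + 1) * jacobi_moment \<alpha> (b + of_nat k)) {0..real k}"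
      using k by (simp add: powr_add mult_ac)
    then have "((\<lambda>s. complex_of_real s powr \<alpha> * (1 - of_real (s / real k)) powr (b + of_nat k)) has_integral
        of_nat k powr (\<alpha> + 1) * jacobi_moment \<alpha> (b + of_nat k)) {0..real k}"
    proof (rule has_integral_eq[rotated])
      fix s assume s: "s \<in> {0..real k}"
      have "complex_of_real s powr \<alpha> = (of_real (real k) * of_real (s / real k)) powr \<alpha>"
        using k by (simp add: field_simps)
      also have "\<dots> = of_real (real k) powr \<alpha> * of_real (s / real k) powr \<alpha>"
        using s k by (intro powr_times_real) auto
      finally show "of_nat k powr \<alpha> * jacobi_weight \<alpha> (b + of_nat k) (of_real (s / real k)) =
          complex_of_real s powr \<alpha> * (1 - of_real (s / real k)) powr (b + of_nat k)"
        by (simp add: jacobi_weight_def)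
    qed
    then have "((\<lambda>s. if s \<in> {0..real k} then complex_of_real s powr \<alpha> * (1 - of_real (s / real k)) powr (b + of_nat k) else 0)
        has_integral of_nat k powr (\<alpha> + 1) * jacobi_moment \<alpha> (b + of_nat k)) {0..}"
      by (subst has_integral_restrict) auto
    then show ?thesis by (simp only: f_def k_def)
  qed
  \<comment> \<open>This dominates every \<open>f n\<close>, because 1 - x \<le> e^(-x) and Re b > 0
    give (1 - s/k)^(Re b + k) \<le> e^(-s).\<close>
  define h where "h = (\<lambda>s::real. s powr Re \<alpha> / exp s)"
  have "(\<lambda>n. integral {0..} (f n)) \<longlonglongrightarrow> integral {0..} (\<lambda>s. complex_of_real s powr \<alpha> / of_real (exp s))"
  proof (rule dominated_convergence(2))
    show "f n integrable_on {0..}" for n using int by (rule has_integral_integrable)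
    show "h integrable_on {0..}"
      using Gamma_integral_real[of "Re \<alpha> + 1"] assms by (auto simp: h_def integrable_on_def)
    show "norm (f n s) \<le> h s" if "s \<in> {0..}" for n s
    proof (cases "s \<le> real (Suc n)")
      case True
      define k where "k = Suc n"
      define x where "x = 1 - s / real k"
      have k: "k > 0" "s \<le> real k" "0 \<le> s" using True that by (auto simp: k_def)
      then have x: "0 \<le> x" "x \<le> 1" by (auto simp: x_def)
      have "x \<le> exp (- (s / real k))" using exp_ge_add_one_self[of "- (s / real k)"] by (simp add: x_def)
      have "x powr (Re b + real k) \<le> x powr real k"
        using x assms by (intro powr_mono') auto
      also have "\<dots> \<le> exp (- (s / real k)) powr real k"
        using x \<open>x \<le> exp _\<close> by (intro powr_mono2) auto
      also have "\<dots> = exp (- s)" using k by (simp add: powr_def)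
      finally have *: "x powr (Re b + real k) \<le> exp (- s)" .
      have "complex_of_real x = 1 - of_real (s / real k)" by (simp add: x_def)
      moreover have "f n s = complex_of_real s powr \<alpha> * (1 - of_real (s / real k)) powr (b + of_nat k)"
        using k by (simp add: f_def k_def)
      ultimately have "f n s = complex_of_real s powr \<alpha> * complex_of_real x powr (b + of_nat k)" by metis
      then have "norm (f n s) = s powr Re \<alpha> * x powr (Re b + real k)"
        using k x by (simp add: norm_mult norm_powr_real_powr)
      also have "\<dots> \<le> s powr Re \<alpha> * exp (- s)" using * by (intro mult_left_mono) auto
      finally show ?thesis by (simp add: h_def exp_minus field_simps)
    qed (auto simp: f_def h_def)
    show "(\<lambda>n. f n s) \<longlonglongrightarrow> complex_of_real s powr \<alpha> / of_real (exp s)" if s: "s \<in> {0..}" for s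
    proof -
      have l0: "(\<lambda>n. s / real n) \<longlonglongrightarrow> 0" by (rule lim_const_over_n)
      have "(\<lambda>n. 1 - complex_of_real (s / real n)) \<longlonglongrightarrow> 1 - of_real 0"
        by (intro tendsto_intros l0)
      then have l1: "(\<lambda>n. (1 - complex_of_real (s / real n)) powr b) \<longlonglongrightarrow> 1 powr b"
        by (intro tendsto_powr_complex) auto
      have "(\<lambda>n. (1 + (-s) / real n) ^ n) \<longlonglongrightarrow> exp (- s)" by (rule tendsto_exp_limit_sequentially)
      then have l2: "(\<lambda>n. complex_of_real ((1 + (-s) / real n) ^ n)) \<longlonglongrightarrow> of_real (exp (- s))"
        by (rule tendsto_of_real)
      have "(\<lambda>n. complex_of_real s powr \<alpha> * ((1 - complex_of_real (s / real n)) powr b * of_real ((1 + (-s) / real n) ^ n)))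
          \<longlonglongrightarrow> complex_of_real s powr \<alpha> * (1 powr b * of_real (exp (- s)))"
        by (intro tendsto_mult tendsto_const l1 l2)
      from LIMSEQ_Suc[OF this]
      have *: "(\<lambda>n. complex_of_real s powr \<alpha> * ((1 - complex_of_real (s / real (Suc n))) powr b * of_real ((1 + (-s) / real (Suc n)) ^ (Suc n))))
          \<longlonglongrightarrow> complex_of_real s powr \<alpha> / of_real (exp s)" by (simp add: exp_minus field_simps)
      \<comment> \<open>From this index on the base 1 - s/k is nonzero, so the power with exponent b
        + k splits into its b-th and k-th powers.\<close>
      obtain N where N: "real N > s" using reals_Archimedean2 by blast
      have "\<forall>\<^sub>F n in sequentially. complex_of_real s powr \<alpha> * ((1 - complex_of_real (s / real (Suc n))) powr b * of_real ((1 + (-s) / real (Suc n)) ^ (Suc n))) = f n s"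
        using eventually_ge_at_top[of N]
      proof eventually_elim
        case (elim n)
        then have n: "s < real (Suc n)" using N by simp
        define x where "x = 1 - complex_of_real (s / real (Suc n))"
        have "x = of_real (1 - s / real (Suc n))" by (simp add: x_def)
        moreover have "1 - s / real (Suc n) \<noteq> 0" using n s by (simp add: field_simps)
        ultimately have "x \<noteq> 0" by (metis of_real_eq_0_iff)
        then have "x powr (b + of_nat (Suc n)) = x powr b * x ^ Suc n"
          by (subst powr_add) (simp only: powr_complexpow simp_thms)
        moreover have "of_real ((1 + (-s) / real (Suc n)) ^ (Suc n)) = x ^ Suc n"
          unfolding of_real_power by (simp add: x_def)
        ultimately show ?case unfolding f_def x_def[symmetric] using s n by simp
      qed
      from Lim_transform_eventually[OF * this] show ?thesis .
    qed
  qed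
  moreover have "integral {0..} (\<lambda>s. complex_of_real s powr \<alpha> / of_real (exp s)) = Gamma (\<alpha> + 1)"
    using Gamma_integral_complex[of "\<alpha> + 1"] assms by (intro integral_unique) simp
  moreover have "integral {0..} (f n) = of_nat (Suc n) powr (\<alpha> + 1) * jacobi_moment \<alpha> (b + of_nat (Suc n))" for n
    using int by (rule integral_unique)
  ultimately show ?thesis by simp
qed

text \<open>For large exponents the moment is determined by its recurrence in \<beta> together with
  its asymptotics as \<beta> tends to infinity along integers. The Beta function obeys the same
  recurrences, which covers the descent.\<close>

theorem jacobi_moment_eq_Beta:
  assumes "regular_exponent \<alpha>" "regular_exponent \<beta>"
  shows "jacobi_moment \<alpha> \<beta> = Beta (\<alpha> + 1) (\<beta> + 1)"
  using assms
proof (induct rule: exponent_induct[where r=0])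
  case (base \<alpha> \<beta>)
  note reg = base(1,2)
  have poch: "pochhammer (\<alpha> + \<beta> + 2) n * jacobi_moment \<alpha> (\<beta> + of_nat n) = pochhammer (\<beta> + 1) n * jacobi_moment \<alpha> \<beta>" for n
  proof (induction n)
    case (Suc n)
    have r: "(\<alpha> + \<beta> + 2 + of_nat n) * jacobi_moment \<alpha> (\<beta> + of_nat (Suc n)) = (\<beta> + 1 + of_nat n) * jacobi_moment \<alpha> (\<beta> + of_nat n)"
      using jacobi_moment_plus_1_right[OF reg(1) regular_exponent_plus_nat[OF reg(2)], of n] by (simp add: add_ac)
    have "pochhammer (\<alpha> + \<beta> + 2) (Suc n) * jacobi_moment \<alpha> (\<beta> + of_nat (Suc n)) =
      pochhammer (\<alpha> + \<beta> + 2) n * ((\<alpha> + \<beta> + 2 + of_nat n) * jacobi_moment \<alpha> (\<beta> + of_nat (Suc n)))"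
      by (simp only: pochhammer_Suc mult.assoc)
    also have "\<dots> = (\<beta> + 1 + of_nat n) * (pochhammer (\<alpha> + \<beta> + 2) n * jacobi_moment \<alpha> (\<beta> + of_nat n))"
      unfolding r by (simp only: mult_ac)
    also have "\<dots> = pochhammer (\<beta> + 1) (Suc n) * jacobi_moment \<alpha> \<beta>"
      unfolding Suc.IH by (simp only: pochhammer_Suc mult_ac)
    finally show ?case .
  qed simp
  \<comment> \<open>The Pochhammer factors are exactly those in the partial products of 1/Gamma, and
    the powers of Suc n differ by the exponent \<alpha> + 1. Since \<open>rGamma_series\<close> at k
    involves k + 1 factors, the moment occurs at \<beta> + k + 1, so the asymptotics are taken with
    b = \<beta> + 1.\<close>
  have eq: "rGamma_series (\<beta> + 1) (Suc n) * jacobi_moment \<alpha> \<beta> =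
      rGamma_series (\<alpha> + \<beta> + 2) (Suc n) * (of_nat (Suc n) powr (\<alpha> + 1) * jacobi_moment \<alpha> (\<beta> + 1 + of_nat (Suc n)))" for n
  proof -
    let ?k = "Suc n" and ?l = "complex_of_real (ln (real (Suc n)))"
    have ln: "Ln (of_nat ?k) = ?l" by (rule Ln_of_nat) (simp del: of_nat_Suc)
    define F where "F = (fact ?k :: complex)"
    define E where "E = exp ((\<beta> + 1) * ?l)"
    define E' where "E' = exp ((\<alpha> + 1) * ?l)"
    have nz: "F \<noteq> 0" "E \<noteq> 0" "E' \<noteq> 0" by (simp_all add: F_def E_def E'_def del: fact_Suc)
    have e: "exp ((\<alpha> + \<beta> + 2) * ?l) = E * E'"
      unfolding E_def E'_def exp_add[symmetric] by (simp only: ring_distribs) (simp add: algebra_simps)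
    have p: "of_nat ?k powr (\<alpha> + 1) = E'" unfolding powr_def ln E'_def by (simp del: of_nat_Suc)
    have r: "rGamma_series (\<alpha> + \<beta> + 2) ?k = pochhammer (\<alpha> + \<beta> + 2) (?k + 1) / (F * (E * E'))"
      unfolding rGamma_series_def F_def e[symmetric] by simp
    have i: "\<beta> + 1 + of_nat ?k = \<beta> + of_nat (?k + 1)" by simp
    have "rGamma_series (\<alpha> + \<beta> + 2) ?k * (of_nat ?k powr (\<alpha> + 1) * jacobi_moment \<alpha> (\<beta> + 1 + of_nat ?k)) =
      (pochhammer (\<alpha> + \<beta> + 2) (?k + 1) * jacobi_moment \<alpha> (\<beta> + of_nat (?k + 1))) / (F * E)"
      unfolding r p i using nz by (simp only: divide_simps) simp
    also have "\<dots> = rGamma_series (\<beta> + 1) ?k * jacobi_moment \<alpha> \<beta>"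
      unfolding poch rGamma_series_def F_def E_def by simp
    finally show ?thesis ..
  qed
  have "(\<lambda>n. rGamma_series (\<beta> + 1) (Suc n) * jacobi_moment \<alpha> \<beta>) \<longlonglongrightarrow> rGamma (\<beta> + 1) * jacobi_moment \<alpha> \<beta>"
    by (intro tendsto_mult tendsto_const LIMSEQ_Suc rGamma_series_LIMSEQ)
  moreover have "(\<lambda>n. rGamma_series (\<alpha> + \<beta> + 2) (Suc n) * (of_nat (Suc n) powr (\<alpha> + 1) * jacobi_moment \<alpha> (\<beta> + 1 + of_nat (Suc n))))
      \<longlonglongrightarrow> rGamma (\<alpha> + \<beta> + 2) * Gamma (\<alpha> + 1)"
    using base by (intro tendsto_mult jacobi_moment_asymptotic LIMSEQ_Suc rGamma_series_LIMSEQ) auto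
  ultimately have "rGamma (\<beta> + 1) * jacobi_moment \<alpha> \<beta> = rGamma (\<alpha> + \<beta> + 2) * Gamma (\<alpha> + 1)"
    unfolding eq by (rule LIMSEQ_unique)
  moreover have "rGamma (\<beta> + 1) * Gamma (\<beta> + 1) = 1"
    using reg(2) by (simp add: regular_exponent_def Gamma_def rGamma_eq_zero_iff)
  ultimately show ?case unfolding Beta_altdef
    by (simp add: add_ac) (metis (no_types, lifting) mult.assoc mult.commute mult.right_neutral)
next
  case (left \<alpha> \<beta>)
  note reg = left(1,2)
  have "\<alpha> + 1 \<noteq> 0" by (rule regular_exponent_plus_1_ne_0[OF reg(1)])
  moreover have "(\<alpha> + 1) * jacobi_moment \<alpha> \<beta> = (\<alpha> + 1) * Beta (\<alpha> + 1) (\<beta> + 1)"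
    using jacobi_moment_plus_1_left[OF reg] Beta_plus1_left[of "\<alpha> + 1" "\<beta> + 1"] reg(1)
    unfolding left(3) by (simp add: regular_exponent_def algebra_simps)
  ultimately show ?case by simp
next
  case (right \<alpha> \<beta>)
  note reg = right(1,2)
  have "\<beta> + 1 \<noteq> 0" by (rule regular_exponent_plus_1_ne_0[OF reg(2)])
  moreover have "(\<beta> + 1) * jacobi_moment \<alpha> \<beta> = (\<beta> + 1) * Beta (\<alpha> + 1) (\<beta> + 1)"
    using jacobi_moment_plus_1_right[OF reg] Beta_plus1_right[of "\<beta> + 1" "\<alpha> + 1"] reg(2)
    unfolding right(3) by (simp add: regular_exponent_def algebra_simps)
  ultimately show ?case by simp
qed

section \<open>The jump across the interval\<close>

lemma isCont_cauchy_integral_linepath: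
  assumes "continuous_on (closed_segment a b) f" "z \<notin> closed_segment a b"
  shows "isCont (\<lambda>z. contour_integral (linepath a b) (\<lambda>u. f u / (u - z))) z"
proof -
  have int: "((\<lambda>u. f u / (u - w) ^ 1) has_contour_integral contour_integral (linepath a b) (\<lambda>u. f u / (u - w))) (linepath a b)"
    if "w \<in> UNIV - path_image (linepath a b)" for w
  proof -
    have "(\<lambda>u. f u / (u - w)) contour_integrable_on linepath a b"
      using that by (intro contour_integrable_continuous_linepath continuous_intros assms(1)) auto
    then show ?thesis by (simp add: has_contour_integral_integral)
  qed
  have "((\<lambda>z. contour_integral (linepath a b) (\<lambda>u. f u / (u - z))) has_field_derivative
      (of_nat 1 * contour_integral (linepath a b) (\<lambda>u. f u / (u - z) ^ Suc 1))) (at z)"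
    by (rule Cauchy_next_derivative(2)[where B="norm (b - a)" and S=UNIV, OF _ _ int])
       (use assms in \<open>auto simp: vector_derivative_linepath_at\<close>)
  then show ?thesis by (rule DERIV_isCont)
qed

text \<open>The interval is deformed to the two lower sides of the triangle with vertices \<open>0\<close>, \<open>1\<close> and
  this point.\<close>

definition apex :: complex where "apex = Complex (1/2) (-1/2)"

text \<open>Being continuous at the points of (0,1), it continues the transform from the upper
  half-plane across the interval. Inside the triangle it differs from the transform by a residue,
  which becomes the jump.\<close>

definition lower_stieltjes :: "complex \<Rightarrow> complex \<Rightarrow> complex \<Rightarrow> complex" where
  "lower_stieltjes \<alpha> \<beta> z =
     contour_integral (linepath 0 apex) (\<lambda>u. jacobi_weight \<alpha> \<beta> u / (u - z)) +
     contour_integral (linepath apex 1) (\<lambda>u. jacobi_weight \<alpha> \<beta> u / (u - z))"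

abbreviation lower_triangle :: "complex set" where
  "lower_triangle \<equiv> convex hull {0, 1, apex}"

lemma lower_triangle_subset: "lower_triangle \<subseteq> {z. 0 \<le> Re z \<and> Re z \<le> 1 \<and> Im z \<le> 0}"
proof (rule hull_minimal)
  have "{z. 0 \<le> Re z \<and> Re z \<le> 1 \<and> Im z \<le> 0} = {z. Re z \<ge> 0} \<inter> {z. Re z \<le> 1} \<inter> {z. Im z \<le> 0}" by auto
  then show "convex {z. 0 \<le> Re z \<and> Re z \<le> 1 \<and> Im z \<le> 0}"
    by (simp add: convex_Int convex_halfspace_Re_le convex_halfspace_Re_ge convex_halfspace_Im_le)
qed (auto simp: apex_def)

definition open_lower_triangle :: "complex set" where
  "open_lower_triangle = {z. Im z < 0 \<and> Re z + Im z > 0 \<and> Re z - Im z < 1}"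

lemma open_lower_triangle: "open open_lower_triangle"
  unfolding open_lower_triangle_def by (intro open_Collect_conj open_Collect_less continuous_intros)

lemma open_lower_triangle_interior: "open_lower_triangle \<subseteq> interior lower_triangle"
proof (rule interior_maximal[OF _ open_lower_triangle])
  show "open_lower_triangle \<subseteq> lower_triangle"
  proof
    fix z assume "z \<in> open_lower_triangle"
    then have z: "Im z < 0" "Re z + Im z > 0" "Re z - Im z < 1" by (auto simp: open_lower_triangle_def)
    \<comment> \<open>Barycentric coordinates with respect to 0, 1 and \<open>apex\<close>; the
      three inequalities say that they are positive.\<close>
    have "z = (1 - Re z + Im z) *\<^sub>R 0 + (Re z + Im z) *\<^sub>R 1 + (- 2 * Im z) *\<^sub>R apex"
      by (simp add: complex_eq_iff apex_def)
    then show "z \<in> lower_triangle" unfolding convex_hull_3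
      using z by (intro CollectI exI[of _ "1 - Re z + Im z"] exI[of _ "Re z + Im z"] exI[of _ "- 2 * Im z"]) auto
  qed
qed

lemma interior_lower_triangle_Re: "z \<in> interior lower_triangle \<Longrightarrow> 0 < Re z \<and> Re z < 1"
proof -
  assume "z \<in> interior lower_triangle"
  moreover have "interior lower_triangle \<subseteq> interior {z. 0 \<le> Re z} \<inter> interior {z. Re z \<le> 1}"
    using lower_triangle_subset by (auto intro!: interior_mono)
  moreover have "interior {z. 0 \<le> Re z} = {z. 0 < Re z}" "interior {z. Re z \<le> 1} = {z. Re z < 1}"
    using interior_halfspace_ge[of "1::complex" 0] interior_halfspace_le[of "1::complex" 1]
    by (simp_all add: inner_complex_def)
  ultimately show ?thesis by auto
qed

lemma segments_lower_triangle:
  "closed_segment 0 1 \<subseteq> lower_triangle" "closed_segment 0 apex \<subseteq> lower_triangle"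
  "closed_segment apex 1 \<subseteq> lower_triangle" "closed_segment 1 apex \<subseteq> lower_triangle"
  "closed_segment apex 0 \<subseteq> lower_triangle"
  by (auto simp: segment_convex_hull intro!: hull_mono)

lemma lower_segments:
  assumes "u \<in> closed_segment 0 apex"
  shows "\<exists>s\<in>{0..1}. u = Complex (s / 2) (- s / 2)"
  using assms by (auto simp: closed_segment_def apex_def complex_eq_iff)

lemma right_segments:
  assumes "u \<in> closed_segment apex 1"
  shows "\<exists>s\<in>{0..1}. u = Complex (1/2 + s / 2) (- 1 / 2 + s / 2)"
  using assms by (auto simp: closed_segment_def apex_def complex_eq_iff algebra_simps)

context
  fixes \<alpha> \<beta> :: complex
  assumes pos: "Re \<alpha> > 0" "Re \<beta> > 0"
begin

lemma continuous_on_weight_triangle: "continuous_on lower_triangle (jacobi_weight \<alpha> \<beta>)"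
  by (rule continuous_on_subset[OF continuous_on_jacobi_weight[OF pos]]) (use lower_triangle_subset in auto)

lemma field_differentiable_weight:
  assumes "z \<in> interior lower_triangle"
  shows "jacobi_weight \<alpha> \<beta> field_differentiable at z"
proof -
  have "jacobi_weight \<alpha> \<beta> holomorphic_on {z. Re z > 0} \<inter> {z. Re z < 1}"
    unfolding jacobi_weight_def by (intro holomorphic_intros) (auto simp: complex_nonpos_Reals_iff)
  then show ?thesis
    by (rule holomorphic_on_imp_differentiable_at)
       (use interior_lower_triangle_Re[OF assms] in \<open>auto intro!: open_Int open_halfspace_Re_lt open_halfspace_Re_gt\<close>)
qed

lemma stieltjes_eq_contour_integral:
  assumes "z \<in> slit_plane"
  shows "contour_integral (linepath 0 1) (\<lambda>u. jacobi_weight \<alpha> \<beta> u / (u - z)) = stieltjes \<alpha> \<beta> z"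
  using has_contour_integral_fp_integral[OF pos regular_exponent_Re_pos[OF pos(1)] regular_exponent_Re_pos[OF pos(2)] analytic_cauchy_kernel[OF assms]]
  by (intro contour_integral_unique) (simp add: stieltjes_def)

lemma continuous_on_cauchy_segments:
  assumes "z \<notin> closed_segment a b" "closed_segment a b \<subseteq> lower_triangle"
  shows "continuous_on (closed_segment a b) (\<lambda>u. jacobi_weight \<alpha> \<beta> u / (u - z))"
  using assms by (auto intro!: continuous_intros continuous_on_subset[OF continuous_on_weight_triangle])

lemma triangle_path_integral:
  assumes "z \<in> slit_plane" "z \<notin> closed_segment 0 apex" "z \<notin> closed_segment apex 1"
    and "((\<lambda>u. jacobi_weight \<alpha> \<beta> u / (u - z)) has_contour_integral I) (linepath 0 1 +++ linepath 1 apex +++ linepath apex 0)"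
  shows "stieltjes \<alpha> \<beta> z = lower_stieltjes \<alpha> \<beta> z + I"
proof -
  let ?f = "\<lambda>u. jacobi_weight \<alpha> \<beta> u / (u - z)"
  have "contour_integral (linepath 0 apex) ?f = - contour_integral (linepath apex 0) ?f"
    "contour_integral (linepath apex 1) ?f = - contour_integral (linepath 1 apex) ?f"
    using assms segments_lower_triangle
    by (intro contour_integral_reverse_linepath continuous_on_cauchy_segments; simp)+
  moreover have "contour_integral (linepath 0 1) ?f + contour_integral (linepath 1 apex) ?f + contour_integral (linepath apex 0) ?f = I"
    using assms(4) by (rule has_chain_integral_chain_integral3)
  ultimately show ?thesis
    unfolding lower_stieltjes_def stieltjes_eq_contour_integral[OF assms(1)] by (simp add: algebra_simps)
qed

lemma stieltjes_eq_lower_outside: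
  assumes "z \<in> slit_plane" "z \<notin> lower_triangle"
  shows "stieltjes \<alpha> \<beta> z = lower_stieltjes \<alpha> \<beta> z"
proof -
  let ?f = "\<lambda>u. jacobi_weight \<alpha> \<beta> u / (u - z)"
  have "(?f has_contour_integral 0) (linepath 0 1 +++ linepath 1 apex +++ linepath apex 0)"
  proof (rule Cauchy_theorem_triangle_interior)
    show "continuous_on lower_triangle ?f"
      using assms by (auto intro!: continuous_intros continuous_on_weight_triangle)
    have "?f field_differentiable at u" if "u \<in> interior lower_triangle" for u
      using that assms interior_subset
      by (intro field_differentiable_divide field_differentiable_weight derivative_intros) auto
    then show "?f holomorphic_on interior lower_triangle"
      by (simp add: holomorphic_on_def field_differentiable_at_within)
  qed
  moreover have "z \<notin> closed_segment 0 apex" "z \<notin> closed_segment apex 1"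
    using assms(2) segments_lower_triangle by auto
  ultimately show ?thesis using triangle_path_integral[OF assms(1)] by force
qed

lemma open_lower_triangle_segments:
  assumes "z \<in> open_lower_triangle"
  shows "z \<notin> closed_segment 0 1" "z \<notin> closed_segment 0 apex" "z \<notin> closed_segment apex 1" "z \<in> slit_plane"
proof -
  show "z \<notin> closed_segment 0 1" "z \<in> slit_plane"
    using assms by (auto simp: open_lower_triangle_def slit_plane_def closed_segment_def)
  show "z \<notin> closed_segment 0 apex"
  proof
    assume "z \<in> closed_segment 0 apex"
    from lower_segments[OF this] assms show False by (auto simp: open_lower_triangle_def)
  qed
  show "z \<notin> closed_segment apex 1"
  proof
    assume "z \<in> closed_segment apex 1"
    from right_segments[OF this] assms show False by (auto simp: open_lower_triangle_def)
  qed
qed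

lemma stieltjes_eq_lower_inside:
  assumes "z \<in> open_lower_triangle"
  shows "stieltjes \<alpha> \<beta> z = lower_stieltjes \<alpha> \<beta> z - 2 * of_real pi * \<i> * jacobi_weight \<alpha> \<beta> z"
proof -
  let ?g = "linepath 0 1 +++ linepath 1 apex +++ linepath apex 0"
  note seg = open_lower_triangle_segments[OF assms]
  have zi: "z \<in> interior lower_triangle" using assms open_lower_triangle_interior by auto
  have "((\<lambda>w. jacobi_weight \<alpha> \<beta> w / (w - z)) has_contour_integral (of_real (2 * pi) * \<i> * winding_number ?g z * jacobi_weight \<alpha> \<beta> z)) ?g"
  proof (rule Cauchy_integral_formula_convex[where K="{}" and S="lower_triangle"])
    show "path_image ?g \<subseteq> lower_triangle - {z}"
      using seg segments_lower_triangle by (auto simp: path_image_join closed_segment_commute)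
  qed (use zi continuous_on_weight_triangle field_differentiable_weight in \<open>auto simp: convex_convex_hull\<close>)
  \<comment> \<open>The boundary runs 0, 1, \<open>apex\<close>, 0 with \<open>apex\<close> below
    the real axis, hence clockwise.\<close>
  moreover have "winding_number ?g z = -1"
    using winding_number_triangle[OF zi] assms by (simp add: open_lower_triangle_def)
  ultimately have "((\<lambda>w. jacobi_weight \<alpha> \<beta> w / (w - z)) has_contour_integral (- (2 * of_real pi * \<i> * jacobi_weight \<alpha> \<beta> z))) ?g"
    by simp
  from triangle_path_integral[OF seg(4,2,3) this] show ?thesis by simp
qed

lemma isCont_lower_stieltjes:
  assumes "z \<notin> closed_segment 0 apex" "z \<notin> closed_segment apex 1"
  shows "isCont (lower_stieltjes \<alpha> \<beta>) z"
  unfolding lower_stieltjes_def using assms segments_lower_triangle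
  by (intro continuous_intros isCont_cauchy_integral_linepath continuous_on_subset[OF continuous_on_weight_triangle]) auto

text \<open>Approaching x from above, z stays outside the triangle and the two integrals agree. From
  below it is eventually inside, and the Cauchy formula contributes the residue of the weight at
  z.\<close>

lemma stieltjes_boundary_large:
  assumes "0 < x" "x < 1"
  shows "(stieltjes \<alpha> \<beta> \<longlongrightarrow> lower_stieltjes \<alpha> \<beta> (of_real x)) (upper_at x)"
    and "(stieltjes \<alpha> \<beta> \<longlongrightarrow> lower_stieltjes \<alpha> \<beta> (of_real x) - 2 * of_real pi * \<i> * jacobi_weight \<alpha> \<beta> (of_real x)) (lower_at x)"
proof -
  have x: "complex_of_real x \<notin> closed_segment 0 apex" "complex_of_real x \<notin> closed_segment apex 1"
    using lower_segments[of "of_real x"] right_segments[of "of_real x"] assms by (auto simp: complex_eq_iff)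
  have lim: "(lower_stieltjes \<alpha> \<beta> \<longlongrightarrow> lower_stieltjes \<alpha> \<beta> (of_real x)) (at (of_real x) within S)" for S
    using isCont_lower_stieltjes[OF x] by (simp add: continuous_at_imp_continuous_at_within continuous_within[symmetric])
  have "\<forall>\<^sub>F z in upper_at x. lower_stieltjes \<alpha> \<beta> z = stieltjes \<alpha> \<beta> z"
    unfolding upper_at_def eventually_at_filter
  proof (rule always_eventually, intro allI impI)
    fix z :: complex assume "z \<in> {z. 0 < Im z}"
    then have "z \<in> slit_plane" "z \<notin> lower_triangle"
      using lower_triangle_subset by (auto simp: slit_plane_def)
    then show "lower_stieltjes \<alpha> \<beta> z = stieltjes \<alpha> \<beta> z" by (rule stieltjes_eq_lower_outside[symmetric])
  qed
  then show "(stieltjes \<alpha> \<beta> \<longlongrightarrow> lower_stieltjes \<alpha> \<beta> (of_real x)) (upper_at x)"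
    using lim unfolding upper_at_def by (rule Lim_transform_eventually[rotated])
  have "isCont (jacobi_weight \<alpha> \<beta>) (of_real x)"
    unfolding jacobi_weight_def using assms
    by (intro continuous_intros) (auto simp: complex_nonpos_Reals_iff)
  then have w: "(jacobi_weight \<alpha> \<beta> \<longlongrightarrow> jacobi_weight \<alpha> \<beta> (of_real x)) (at (of_real x) within S)" for S
    by (simp add: continuous_at_imp_continuous_at_within continuous_within[symmetric])
  have "open {z. Re z + Im z > 0 \<and> Re z - Im z < 1}"
    by (intro open_Collect_conj open_Collect_less continuous_intros)
  then have "\<forall>\<^sub>F z in nhds (of_real x). z \<in> {z. Re z + Im z > 0 \<and> Re z - Im z < 1}"
    using assms by (intro eventually_nhds_in_open) auto
  then have "\<forall>\<^sub>F z in lower_at x. lower_stieltjes \<alpha> \<beta> z - 2 * of_real pi * \<i> * jacobi_weight \<alpha> \<beta> z = stieltjes \<alpha> \<beta> z"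
    unfolding lower_at_def eventually_at_filter
    by eventually_elim (auto simp: stieltjes_eq_lower_inside open_lower_triangle_def)
  moreover have "((\<lambda>z. lower_stieltjes \<alpha> \<beta> z - 2 * of_real pi * \<i> * jacobi_weight \<alpha> \<beta> z) \<longlongrightarrow>
     lower_stieltjes \<alpha> \<beta> (of_real x) - 2 * of_real pi * \<i> * jacobi_weight \<alpha> \<beta> (of_real x)) (lower_at x)"
    unfolding lower_at_def by (intro tendsto_intros lim w)
  ultimately show "(stieltjes \<alpha> \<beta> \<longlongrightarrow> lower_stieltjes \<alpha> \<beta> (of_real x) - 2 * of_real pi * \<i> * jacobi_weight \<alpha> \<beta> (of_real x)) (lower_at x)"
    by (rule Lim_transform_eventually[rotated])
qed

section \<open>Growth near the endpoint 0\<close>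

text \<open>The left leg leaves 0 downwards at 45 degrees, so a point z with Im z \<ge> 0 has
  distance at least |z|/2 from it; the right leg stays at distance at least 1/2 from 0. The weight
  is bounded on both legs.\<close>

lemma lower_stieltjes_bound:
  obtains C where "\<And>z. Im z \<ge> 0 \<Longrightarrow> z \<noteq> 0 \<Longrightarrow> norm z < 1/4 \<Longrightarrow> norm (lower_stieltjes \<alpha> \<beta> z) \<le> C / norm z"
proof -
  have "compact (jacobi_weight \<alpha> \<beta> ` lower_triangle)"
    by (intro compact_continuous_image continuous_on_weight_triangle compact_convex_hull) auto
  then obtain M where M: "M > 0" "\<And>u. u \<in> lower_triangle \<Longrightarrow> norm (jacobi_weight \<alpha> \<beta> u) \<le> M"
    by (auto dest!: compact_imp_bounded simp: bounded_pos)
  have "norm (lower_stieltjes \<alpha> \<beta> z) \<le> (2 * M * norm apex + M * norm (1 - apex)) / norm z"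
    if z: "Im z \<ge> 0" "z \<noteq> 0" "norm z < 1/4" for z
  proof -
    let ?f = "\<lambda>u. jacobi_weight \<alpha> \<beta> u / (u - z)"
    have d1: "norm z \<le> 2 * norm (u - z)" if u: "u \<in> closed_segment 0 apex" for u
    proof -
      obtain s where s: "s \<in> {0..1}" "u = Complex (s / 2) (- s / 2)" using lower_segments[OF u] by auto
      have "(Re z)\<^sup>2 + (Im z)\<^sup>2 \<le> 4 * ((s / 2 - Re z)\<^sup>2 + (s / 2 + Im z)\<^sup>2)"
      proof (cases "Re z \<ge> 0")
        case True
        \<comment> \<open>Completing the square in s; the remaining term 4 Re z Im z is nonnegative
          in this quadrant.\<close>
        have "4 * ((s / 2 - Re z)\<^sup>2 + (s / 2 + Im z)\<^sup>2) - 2 * ((Re z)\<^sup>2 + (Im z)\<^sup>2) = 2 * (s - (Re z - Im z))\<^sup>2 + 4 * (Re z * Im z)"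
          by (simp add: power2_eq_square algebra_simps)
        moreover have "0 \<le> 2 * (s - (Re z - Im z))\<^sup>2 + 4 * (Re z * Im z)"
          using True z(1) by simp
        moreover have "B \<le> A" if "A - 2 * B = C" "0 \<le> C" "0 \<le> B" for A B C :: real
          using that by linarith
        ultimately show ?thesis by (metis sum_power2_ge_zero)
      next
        case False
        have "(Re z)\<^sup>2 \<le> (s / 2 - Re z)\<^sup>2" using False s(1) by (intro power2_le_iff_abs_le[THEN iffD2]) auto
        moreover have "(Im z)\<^sup>2 \<le> (s / 2 + Im z)\<^sup>2" using z(1) s(1) by (intro power_mono) auto
        moreover have "a + b \<le> 4 * (c + d)" if "a \<le> c" "b \<le> d" "0 \<le> c" "0 \<le> d" for a b c d :: real
        proof -
          have "a + b \<le> 1 * (c + d)" using that by simp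
          also have "\<dots> \<le> 4 * (c + d)" using that by (intro mult_right_mono) auto
          finally show ?thesis .
        qed
        ultimately show ?thesis by (metis zero_le_power2)
      qed
      then have "(norm z)\<^sup>2 \<le> (2 * norm (u - z))\<^sup>2"
        unfolding power_mult_distrib cmod_power2 s(2)
        by (simp add: power2_eq_square algebra_simps)
      then show ?thesis by (rule power2_le_imp_le) simp
    qed
    have d2: "norm z \<le> norm (u - z)" if u: "u \<in> closed_segment apex 1" for u
    proof -
      obtain s where s: "s \<in> {0..1}" "u = Complex (1/2 + s / 2) (- 1 / 2 + s / 2)" using right_segments[OF u] by auto
      have "1/2 \<le> norm u" using s abs_Re_le_cmod[of u] by auto
      moreover have "norm u - norm z \<le> norm (u - z)" by (rule norm_triangle_ineq2)
      ultimately show ?thesis using z(3) by linarith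
    qed
    have n1: "z \<notin> closed_segment 0 apex" using d1[of z] z(2) by auto
    have n2: "z \<notin> closed_segment apex 1" using d2[of z] z(2) by auto
    have "norm (contour_integral (linepath 0 apex) ?f) \<le> 2 * M / norm z * norm (apex - 0)"
    proof (rule has_contour_integral_bound_linepath)
      show "(?f has_contour_integral contour_integral (linepath 0 apex) ?f) (linepath 0 apex)"
        using n1 segments_lower_triangle(2)
        by (intro has_contour_integral_integral contour_integrable_continuous_linepath continuous_on_cauchy_segments)
      fix u assume u: "u \<in> closed_segment 0 apex"
      then have "u \<noteq> z" using n1 by auto
      have "norm (?f u) = norm (jacobi_weight \<alpha> \<beta> u) / norm (u - z)" by (simp add: norm_divide)
      also have "\<dots> \<le> M / (norm z / 2)"
        using M(2)[of u] M(1) segments_lower_triangle(2) u d1[OF u] z(2) by (intro frac_le) auto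
      finally show "norm (?f u) \<le> 2 * M / norm z" by (simp add: mult.commute)
    qed (use M z in simp)
    moreover have "norm (contour_integral (linepath apex 1) ?f) \<le> M / norm z * norm (1 - apex)"
    proof (rule has_contour_integral_bound_linepath)
      show "(?f has_contour_integral contour_integral (linepath apex 1) ?f) (linepath apex 1)"
        using n2 segments_lower_triangle(3)
        by (intro has_contour_integral_integral contour_integrable_continuous_linepath continuous_on_cauchy_segments)
      fix u assume u: "u \<in> closed_segment apex 1"
      have "norm (?f u) = norm (jacobi_weight \<alpha> \<beta> u) / norm (u - z)" by (simp add: norm_divide)
      also have "\<dots> \<le> M / norm z"
        using M(2)[of u] M(1) segments_lower_triangle(3) u d2[OF u] z(2) by (intro frac_le) auto
      finally show "norm (?f u) \<le> M / norm z" .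
    qed (use M z in simp)
    ultimately show ?thesis unfolding lower_stieltjes_def
      by (intro order_trans[OF norm_triangle_ineq]) (simp add: add_divide_distrib)
  qed
  then show thesis by (rule that)
qed

end

lemma cnj_slit_plane: "z \<in> slit_plane \<Longrightarrow> cnj z \<in> slit_plane"
  unfolding slit_plane_def by (auto simp: image_iff) (metis atLeastAtMost_iff complex_cnj_cnj complex_cnj_complex_of_real)

text \<open>The path is deformed downwards only, so the growth estimate is available for Im z \<ge>
  0. Conjugation transfers it to the lower half-plane at the cost of conjugating the
  exponents.\<close>

lemma cnj_stieltjes:
  assumes "Re \<alpha> > 0" "Re \<beta> > 0" "z \<in> slit_plane"
  shows "stieltjes (cnj \<alpha>) (cnj \<beta>) (cnj z) = cnj (stieltjes \<alpha> \<beta> z)"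
proof -
  have zc: "cnj z \<in> slit_plane"
    using assms(3) by (rule cnj_slit_plane)
  have "((\<lambda>t. jacobi_weight \<alpha> \<beta> (of_real t) * (1 / (of_real t - z))) has_integral stieltjes \<alpha> \<beta> z) {0..1}"
    unfolding stieltjes_def using assms by (intro has_integral_fp_integral regular_exponent_Re_pos analytic_cauchy_kernel)
  then have "(cnj \<circ> (\<lambda>t. jacobi_weight \<alpha> \<beta> (of_real t) * (1 / (of_real t - z))) has_integral cnj (stieltjes \<alpha> \<beta> z)) {0..1}"
    by (simp only: has_integral_cnj)
  then have "((\<lambda>t. jacobi_weight (cnj \<alpha>) (cnj \<beta>) (of_real t) * (1 / (of_real t - cnj z))) has_integral cnj (stieltjes \<alpha> \<beta> z)) {0..1}"
    by (rule has_integral_eq[rotated]) (auto simp: jacobi_weight_def cnj_powr)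
  moreover have "((\<lambda>t. jacobi_weight (cnj \<alpha>) (cnj \<beta>) (of_real t) * (1 / (of_real t - cnj z))) has_integral stieltjes (cnj \<alpha>) (cnj \<beta>) (cnj z)) {0..1}"
    unfolding stieltjes_def using assms zc by (intro has_integral_fp_integral regular_exponent_Re_pos analytic_cauchy_kernel) auto
  ultimately show ?thesis by (metis has_integral_unique)
qed

text \<open>This bound is crude but sufficient: one use of \<open>stieltjes_plus_1_left\<close>
  turns it into boundedness of the transform with \<alpha> raised by one.\<close>

lemma stieltjes_bound_near_0:
  assumes "Re \<alpha> > 0" "Re \<beta> > 0"
  obtains C where "\<And>z. z \<in> slit_plane \<Longrightarrow> norm z < 1/4 \<Longrightarrow> norm (z * stieltjes \<alpha> \<beta> z) \<le> C"
proof -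
  have main: "\<exists>C. \<forall>z. z \<in> slit_plane \<and> Im z \<ge> 0 \<and> norm z < 1/4 \<longrightarrow> norm (z * stieltjes \<alpha> \<beta> z) \<le> C"
    if pos: "Re \<alpha> > 0" "Re \<beta> > 0" for \<alpha> \<beta>
  proof -
    obtain C where C: "\<And>z. Im z \<ge> 0 \<Longrightarrow> z \<noteq> 0 \<Longrightarrow> norm z < 1/4 \<Longrightarrow> norm (lower_stieltjes \<alpha> \<beta> z) \<le> C / norm z"
      using lower_stieltjes_bound[OF pos] by blast
    have "norm (z * stieltjes \<alpha> \<beta> z) \<le> C" if z: "z \<in> slit_plane" "Im z \<ge> 0" "norm z < 1/4" for z
    proof -
      have "z \<notin> lower_triangle"
      proof
        assume "z \<in> lower_triangle"
        then have "Im z = 0" "0 \<le> Re z" "Re z \<le> 1" using lower_triangle_subset z(2) by fastforce+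
        then have "z = of_real (Re z)" "Re z \<in> {0..1}" by (auto simp: complex_eq_iff)
        with z(1) show False unfolding slit_plane_def by blast
      qed
      then have "norm (stieltjes \<alpha> \<beta> z) \<le> C / norm z"
        using C[OF z(2) slit_plane_ne_0[OF z(1)] z(3)] stieltjes_eq_lower_outside[OF pos z(1)] by simp
      then show ?thesis using slit_plane_ne_0[OF z(1)] by (simp add: norm_mult field_simps)
    qed
    then show ?thesis by blast
  qed
  obtain C where C: "\<And>z. z \<in> slit_plane \<Longrightarrow> Im z \<ge> 0 \<Longrightarrow> norm z < 1/4 \<Longrightarrow> norm (z * stieltjes \<alpha> \<beta> z) \<le> C"
    using main[OF assms] by blast
  obtain D where D: "\<And>z. z \<in> slit_plane \<Longrightarrow> Im z \<ge> 0 \<Longrightarrow> norm z < 1/4 \<Longrightarrow> norm (z * stieltjes (cnj \<alpha>) (cnj \<beta>) z) \<le> D"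
    using main[of "cnj \<alpha>" "cnj \<beta>"] assms by auto
  have "norm (z * stieltjes \<alpha> \<beta> z) \<le> max C D" if z: "z \<in> slit_plane" "norm z < 1/4" for z
  proof (cases "Im z \<ge> 0")
    case True
    from C[OF z(1) this z(2)] show ?thesis by simp
  next
    case False
    have zc: "cnj z \<in> slit_plane"
      using z(1) by (rule cnj_slit_plane)
    have "norm (cnj z * stieltjes (cnj \<alpha>) (cnj \<beta>) (cnj z)) \<le> D"
      using False z zc by (intro D) auto
    then show ?thesis unfolding cnj_stieltjes[OF assms z(1)] by (simp add: norm_mult)
  qed
  then show thesis by (rule that)
qed

text \<open>In the descent the moment is constant and has no jump, while dividing by z or 1 - z
  lowers the weight in the jump by precisely the factor x or 1 - x.\<close>

theorem stieltjes_boundary: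
  assumes "regular_exponent \<alpha>" "regular_exponent \<beta>"
  shows "\<forall>x. 0 < x \<and> x < 1 \<longrightarrow> (\<exists>L. (stieltjes \<alpha> \<beta> \<longlongrightarrow> L + 2 * of_real pi * \<i> * jacobi_weight \<alpha> \<beta> (of_real x)) (upper_at x) \<and>
     (stieltjes \<alpha> \<beta> \<longlongrightarrow> L) (lower_at x))"
  using assms
proof (induct rule: exponent_induct[where r=0])
  case (base \<alpha> \<beta>)
  show ?case
  proof (intro allI impI)
    fix x :: real assume x: "0 < x \<and> x < 1"
    from stieltjes_boundary_large[OF base(3,4), of x] x
    show "\<exists>L. (stieltjes \<alpha> \<beta> \<longlongrightarrow> L + 2 * of_real pi * \<i> * jacobi_weight \<alpha> \<beta> (of_real x)) (upper_at x) \<and>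
     (stieltjes \<alpha> \<beta> \<longlongrightarrow> L) (lower_at x)"
      by (intro exI[of _ "lower_stieltjes \<alpha> \<beta> (of_real x) - 2 * of_real pi * \<i> * jacobi_weight \<alpha> \<beta> (of_real x)"]) simp
  qed
next
  case (left \<alpha> \<beta>)
  show ?case
  proof (intro allI impI)
    fix x :: real assume x: "0 < x \<and> x < 1"
    then obtain L where L: "(stieltjes (\<alpha> + 1) \<beta> \<longlongrightarrow> L + 2 * of_real pi * \<i> * jacobi_weight (\<alpha> + 1) \<beta> (of_real x)) (upper_at x)"
       "(stieltjes (\<alpha> + 1) \<beta> \<longlongrightarrow> L) (lower_at x)" using left(3) by blast
    have lim: "(stieltjes \<alpha> \<beta> \<longlongrightarrow> (c - jacobi_moment \<alpha> \<beta>) / of_real x) (at (of_real x) within S)"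
      if "(stieltjes (\<alpha> + 1) \<beta> \<longlongrightarrow> c) (at (of_real x) within S)" "\<And>z. z \<in> S \<Longrightarrow> Im z \<noteq> 0" for c S
    proof (rule Lim_transform_eventually)
      show "((\<lambda>z. (stieltjes (\<alpha> + 1) \<beta> z - jacobi_moment \<alpha> \<beta>) / z) \<longlongrightarrow> (c - jacobi_moment \<alpha> \<beta>) / of_real x) (at (of_real x) within S)"
        using x by (intro tendsto_intros that) auto
      show "\<forall>\<^sub>F z in at (of_real x) within S. (stieltjes (\<alpha> + 1) \<beta> z - jacobi_moment \<alpha> \<beta>) / z = stieltjes \<alpha> \<beta> z"
        unfolding eventually_at_filter
      proof (rule always_eventually, intro allI impI)
        fix z assume "z \<in> S"
        then have "z \<in> slit_plane" using that(2)[of z] by (auto simp: slit_plane_def)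
        then show "(stieltjes (\<alpha> + 1) \<beta> z - jacobi_moment \<alpha> \<beta>) / z = stieltjes \<alpha> \<beta> z"
          using stieltjes_plus_1_left[OF left(1,2)] slit_plane_ne_0 by simp
      qed
    qed
    have "(L + 2 * of_real pi * \<i> * jacobi_weight (\<alpha> + 1) \<beta> (of_real x) - jacobi_moment \<alpha> \<beta>) / of_real x =
        (L - jacobi_moment \<alpha> \<beta>) / of_real x + 2 * of_real pi * \<i> * jacobi_weight \<alpha> \<beta> (of_real x)"
      using x by (simp add: jacobi_weight_def powr_add field_simps)
    then show "\<exists>L. (stieltjes \<alpha> \<beta> \<longlongrightarrow> L + 2 * of_real pi * \<i> * jacobi_weight \<alpha> \<beta> (of_real x)) (upper_at x) \<and>
     (stieltjes \<alpha> \<beta> \<longlongrightarrow> L) (lower_at x)"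
      using lim[OF L(1)[unfolded upper_at_def]] lim[OF L(2)[unfolded lower_at_def]]
      unfolding upper_at_def lower_at_def by (intro exI[of _ "(L - jacobi_moment \<alpha> \<beta>) / of_real x"]) simp
  qed
next
  case (right \<alpha> \<beta>)
  show ?case
  proof (intro allI impI)
    fix x :: real assume x: "0 < x \<and> x < 1"
    then have x1: "1 - complex_of_real x \<noteq> 0" by (metis of_real_1 of_real_eq_iff eq_iff_diff_eq_0 less_irrefl)
    obtain L where L: "(stieltjes \<alpha> (\<beta> + 1) \<longlongrightarrow> L + 2 * of_real pi * \<i> * jacobi_weight \<alpha> (\<beta> + 1) (of_real x)) (upper_at x)"
       "(stieltjes \<alpha> (\<beta> + 1) \<longlongrightarrow> L) (lower_at x)" using right(3) x by blast
    have lim: "(stieltjes \<alpha> \<beta> \<longlongrightarrow> (c + jacobi_moment \<alpha> \<beta>) / (1 - of_real x)) (at (of_real x) within S)"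
      if "(stieltjes \<alpha> (\<beta> + 1) \<longlongrightarrow> c) (at (of_real x) within S)" "\<And>z. z \<in> S \<Longrightarrow> Im z \<noteq> 0" for c S
    proof (rule Lim_transform_eventually)
      show "((\<lambda>z. (stieltjes \<alpha> (\<beta> + 1) z + jacobi_moment \<alpha> \<beta>) / (1 - z)) \<longlongrightarrow> (c + jacobi_moment \<alpha> \<beta>) / (1 - of_real x)) (at (of_real x) within S)"
        using x1 by (intro tendsto_intros that) auto
      show "\<forall>\<^sub>F z in at (of_real x) within S. (stieltjes \<alpha> (\<beta> + 1) z + jacobi_moment \<alpha> \<beta>) / (1 - z) = stieltjes \<alpha> \<beta> z"
        unfolding eventually_at_filter
      proof (rule always_eventually, intro allI impI)
        fix z assume "z \<in> S"
        then have "z \<in> slit_plane" using that(2)[of z] by (auto simp: slit_plane_def)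
        then show "(stieltjes \<alpha> (\<beta> + 1) z + jacobi_moment \<alpha> \<beta>) / (1 - z) = stieltjes \<alpha> \<beta> z"
          using stieltjes_plus_1_right[OF right(1,2)] slit_plane_ne_1[of z] by simp
      qed
    qed
    have "(L + 2 * of_real pi * \<i> * jacobi_weight \<alpha> (\<beta> + 1) (of_real x) + jacobi_moment \<alpha> \<beta>) / (1 - of_real x) =
        (L + jacobi_moment \<alpha> \<beta>) / (1 - of_real x) + 2 * of_real pi * \<i> * jacobi_weight \<alpha> \<beta> (of_real x)"
      using x1 by (simp add: jacobi_weight_def powr_add divide_simps)
    then show "\<exists>L. (stieltjes \<alpha> \<beta> \<longlongrightarrow> L + 2 * of_real pi * \<i> * jacobi_weight \<alpha> \<beta> (of_real x)) (upper_at x) \<and>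
     (stieltjes \<alpha> \<beta> \<longlongrightarrow> L) (lower_at x)"
      using lim[OF L(1)[unfolded upper_at_def]] lim[OF L(2)[unfolded lower_at_def]]
      unfolding upper_at_def lower_at_def by (intro exI[of _ "(L + jacobi_moment \<alpha> \<beta>) / (1 - of_real x)"]) simp
  qed
qed

section \<open>Removable slits and endpoints\<close>

lemma upper_at_neq_bot [simp]: "upper_at x \<noteq> bot" and lower_at_neq_bot [simp]: "lower_at x \<noteq> bot"
proof -
  have "\<exists>z. s * Im z > 0 \<and> z \<noteq> of_real x \<and> dist z (of_real x) < e" if "e > 0" "s = 1 \<or> s = -1" for e s :: real
    using that by (intro exI[of _ "of_real x + \<i> * of_real (s * e / 2)"]) (auto simp: dist_norm norm_mult complex_eq_iff)
  from this[of _ 1] this[of _ "-1"] show "upper_at x \<noteq> bot" "lower_at x \<noteq> bot"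
    unfolding upper_at_def lower_at_def trivial_limit_within islimpt_approachable
    by (force simp: conj_commute)+
qed

lemma eventually_upper_at_ball:
  assumes "\<forall>\<^sub>F z in nhds (complex_of_real x). P z"
  shows "\<forall>\<^sub>F z in upper_at x. P z \<and> Im z > 0" "\<forall>\<^sub>F z in lower_at x. P z \<and> Im z < 0"
  unfolding upper_at_def lower_at_def eventually_at_filter using assms by (auto elim: eventually_mono)

lemma in_slit_plane_Im: "Im z \<noteq> 0 \<Longrightarrow> z \<in> slit_plane"
  by (auto simp: slit_plane_def)

lemma not_in_slit_planeE:
  assumes "z \<notin> slit_plane"
  obtains x where "0 \<le> x" "x \<le> 1" "z = of_real x"
  using assms by (auto simp: slit_plane_def)

text \<open>No uniformity of the boundary limits is assumed. Equality of the two limits at each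
  point already makes the glued function continuous, and a continuous function holomorphic on both
  sides of a line is holomorphic across it.\<close>

lemma holomorphic_across_slit:
  assumes U: "open U" and f: "f holomorphic_on U \<inter> slit_plane"
    and lim: "\<And>x. 0 < x \<Longrightarrow> x < 1 \<Longrightarrow> complex_of_real x \<in> U \<Longrightarrow> \<exists>L. (f \<longlongrightarrow> L) (upper_at x) \<and> (f \<longlongrightarrow> L) (lower_at x)"
  obtains g where "g holomorphic_on U - {0, 1}" "\<And>z. z \<in> U \<inter> slit_plane \<Longrightarrow> g z = f z"
proof -
  obtain L where L: "\<And>x. 0 < x \<Longrightarrow> x < 1 \<Longrightarrow> complex_of_real x \<in> U \<Longrightarrow> (f \<longlongrightarrow> L x) (upper_at x)"
     "\<And>x. 0 < x \<Longrightarrow> x < 1 \<Longrightarrow> complex_of_real x \<in> U \<Longrightarrow> (f \<longlongrightarrow> L x) (lower_at x)"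
    using lim by metis
  define g where "g = (\<lambda>z. if z \<in> slit_plane then f z else L (Re z))"
  have g_eq: "g z = f z" if "z \<in> U \<inter> slit_plane" for z using that by (simp add: g_def)
  let ?U = "U - {0, 1}"
  have "open ?U" using U by (simp add: open_Diff)
  have g_slit: "g field_differentiable at z" if "z \<in> U \<inter> slit_plane" for z
  proof -
    have "g holomorphic_on U \<inter> slit_plane" using f by (rule holomorphic_transform) (simp add: g_eq)
    then show ?thesis by (rule holomorphic_on_imp_differentiable_at) (use that U in auto)
  qed
  have g_real: "isCont g (of_real x)" if x: "0 < x" "x < 1" "complex_of_real x \<in> U" for x
    unfolding continuous_at_eps_delta
  proof (intro allI impI)
    fix e :: real assume e: "e > 0"
    let ?V = "U \<inter> {z. Re z > 0} \<inter> {z. Re z < 1}"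
    have "open ?V" using U by (intro open_Int open_halfspace_Re_gt open_halfspace_Re_lt)
    then obtain d0 where d0: "d0 > 0" "ball (of_real x) d0 \<subseteq> ?V"
    proof -
      have "complex_of_real x \<in> ?V" using x by auto
      with \<open>open ?V\<close> show thesis using that unfolding open_contains_ball by blast
    qed
    have "\<forall>\<^sub>F z in upper_at x. dist (f z) (L x) < e / 2"
      by (rule tendstoD[OF L(1)[OF x] half_gt_zero[OF e]])
    then obtain d1 where d1: "d1 > 0" "\<forall>z\<in>{z. Im z > 0}. z \<noteq> of_real x \<and> dist z (of_real x) < d1 \<longrightarrow> dist (f z) (L x) < e / 2"
      unfolding upper_at_def eventually_at by blast
    have "\<forall>\<^sub>F z in lower_at x. dist (f z) (L x) < e / 2"
      by (rule tendstoD[OF L(2)[OF x] half_gt_zero[OF e]])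
    then obtain d2 where d2: "d2 > 0" "\<forall>z\<in>{z. Im z < 0}. z \<noteq> of_real x \<and> dist z (of_real x) < d2 \<longrightarrow> dist (f z) (L x) < e / 2"
      unfolding lower_at_def eventually_at by blast
    have d: "d1 > 0" "d2 > 0"
      "\<And>z. Im z > 0 \<Longrightarrow> dist z (of_real x) < d1 \<Longrightarrow> dist (f z) (L x) < e / 2"
      "\<And>z. Im z < 0 \<Longrightarrow> dist z (of_real x) < d2 \<Longrightarrow> dist (f z) (L x) < e / 2"
      using d1 d2 by auto
    define \<delta> where "\<delta> = min d0 (min d1 d2)"
    have "dist (g z) (g (of_real x)) < e" if z: "dist z (of_real x) < \<delta>" for z
    proof -
      have gx: "g (of_real x) = L x" using x by (auto simp: g_def slit_plane_def)
      consider "Im z > 0" | "Im z < 0" | "Im z = 0" by linarith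
      then have "dist (g z) (L x) \<le> e / 2"
      proof cases
        case 1
        then show ?thesis using d(3)[of z] z in_slit_plane_Im[of z] by (auto simp: g_def \<delta>_def)
      next
        case 2
        then show ?thesis using d(4)[of z] z in_slit_plane_Im[of z] by (auto simp: g_def \<delta>_def)
      next
        \<comment> \<open>For another point y of the slit, L y is a limit of values of
          \<open>f\<close> from above, all of which are within e/2 of L x.\<close>
        case 3
        define y where "y = Re z"
        have zy: "z = of_real y" using 3 by (simp add: y_def complex_eq_iff)
        have "z \<in> ?V" using z d0 by (auto simp: \<delta>_def dist_commute)
        then have y: "0 < y" "y < 1" "complex_of_real y \<in> U" using zy by auto
        then have "g z = L y" by (auto simp: g_def zy slit_plane_def)
        have "\<forall>\<^sub>F w in nhds (complex_of_real y). w \<in> ball (of_real x) \<delta>"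
          using z by (intro eventually_nhds_in_open) (auto simp: zy dist_commute)
        from eventually_upper_at_ball(1)[OF this] have "\<forall>\<^sub>F w in upper_at y. norm (f w - L x) \<le> e / 2"
        proof eventually_elim
          case (elim w)
          then have "dist (f w) (L x) < e / 2" by (intro d(3)) (auto simp: \<delta>_def dist_commute)
          then show ?case by (simp add: dist_norm)
        qed
        moreover have "((\<lambda>w. f w - L x) \<longlongrightarrow> L y - L x) (upper_at y)"
          by (intro tendsto_intros L y)
        ultimately have "norm (L y - L x) \<le> e / 2"
          by (intro Lim_norm_ubound[OF upper_at_neq_bot])
        then show ?thesis by (simp add: \<open>g z = L y\<close> dist_norm)
      qed
      then show ?thesis using e gx by simp
    qed
    moreover have "\<delta> > 0" using d0 d by (simp add: \<delta>_def)
    ultimately show "\<exists>d>0. \<forall>x'. dist x' (of_real x) < d \<longrightarrow> dist (g x') (g (of_real x)) < e" by blast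
  qed
  have "g field_differentiable at z" if z: "z \<in> ?U" for z
  proof (cases "z \<in> slit_plane")
    case True
    then show ?thesis using z g_slit by blast
  next
    case False
    then obtain x where "0 \<le> x" "x \<le> 1" "z = of_real x" by (rule not_in_slit_planeE)
    then have x: "0 < x" "x < 1" "z = of_real x" using z by (auto simp: less_le)
    let ?V = "U \<inter> {z. Re z > 0} \<inter> {z. Re z < 1}"
    have "open ?V" using U by (intro open_Int open_halfspace_Re_gt open_halfspace_Re_lt)
    have "z \<in> ?V" using x z by auto
    have "g holomorphic_on ?V"
    proof (rule holomorphic_on_paste_across_line[of ?V \<i> _ 0])
      have hol: "g holomorphic_on ?V \<inter> S" if "\<And>z. z \<in> S \<Longrightarrow> Im z \<noteq> 0" for S
        unfolding holomorphic_on_def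
      proof
        fix w assume "w \<in> ?V \<inter> S"
        then have "w \<in> U \<inter> slit_plane" using that[of w] in_slit_plane_Im[of w] by auto
        then show "g field_differentiable at w within ?V \<inter> S"
          by (rule field_differentiable_at_within[OF g_slit])
      qed
      show "g holomorphic_on ?V \<inter> {z. \<i> \<bullet> z < 0}" "g holomorphic_on ?V \<inter> {z. 0 < \<i> \<bullet> z}"
        by (rule hol, simp add: inner_complex_def)+
      show "continuous_on ?V g"
      proof (intro continuous_at_imp_continuous_on ballI)
        fix w assume w: "w \<in> ?V"
        show "isCont g w"
        proof (cases "w \<in> slit_plane")
          case True
          then show ?thesis using w g_slit field_differentiable_imp_continuous_at by blast
        next
          case False
          then obtain y where "0 \<le> y" "y \<le> 1" "w = of_real y" by (rule not_in_slit_planeE)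
          then show ?thesis using w g_real[of y] by auto
        qed
      qed
    qed (use \<open>open ?V\<close> in auto)
    then show ?thesis using \<open>z \<in> ?V\<close> \<open>open ?V\<close> holomorphic_on_imp_differentiable_at by blast
  qed
  then have "g holomorphic_on ?U"
    by (simp add: holomorphic_on_def field_differentiable_at_within)
  then show thesis using g_eq by (rule that)
qed

section \<open>Powers on both sides of the slit and removability\<close>

text \<open>If z lies just above the positive axis then -z lies just below the negative one, so
  Ln(-z) = Ln z - i pi; from below the sign is opposite.\<close>

lemma exp_neg_powr_limits:
  assumes "t > 0"
  shows "((\<lambda>z. (- z) powr \<alpha>) \<longlongrightarrow> of_real t powr \<alpha> * exp (- (\<i> * of_real pi * \<alpha>))) (upper_at t)"
    "((\<lambda>z. (- z) powr \<alpha>) \<longlongrightarrow> of_real t powr \<alpha> * exp (\<i> * of_real pi * \<alpha>)) (lower_at t)"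
    "((\<lambda>z. Ln (- z)) \<longlongrightarrow> of_real (ln t) - \<i> * of_real pi) (upper_at t)"
    "((\<lambda>z. Ln (- z)) \<longlongrightarrow> of_real (ln t) + \<i> * of_real pi) (lower_at t)"
proof -
  have t: "complex_of_real t \<notin> \<real>\<^sub>\<le>\<^sub>0" using assms by (simp add: complex_nonpos_Reals_iff)
  have lnt: "Ln (complex_of_real t) = of_real (ln t)" using assms by (simp add: Ln_of_real)
  have l: "(Ln \<longlongrightarrow> of_real (ln t)) (at (of_real t) within S)" for S
    using continuous_at_Ln[OF t] unfolding lnt[symmetric]
    by (simp add: continuous_at_imp_continuous_at_within continuous_within[symmetric])
  have pos: "\<forall>\<^sub>F z in nhds (complex_of_real t). z \<in> {z. Re z > 0}"
    using assms by (intro eventually_nhds_in_open open_halfspace_Re_gt) auto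
  have u: "\<forall>\<^sub>F z in upper_at t. Ln z - \<i> * of_real pi = Ln (- z)"
    using eventually_upper_at_ball(1)[OF pos]
  proof eventually_elim
    case (elim z)
    then have "z \<noteq> 0" by auto
    from Ln_minus[OF this] elim show ?case by simp
  qed
  have w: "\<forall>\<^sub>F z in lower_at t. Ln z + \<i> * of_real pi = Ln (- z)"
    using eventually_upper_at_ball(2)[OF pos]
  proof eventually_elim
    case (elim z)
    then have "z \<noteq> 0" by auto
    from Ln_minus[OF this] elim show ?case by simp
  qed
  have lu: "((\<lambda>z. Ln z - \<i> * of_real pi) \<longlongrightarrow> of_real (ln t) - \<i> * of_real pi) (upper_at t)"
    and lw: "((\<lambda>z. Ln z + \<i> * of_real pi) \<longlongrightarrow> of_real (ln t) + \<i> * of_real pi) (lower_at t)"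
    unfolding upper_at_def lower_at_def by (intro tendsto_intros l)+
  show U: "((\<lambda>z. Ln (- z)) \<longlongrightarrow> of_real (ln t) - \<i> * of_real pi) (upper_at t)"
    by (rule Lim_transform_eventually[OF lu u])
  show W: "((\<lambda>z. Ln (- z)) \<longlongrightarrow> of_real (ln t) + \<i> * of_real pi) (lower_at t)"
    by (rule Lim_transform_eventually[OF lw w])
  have p: "of_real t powr \<alpha> * exp (s * \<alpha>) = exp (\<alpha> * (of_real (ln t) + s))" for s
    using assms by (simp add: powr_def Ln_of_real exp_add[symmetric] algebra_simps)
  have nz: "\<forall>\<^sub>F z in upper_at t. exp (\<alpha> * Ln (- z)) = (- z) powr \<alpha>" "\<forall>\<^sub>F z in lower_at t. exp (\<alpha> * Ln (- z)) = (- z) powr \<alpha>"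
    using eventually_upper_at_ball[OF pos] by (auto elim!: eventually_mono simp: powr_def)
  have "((\<lambda>z. exp (\<alpha> * Ln (- z))) \<longlongrightarrow> exp (\<alpha> * (of_real (ln t) - \<i> * of_real pi))) (upper_at t)"
    by (intro tendsto_intros U)
  from Lim_transform_eventually[OF this nz(1)]
  show "((\<lambda>z. (- z) powr \<alpha>) \<longlongrightarrow> of_real t powr \<alpha> * exp (- (\<i> * of_real pi * \<alpha>))) (upper_at t)"
    using p[of "- (\<i> * of_real pi)"] by simp
  have "((\<lambda>z. exp (\<alpha> * Ln (- z))) \<longlongrightarrow> exp (\<alpha> * (of_real (ln t) + \<i> * of_real pi))) (lower_at t)"
    by (intro tendsto_intros W)
  from Lim_transform_eventually[OF this nz(2)]
  show "((\<lambda>z. (- z) powr \<alpha>) \<longlongrightarrow> of_real t powr \<alpha> * exp (\<i> * of_real pi * \<alpha>)) (lower_at t)"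
    using p[of "\<i> * of_real pi"] by simp
qed

lemma exp_pi_eq_imp_Ints:
  assumes "exp (\<i> * of_real pi * \<alpha>) = exp (- (\<i> * of_real pi * \<alpha>))"
  shows "\<alpha> \<in> \<int>"
proof -
  obtain n where "\<i> * of_real pi * \<alpha> = - (\<i> * of_real pi * \<alpha>) + of_int (2 * n) * of_real pi * \<i>"
    using assms by (auto simp: exp_eq)
  then have "(2 * (\<i> * of_real pi)) * \<alpha> = (2 * (\<i> * of_real pi)) * of_int n" by (simp add: algebra_simps)
  then have "\<alpha> = of_int n" by (subst (asm) mult_cancel_left) auto
  then show ?thesis by simp
qed

lemma regular_exponent_Ints: "regular_exponent \<alpha> \<Longrightarrow> \<alpha> \<in> \<int> \<Longrightarrow> \<alpha> \<in> \<nat>"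
proof -
  assume r: "regular_exponent \<alpha>" and "\<alpha> \<in> \<int>"
  then obtain n where n: "\<alpha> = of_int n" by (auto elim: Ints_cases)
  have "n \<ge> 0"
  proof (rule ccontr)
    assume "\<not> n \<ge> 0"
    then have "\<alpha> = - of_nat (nat (- n))" "nat (- n) \<ge> 1" using n by auto
    with r show False unfolding regular_exponent_iff by blast
  qed
  then show ?thesis using n by (metis of_nat_in_Nats of_nat_nat)
qed

text \<open>A value on the slit is itself a limit of values from above, so a bound valid off the
  slit passes to it.\<close>

lemma tendsto_from_slit:
  assumes r: "r > 0" and g: "continuous_on (ball 0 r - {0}) g"
    and lim: "(g \<longlongrightarrow> (0::complex)) (at 0 within slit_plane)"
  shows "(g \<longlongrightarrow> 0) (at 0)"
  unfolding LIM_def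
proof (intro allI impI)
  fix e :: real assume e: "e > 0"
  then obtain d where d: "d > 0" "\<And>z. z \<in> slit_plane \<Longrightarrow> norm z < d \<Longrightarrow> norm (g z) < e / 2"
    using tendstoD[OF lim, of "e / 2"] unfolding eventually_at by (auto simp: slit_plane_ne_0)
  have "norm (g z) \<le> e / 2" if z: "z \<noteq> 0" "norm z < min d r" for z
  proof (cases "z \<in> slit_plane")
    case True
    then show ?thesis using d(2)[of z] z by simp
  next
    case False
    then obtain x where x: "z = of_real x" by (rule not_in_slit_planeE)
    have "open (ball 0 r - {0::complex})" by (simp add: open_Diff)
    then have "isCont g z" using g z by (subst (asm) continuous_on_eq_continuous_at) auto
    then have "(g \<longlongrightarrow> g z) (upper_at x)" unfolding upper_at_def x[symmetric]
      by (simp add: continuous_at_imp_continuous_at_within continuous_within[symmetric])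
    moreover have "\<forall>\<^sub>F w in nhds (of_real x). w \<in> ball (0::complex) d"
      using z x by (intro eventually_nhds_in_open) auto
    from eventually_upper_at_ball(1)[OF this] have "\<forall>\<^sub>F w in upper_at x. norm (g w) \<le> e / 2"
      by eventually_elim (use d(2) in_slit_plane_Im in \<open>auto simp: less_imp_le\<close>)
    ultimately show ?thesis by (rule Lim_norm_ubound[OF upper_at_neq_bot])
  qed
  then show "\<exists>s>0. \<forall>x. x \<noteq> 0 \<and> dist x 0 < s \<longrightarrow> dist (g x) 0 < e"
    using d(1) r e by (intro exI[of _ "min d r"]) force
qed

lemma norm_powr_le_real:
  assumes "z \<noteq> 0"
  shows "norm (z powr \<gamma>) \<le> norm z powr Re \<gamma> * exp (pi * \<bar>Im \<gamma>\<bar>)"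
proof -
  have "norm (z powr \<gamma>) = exp (Re \<gamma> * ln (norm z) - Im \<gamma> * Im (Ln z))"
    using assms by (simp add: powr_def)
  also have "- (Im \<gamma> * Im (Ln z)) \<le> \<bar>Im \<gamma>\<bar> * \<bar>Im (Ln z)\<bar>" by (metis abs_ge_minus_self abs_mult)
  then have "- (Im \<gamma> * Im (Ln z)) \<le> \<bar>Im \<gamma>\<bar> * pi"
    using Im_Ln_le_pi[OF assms] mpi_less_Im_Ln[OF assms]
    by (elim order_trans) (intro mult_left_mono, auto)
  then have "exp (Re \<gamma> * ln (norm z) - Im \<gamma> * Im (Ln z)) \<le> exp (Re \<gamma> * ln (norm z) + pi * \<bar>Im \<gamma>\<bar>)"
    by (simp add: mult.commute)
  also have "\<dots> = norm z powr Re \<gamma> * exp (pi * \<bar>Im \<gamma>\<bar>)"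
    using assms by (simp add: powr_def exp_add)
  finally show ?thesis .
qed

text \<open>This transports a bound from the positive ray to a full neighbourhood: by its order of
  vanishing, |u(z)| is comparable to |z|^j and hence to |u(|z|)|.\<close>

lemma analytic_at_0_radial_bound:
  assumes "u analytic_on {0::complex}"
  obtains C where "\<forall>\<^sub>F z in nhds 0. norm (u z) \<le> C * norm (u (of_real (norm z)))"
  using assms
proof (cases rule: analytic_at_0_factor)
  case 1
  then have "\<forall>\<^sub>F z in nhds 0. norm (u z) \<le> 0 * norm (u (of_real (norm z)))"
    by eventually_elim simp
  then show thesis by (rule that)
next
  case (2 j v)
  have "isCont v 0" using 2(1) by (rule analytic_at_imp_isCont)
  then have lim: "(v \<longlongrightarrow> v 0) (nhds 0)" by (simp add: isCont_def tendsto_at_iff_tendsto_nhds)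
  have v0: "norm (v 0) > 0" using 2(2) by simp
  have "\<forall>\<^sub>F z in nhds 0. norm (v z) < 2 * norm (v 0)"
    using v0 by (intro order_tendstoD(2)[OF tendsto_norm[OF lim]]) simp
  moreover have up: "\<forall>\<^sub>F z in nhds 0. norm (v z) > norm (v 0) / 2 \<and> u z = z ^ j * v z"
    using v0 2(3) by (intro eventually_conj order_tendstoD(1)[OF tendsto_norm[OF lim]]) simp_all
  moreover have "filterlim (\<lambda>z::complex. complex_of_real (norm z)) (nhds 0) (nhds 0)"
  proof -
    have "isCont (\<lambda>z::complex. complex_of_real (norm z)) 0" by (intro continuous_intros)
    from this[unfolded isCont_def, THEN tendsto_at_iff_tendsto_nhds[THEN iffD1]]
    show ?thesis by simp
  qed
  from eventually_compose_filterlim[OF up this]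
  have "\<forall>\<^sub>F z::complex in nhds 0. norm (v (of_real (norm z))) > norm (v 0) / 2 \<and>
      u (of_real (norm z)) = of_real (norm z) ^ j * v (of_real (norm z))" .
  ultimately have "\<forall>\<^sub>F z in nhds 0. norm (u z) \<le> 4 * norm (u (of_real (norm z)))"
  proof eventually_elim
    case (elim z)
    have "norm (u z) = norm z ^ j * norm (v z)" using elim by (simp add: norm_mult norm_power)
    also have "\<dots> \<le> norm z ^ j * (4 * norm (v (of_real (norm z))))"
      using elim by (intro mult_left_mono) auto
    also have "\<dots> = 4 * norm (u (of_real (norm z)))"
      using elim by (simp add: norm_mult norm_power)
    finally show ?case .
  qed
  then show thesis by (rule that)
qed

lemma powr_neg_tendsto_0:
  assumes "Re \<gamma> > 0"
  shows "((\<lambda>z. (- z) powr \<gamma>) \<longlongrightarrow> 0) (at 0 within S)"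
  using assms by (intro tendsto_powr_complex_0[where b=\<gamma>]) (auto intro!: tendsto_eq_intros)

text \<open>With a = Re \<gamma> / 2, the logarithm is at most of size |z|^(-a)/a up to a constant,
  so half of the exponent absorbs it and the other half still tends to 0.\<close>

lemma powr_Ln_neg_tendsto_0:
  assumes "Re \<gamma> > 0"
  shows "((\<lambda>z. (- z) powr \<gamma> * Ln (- z)) \<longlongrightarrow> 0) (at 0 within S)"
proof -
  define a where "a = Re \<gamma> / 2"
  have a: "a > 0" "Re (\<gamma> - of_real a) > 0" using assms by (auto simp: a_def)
  have ev: "\<forall>\<^sub>F z in at 0 within S. norm ((- z) powr \<gamma> * Ln (- z)) \<le> norm ((- z) powr (\<gamma> - of_real a)) / a + norm ((- z) powr \<gamma>) * pi"
  proof -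
    have "\<forall>\<^sub>F z in nhds 0. z \<in> ball (0::complex) 1" by (intro eventually_nhds_in_open) auto
    then show ?thesis unfolding eventually_at_filter
    proof eventually_elim
      case (elim z)
      show ?case
      proof (intro impI)
        assume z: "z \<noteq> 0"
        define r where "r = norm z"
        have r: "0 < r" "r < 1" using z elim by (auto simp: r_def)
        have "ln (1 / r) \<le> (1 / r) powr a / a" using r a by (intro ln_powr_bound) auto
        then have l: "\<bar>ln r\<bar> \<le> r powr (- a) / a"
          using r by (simp add: ln_div powr_minus powr_divide field_simps)
        have "norm (Ln (- z)) \<le> \<bar>Re (Ln (- z))\<bar> + \<bar>Im (Ln (- z))\<bar>" by (rule cmod_le)
        also have "\<dots> \<le> r powr (- a) / a + pi"
          using l z Im_Ln_le_pi[of "- z"] mpi_less_Im_Ln[of "- z"] by (intro add_mono) (auto simp: r_def)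
        finally have "norm ((- z) powr \<gamma> * Ln (- z)) \<le> norm ((- z) powr \<gamma>) * (r powr (- a) / a + pi)"
          unfolding norm_mult by (intro mult_left_mono) auto
        moreover have "norm ((- z) powr (\<gamma> - of_real a)) = norm ((- z) powr \<gamma>) * r powr (- a)"
        proof -
          have "(- z) powr (\<gamma> - of_real a) = (- z) powr \<gamma> * (- z) powr (of_real (- a))"
            using z by (simp add: powr_add[symmetric])
          then show ?thesis by (simp add: norm_mult norm_powr_real_powr' r_def)
        qed
        ultimately show "norm ((- z) powr \<gamma> * Ln (- z)) \<le> norm ((- z) powr (\<gamma> - of_real a)) / a + norm ((- z) powr \<gamma>) * pi"
          by (simp add: algebra_simps)
      qed
    qed
  qed
  have "((\<lambda>z. norm ((- z) powr (\<gamma> - of_real a)) / a + norm ((- z) powr \<gamma>) * pi) \<longlongrightarrow> 0 / a + 0 * pi) (at 0 within S)"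
    using a by (intro tendsto_intros tendsto_norm_zero powr_neg_tendsto_0 assms) auto
  then show ?thesis using ev by (intro Lim_null_comparison[OF ev]) simp
qed

text \<open>A single-valued function cannot compensate a non-integer power: comparing the limits from both
  sides of the slit shows that the power term itself is \<open>o(1/z)\<close>.\<close>

lemma removable_at_0:
  assumes reg: "regular_exponent \<alpha>" and r: "r > 0" and g: "g holomorphic_on ball 0 r - {0}"
    and u: "u analytic_on {0}"
    and lim: "((\<lambda>z. z * (g z - (- z) powr \<alpha> * u z)) \<longlongrightarrow> 0) (at 0 within slit_plane)"
  shows "((\<lambda>z. z * g z) \<longlongrightarrow> 0) (at 0)"
proof -
  have contu: "(u \<longlongrightarrow> u 0) (at 0 within S)" for S
    using analytic_at_imp_isCont[OF u] by (simp add: continuous_at_imp_continuous_at_within continuous_within[symmetric])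
  have key: "((\<lambda>z. z * ((- z) powr \<alpha> * u z)) \<longlongrightarrow> 0) (at 0 within slit_plane)"
  proof (cases "exp (\<i> * of_real pi * \<alpha>) = exp (- (\<i> * of_real pi * \<alpha>))")
    \<comment> \<open>Here \<alpha> is a natural number, and z (-z)^\<alpha> tends to 0 by
      itself.\<close>
    case True
    then have "\<alpha> \<in> \<nat>" using exp_pi_eq_imp_Ints regular_exponent_Ints[OF reg] by blast
    then have "Re (\<alpha> + 1) > 0" by (auto elim!: Nats_cases)
    from tendsto_minus[OF tendsto_mult[OF powr_neg_tendsto_0[OF this] contu]]
    have "((\<lambda>z. - ((- z) powr (\<alpha> + 1) * u z)) \<longlongrightarrow> 0) (at 0 within slit_plane)"
      by simp
    moreover have "\<forall>\<^sub>F z in at 0 within slit_plane. - ((- z) powr (\<alpha> + 1) * u z) = z * ((- z) powr \<alpha> * u z)"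
      unfolding eventually_at_filter by (auto intro!: always_eventually simp: powr_add)
    ultimately show ?thesis by (rule Lim_transform_eventually)
  next
    case False
    \<comment> \<open>At a point of the positive axis \<open>g\<close> has one value, while
      (-z)^\<alpha> has two limits whose difference is t^\<alpha> D. Subtracting the two one-sided
      estimates cancels \<open>g\<close> and bounds t^(\<alpha>+1) u(t) D.\<close>
    define D where "D = exp (- (\<i> * of_real pi * \<alpha>)) - exp (\<i> * of_real pi * \<alpha>)"
    have D: "D \<noteq> 0" using False by (simp add: D_def)
    obtain \<rho> where \<rho>: "\<rho> > 0" "u holomorphic_on ball 0 \<rho>" using u by (auto simp: analytic_on_def)
    have small: "\<exists>d>0. \<forall>t. 0 < t \<and> t < d \<longrightarrow> norm (of_real t powr (\<alpha> + 1) * u (of_real t)) \<le> e" if e: "e > 0" for e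
    proof -
      define e' where "e' = e * norm D / 2"
      have e': "e' > 0" using e D by (simp add: e'_def)
      then obtain d where d: "d > 0" "\<And>z. z \<in> slit_plane \<Longrightarrow> norm z < d \<Longrightarrow> norm (z * (g z - (- z) powr \<alpha> * u z)) < e'"
        using tendstoD[OF lim e'] unfolding eventually_at by (auto simp: slit_plane_ne_0)
      have "norm (of_real t powr (\<alpha> + 1) * u (of_real t)) \<le> e" if t: "0 < t" "t < min d (min r \<rho>)" for t
      proof -
        have "open (ball 0 r - {0::complex})" by (simp add: open_Diff)
        then have "isCont g (of_real t)" using t holomorphic_on_imp_continuous_on[OF g]
          by (subst (asm) continuous_on_eq_continuous_at) auto
        moreover have "isCont u (of_real t)" using t holomorphic_on_imp_continuous_on[OF \<rho>(2)]
          by (subst (asm) continuous_on_eq_continuous_at) auto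
        ultimately have gu: "(g \<longlongrightarrow> g (of_real t)) (at (of_real t) within S)" "(u \<longlongrightarrow> u (of_real t)) (at (of_real t) within S)" for S
          by (simp_all add: continuous_at_imp_continuous_at_within continuous_within[symmetric])
        have "\<forall>\<^sub>F w in nhds (of_real t). w \<in> ball (0::complex) d"
          using t by (intro eventually_nhds_in_open) auto
        note ev = eventually_upper_at_ball[OF this]
        let ?T = "complex_of_real t" and ?p = "exp (- (\<i> * of_real pi * \<alpha>))" and ?q = "exp (\<i> * of_real pi * \<alpha>)"
        have 1: "norm (?T * (g ?T - ?T powr \<alpha> * ?p * u ?T)) \<le> e'"
        proof (rule Lim_norm_ubound[OF upper_at_neq_bot[of t]])
          show "((\<lambda>z. z * (g z - (- z) powr \<alpha> * u z)) \<longlongrightarrow> ?T * (g ?T - ?T powr \<alpha> * ?p * u ?T)) (upper_at t)"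
            using exp_neg_powr_limits(1)[OF t(1)] gu unfolding upper_at_def by (intro tendsto_intros) auto
          show "\<forall>\<^sub>F z in upper_at t. norm (z * (g z - (- z) powr \<alpha> * u z)) \<le> e'"
            using ev(1) by eventually_elim (auto intro!: less_imp_le[OF d(2)] in_slit_plane_Im)
        qed
        have 2: "norm (?T * (g ?T - ?T powr \<alpha> * ?q * u ?T)) \<le> e'"
        proof (rule Lim_norm_ubound[OF lower_at_neq_bot[of t]])
          show "((\<lambda>z. z * (g z - (- z) powr \<alpha> * u z)) \<longlongrightarrow> ?T * (g ?T - ?T powr \<alpha> * ?q * u ?T)) (lower_at t)"
            using exp_neg_powr_limits(2)[OF t(1)] gu unfolding lower_at_def by (intro tendsto_intros) auto
          show "\<forall>\<^sub>F z in lower_at t. norm (z * (g z - (- z) powr \<alpha> * u z)) \<le> e'"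
            using ev(2) by eventually_elim (auto intro!: less_imp_le[OF d(2)] in_slit_plane_Im)
        qed
        have "?T powr (\<alpha> + 1) * u ?T * D = ?T * (g ?T - ?T powr \<alpha> * ?q * u ?T) - ?T * (g ?T - ?T powr \<alpha> * ?p * u ?T)"
          using t by (simp add: D_def powr_add algebra_simps)
        then have "norm (?T powr (\<alpha> + 1) * u ?T) * norm D \<le> e' + e'"
          unfolding norm_mult[symmetric] using order_trans[OF norm_triangle_ineq4 add_mono[OF 2 1]] by simp
        also have "\<dots> = e * norm D" by (simp add: e'_def)
        finally show ?thesis using D by simp
      qed
      then show ?thesis using d(1) r \<rho>(1) by (intro exI[of _ "min d (min r \<rho>)"]) auto
    qed
    \<comment> \<open>The estimate is known only on the positive ray. The radial comparison for
      \<open>u\<close> and the boundedness of the argument in (-z)^(\<alpha>+1) extend it to all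
      directions.\<close>
    obtain C where C: "\<forall>\<^sub>F z in nhds 0. norm (u z) \<le> C * norm (u (of_real (norm z)))"
      using analytic_at_0_radial_bound[OF u] by blast
    define K where "K = \<bar>C\<bar> * exp (pi * \<bar>Im (\<alpha> + 1)\<bar>) + 1"
    have K: "K > 0" by (simp add: K_def add_nonneg_pos)
    show ?thesis
    proof (rule tendstoI)
      fix e :: real assume e: "e > 0"
      then have "e / (2 * K) > 0" using K by simp
      from small[OF this] obtain d where d: "d > 0"
        "\<And>t. 0 < t \<Longrightarrow> t < d \<Longrightarrow> norm (of_real t powr (\<alpha> + 1) * u (of_real t)) \<le> e / (2 * K)" by blast
      have "\<forall>\<^sub>F z in nhds 0. z \<in> ball (0::complex) d" using d(1) by (intro eventually_nhds_in_open) auto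
      with C show "\<forall>\<^sub>F z in at 0 within slit_plane. dist (z * ((- z) powr \<alpha> * u z)) 0 < e"
        unfolding eventually_at_filter
      proof eventually_elim
        case (elim z)
        show ?case
        proof (intro impI)
          assume z: "z \<noteq> 0"
          define t where "t = norm z"
          have t: "0 < t" "t < d" using z elim by (auto simp: t_def)
          have "norm (z * ((- z) powr \<alpha> * u z)) = norm ((- z) powr (\<alpha> + 1)) * norm (u z)"
            using z by (simp add: powr_add norm_mult)
          also have "\<dots> \<le> (t powr Re (\<alpha> + 1) * exp (pi * \<bar>Im (\<alpha> + 1)\<bar>)) * (\<bar>C\<bar> * norm (u (of_real t)))"
          proof (rule mult_mono)
            show "norm ((- z) powr (\<alpha> + 1)) \<le> t powr Re (\<alpha> + 1) * exp (pi * \<bar>Im (\<alpha> + 1)\<bar>)"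
              using norm_powr_le_real[of "- z" "\<alpha> + 1"] z by (simp add: t_def)
            have "norm (u z) \<le> C * norm (u (of_real t))" using elim by (simp add: t_def)
            also have "\<dots> \<le> \<bar>C\<bar> * norm (u (of_real t))" by (intro mult_right_mono) auto
            finally show "norm (u z) \<le> \<bar>C\<bar> * norm (u (of_real t))" .
          qed auto
          also have "\<dots> = (\<bar>C\<bar> * exp (pi * \<bar>Im (\<alpha> + 1)\<bar>)) * norm (of_real t powr (\<alpha> + 1) * u (of_real t))"
            using t(1) by (simp add: norm_mult norm_powr_real_powr)
          also have "\<dots> \<le> K * (e / (2 * K))"
            using d(2)[OF t] K by (intro mult_mono) (auto simp: K_def)
          also have "\<dots> < e" using K e by simp
          finally show "dist (z * ((- z) powr \<alpha> * u z)) 0 < e" by simp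
        qed
      qed
    qed
  qed
  have "((\<lambda>z. z * (g z - (- z) powr \<alpha> * u z) + z * ((- z) powr \<alpha> * u z)) \<longlongrightarrow> 0 + 0) (at 0 within slit_plane)"
    by (intro tendsto_add lim key)
  then have "((\<lambda>z. z * g z) \<longlongrightarrow> 0) (at 0 within slit_plane)" by (simp add: algebra_simps)
  then show ?thesis
    by (rule tendsto_from_slit[OF r, rotated])
       (intro continuous_intros holomorphic_on_imp_continuous_on[OF g])
qed

text \<open>With l = ln x, the identity says that (-z)^\<alpha> (c + d Ln(-z)) jumps across (0,1) by
  2 pi i x^\<alpha>, as the transform does apart from (1-x)^\<beta>. If the power has two different
  limits, a multiple of it suffices and d = 0. Otherwise \<alpha> is natural, the power does not
  jump, and the logarithm provides the jump.\<close>

lemma jump_constants: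
  assumes "regular_exponent \<alpha>"
  obtains c d where "d \<noteq> 0 \<Longrightarrow> \<alpha> \<in> \<nat>"
    "\<And>l. (c + d * (l - \<i> * of_real pi)) * exp (- (\<i> * of_real pi * \<alpha>)) =
         (c + d * (l + \<i> * of_real pi)) * exp (\<i> * of_real pi * \<alpha>) + 2 * of_real pi * \<i>"
proof (cases "exp (\<i> * of_real pi * \<alpha>) = exp (- (\<i> * of_real pi * \<alpha>))")
  case True
  let ?E = "exp (\<i> * of_real pi * \<alpha>)"
  show thesis
  proof (rule that[where c=0 and d="- inverse ?E"])
    show "\<alpha> \<in> \<nat>" using True exp_pi_eq_imp_Ints regular_exponent_Ints[OF assms] by blast
    show "(0 + - inverse ?E * (l - \<i> * of_real pi)) * exp (- (\<i> * of_real pi * \<alpha>)) =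
         (0 + - inverse ?E * (l + \<i> * of_real pi)) * ?E + 2 * of_real pi * \<i>" for l
      unfolding True[symmetric] by (simp add: field_simps)
  qed
next
  case False
  let ?D = "exp (- (\<i> * of_real pi * \<alpha>)) - exp (\<i> * of_real pi * \<alpha>)"
  have D: "?D \<noteq> 0" using False by simp
  show thesis
  proof (rule that[where d=0 and c="2 * of_real pi * \<i> / ?D"])
    fix l :: complex
    have "2 * of_real pi * \<i> / ?D * ?D = 2 * of_real pi * \<i>" using D by simp
    then show "(2 * of_real pi * \<i> / ?D + 0 * (l - \<i> * of_real pi)) * exp (- (\<i> * of_real pi * \<alpha>)) =
         (2 * of_real pi * \<i> / ?D + 0 * (l + \<i> * of_real pi)) * exp (\<i> * of_real pi * \<alpha>) + 2 * of_real pi * \<i>"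
      by (simp add: right_diff_distrib diff_eq_eq add.commute)
  qed simp
qed

section \<open>The endpoint singularity\<close>

lemma slit_plane_neg: "z \<in> slit_plane \<Longrightarrow> norm z < 1 \<Longrightarrow> z \<notin> \<real>\<^sub>\<ge>\<^sub>0"
proof
  assume z: "z \<in> slit_plane" "norm z < 1" "z \<in> \<real>\<^sub>\<ge>\<^sub>0"
  then have "Re z \<ge> 0" "Im z = 0" by (auto simp: complex_nonneg_Reals_iff)
  then have "z = of_real (Re z)" "Re z \<in> {0..1}" using z(2) abs_Re_le_cmod[of z] by (auto simp: complex_eq_iff)
  with z(1) show False unfolding slit_plane_def by blast
qed

lemma one_minus_not_nonpos: "norm (z::complex) < 1 \<Longrightarrow> 1 - z \<notin> \<real>\<^sub>\<le>\<^sub>0"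
  using abs_Re_le_cmod[of z] by (auto simp: complex_nonpos_Reals_iff)

lemma eventually_at_0_slit_ball:
  assumes "\<rho> > 0"
  shows "\<forall>\<^sub>F z in at 0 within slit_plane. z \<in> slit_plane \<inter> ball 0 \<rho>"
proof -
  have "\<forall>\<^sub>F z in nhds 0. z \<in> ball (0::complex) \<rho>" using assms by (intro eventually_nhds_in_open) auto
  then show ?thesis unfolding eventually_at_filter by eventually_elim auto
qed

lemma at_0_within_slit_plane_neq_bot [simp]: "at 0 within slit_plane \<noteq> bot"
  unfolding trivial_limit_within islimpt_approachable not_not
proof (intro allI impI)
  fix e :: real assume "e > 0"
  then show "\<exists>x\<in>slit_plane. x \<noteq> 0 \<and> dist x 0 < e"
    by (intro bexI[of _ "of_real (- e / 2)"]) (auto simp: slit_plane_def complex_eq_iff)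
qed

definition singular_part :: "complex \<Rightarrow> complex \<Rightarrow> complex \<Rightarrow> complex \<Rightarrow> complex" where
  "singular_part \<alpha> c d z = (- z) powr \<alpha> * (c + d * Ln (- z))"

lemma tendsto_mult_singular_part:
  assumes "Re (\<alpha> + 1) > 0"
  shows "((\<lambda>z. z * singular_part \<alpha> c d z) \<longlongrightarrow> 0) (at 0 within slit_plane)"
proof -
  have "((\<lambda>z. - (c * (- z) powr (\<alpha> + 1) + d * ((- z) powr (\<alpha> + 1) * Ln (- z)))) \<longlongrightarrow> - (c * 0 + d * 0)) (at 0 within slit_plane)"
    using assms by (intro tendsto_intros powr_neg_tendsto_0 powr_Ln_neg_tendsto_0)
  moreover have "\<forall>\<^sub>F z in at 0 within slit_plane.
      - (c * (- z) powr (\<alpha> + 1) + d * ((- z) powr (\<alpha> + 1) * Ln (- z))) = z * singular_part \<alpha> c d z"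
    unfolding eventually_at_filter
    by (auto intro!: always_eventually simp: powr_add singular_part_def algebra_simps)
  ultimately have "((\<lambda>z. z * singular_part \<alpha> c d z) \<longlongrightarrow> - (c * 0 + d * 0)) (at 0 within slit_plane)"
    by (rule Lim_transform_eventually)
  then show ?thesis by simp
qed

lemma has_field_derivative_singular_part:
  assumes "z \<in> slit_plane" "norm z < 1"
  shows "(singular_part \<alpha> c d has_field_derivative (\<alpha> * singular_part \<alpha> c d z + d * (- z) powr \<alpha>) / z) (at z)"
proof -
  have z: "- z \<notin> \<real>\<^sub>\<le>\<^sub>0" "z \<noteq> 0" using slit_plane_neg[OF assms] slit_plane_ne_0[OF assms(1)] by auto
  have P: "((\<lambda>z. (- z) powr \<alpha>) has_field_derivative \<alpha> * (- z) powr \<alpha> / z) (at z)"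
    using z by (auto intro!: derivative_eq_intros simp: powr_diff)
  have Q: "((\<lambda>z. Ln (- z)) has_field_derivative 1 / z) (at z)"
    using z by (auto intro!: derivative_eq_intros simp: field_simps)
  from DERIV_mult[OF P DERIV_add[OF DERIV_const DERIV_cmult[OF Q, of d], of c]]
  have "((\<lambda>z. (- z) powr \<alpha> * (c + d * Ln (- z))) has_field_derivative
      \<alpha> * (- z) powr \<alpha> / z * (c + d * Ln (- z)) + (- z) powr \<alpha> * (d * (1 / z))) (at z)"
    by (simp add: mult.commute)
  also have "\<alpha> * (- z) powr \<alpha> / z * (c + d * Ln (- z)) + (- z) powr \<alpha> * (d * (1 / z)) =
      (\<alpha> * singular_part \<alpha> c d z + d * (- z) powr \<alpha>) / z"
    using z(2) by (simp add: singular_part_def field_simps)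
  finally show ?thesis by (simp add: singular_part_def[abs_def])
qed

text \<open>The two expressions for X are z(1-z) times the derivative of the transform, from the
  product rule and from the differential equation. Here s is the singular part, b = (1-z)^\<beta>, P
  the extra term of the logarithm, H = z(1-z)h' and N the constant term. Since (-z)^A (1-z)^B solves
  the homogeneous equation, all terms with s cancel.\<close>

lemma hypergeometric_ode_regular_part:
  fixes A B X b s P H h N z :: complex
  assumes "X = (1 - z) * ((A * s + P) * b) - z * (B * b * s) + H"
    and "X = (A - (A + B) * z) * (s * b + h) - N"
  shows "b * (1 - z) * P + H - (A - (A + B) * z) * h = - N"
proof -
  have "b * (1 - z) * P + H - (A - (A + B) * z) * h + N =
      ((1 - z) * ((A * s + P) * b) - z * (B * b * s) + H) - ((A - (A + B) * z) * (s * b + h) - N)"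
    by (simp add: algebra_simps)
  also have "\<dots> = 0" using assms by simp
  finally show ?thesis by (simp only: eq_neg_iff_add_eq_0)
qed

text \<open>Subtracting a singular part with the correct jump leaves a function that extends across
  the slit; what remains is an isolated singularity at 0, removable because the function is
  o(1/z).\<close>

lemma stieltjes_local_large:
  assumes "Re \<alpha> > 1" "Re \<beta> > 0"
  obtains c d h where "h holomorphic_on ball 0 1" "d \<noteq> 0 \<Longrightarrow> \<alpha> \<in> \<nat>"
    "\<And>z. z \<in> slit_plane \<inter> ball 0 1 \<Longrightarrow> stieltjes \<alpha> \<beta> z = singular_part \<alpha> c d z * (1 - z) powr \<beta> + h z"
proof -
  have reg: "regular_exponent \<alpha>" "regular_exponent \<beta>" "regular_exponent (\<alpha> - 1)"
    using assms by (auto intro!: regular_exponent_Re_pos)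
  obtain c d where cd: "d \<noteq> 0 \<Longrightarrow> \<alpha> \<in> \<nat>"
    "\<And>l. (c + d * (l - \<i> * of_real pi)) * exp (- (\<i> * of_real pi * \<alpha>)) =
         (c + d * (l + \<i> * of_real pi)) * exp (\<i> * of_real pi * \<alpha>) + 2 * of_real pi * \<i>"
    by (rule jump_constants[OF reg(1)]) (rule that)
  define f where "f = (\<lambda>z. stieltjes \<alpha> \<beta> z - singular_part \<alpha> c d z * (1 - z) powr \<beta>)"
  have "stieltjes \<alpha> \<beta> holomorphic_on ball 0 1 \<inter> slit_plane"
    by (rule holomorphic_on_subset[OF stieltjes_holomorphic[OF reg(1,2)]]) auto
  then have "f holomorphic_on ball 0 1 \<inter> slit_plane"
    unfolding f_def singular_part_def
    by (intro holomorphic_intros) (auto simp: slit_plane_neg one_minus_not_nonpos)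
  moreover have "\<exists>L. (f \<longlongrightarrow> L) (upper_at x) \<and> (f \<longlongrightarrow> L) (lower_at x)" if x: "0 < x" "x < 1" for x
  proof -
    obtain L where L: "(stieltjes \<alpha> \<beta> \<longlongrightarrow> L + 2 * of_real pi * \<i> * jacobi_weight \<alpha> \<beta> (of_real x)) (upper_at x)"
      "(stieltjes \<alpha> \<beta> \<longlongrightarrow> L) (lower_at x)" using stieltjes_boundary[OF reg(1,2)] x by blast
    let ?X = "complex_of_real x" and ?l = "complex_of_real (ln x)"
    have nx: "1 - ?X \<notin> \<real>\<^sub>\<le>\<^sub>0" using x by (simp add: complex_nonpos_Reals_iff)
    have u: "(f \<longlongrightarrow> L + 2 * of_real pi * \<i> * jacobi_weight \<alpha> \<beta> ?X -
        (?X powr \<alpha> * exp (- (\<i> * of_real pi * \<alpha>))) * (c + d * (?l - \<i> * of_real pi)) * (1 - ?X) powr \<beta>) (upper_at x)"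
      unfolding f_def singular_part_def
      by (intro tendsto_intros L exp_neg_powr_limits x) (use nx in \<open>simp_all add: upper_at_def\<close>)
    have l: "(f \<longlongrightarrow> L - (?X powr \<alpha> * exp (\<i> * of_real pi * \<alpha>)) * (c + d * (?l + \<i> * of_real pi)) * (1 - ?X) powr \<beta>) (lower_at x)"
      unfolding f_def singular_part_def
      by (intro tendsto_intros L exp_neg_powr_limits x) (use nx in \<open>simp_all add: lower_at_def\<close>)
    have "L + 2 * of_real pi * \<i> * jacobi_weight \<alpha> \<beta> ?X -
        (?X powr \<alpha> * exp (- (\<i> * of_real pi * \<alpha>))) * (c + d * (?l - \<i> * of_real pi)) * (1 - ?X) powr \<beta> =
       L - (?X powr \<alpha> * exp (\<i> * of_real pi * \<alpha>)) * (c + d * (?l + \<i> * of_real pi)) * (1 - ?X) powr \<beta>"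
      using cd(2)[of ?l] unfolding jacobi_weight_def by algebra
    with u l show ?thesis by metis
  qed
  ultimately obtain g where g: "g holomorphic_on ball 0 1 - {0, 1}" "\<And>z. z \<in> ball 0 1 \<inter> slit_plane \<Longrightarrow> g z = f z"
    using holomorphic_across_slit[of "ball 0 1" f] by blast
  have "(1::complex) \<notin> ball 0 1" by simp
  then have "ball 0 1 - {0, 1::complex} = ball 0 1 - {0}" by auto
  with g(1) have g1: "g holomorphic_on ball 0 1 - {0}" by simp
  have lim: "((\<lambda>z. z * f z) \<longlongrightarrow> 0) (at 0 within slit_plane)"
  proof -
    \<comment> \<open>Re \<alpha> > 1 allows the growth bound at \<alpha> - 1, so the transform at
      \<alpha> is bounded near 0.\<close>
    obtain C where C: "\<And>z. z \<in> slit_plane \<Longrightarrow> norm z < 1/4 \<Longrightarrow> norm (z * stieltjes (\<alpha> - 1) \<beta> z) \<le> C"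
      by (rule stieltjes_bound_near_0[of "\<alpha> - 1" \<beta>]) (use assms that in auto)
    let ?M = "jacobi_moment (\<alpha> - 1) \<beta>"
    have "\<forall>\<^sub>F z in at 0 within slit_plane. norm (z * stieltjes \<alpha> \<beta> z) \<le> norm z * (C + norm ?M)"
      using eventually_at_0_slit_ball[of "1/4", simplified]
    proof eventually_elim
      case (elim z)
      have "stieltjes \<alpha> \<beta> z = z * stieltjes (\<alpha> - 1) \<beta> z + ?M"
        using stieltjes_plus_1_left[OF reg(3,2), of z] elim by simp
      then have "norm (stieltjes \<alpha> \<beta> z) \<le> C + norm ?M"
        using norm_triangle_ineq[of "z * stieltjes (\<alpha> - 1) \<beta> z" ?M] C[of z] elim by auto
      then show ?case unfolding norm_mult by (intro mult_left_mono) auto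
    qed
    moreover have "((\<lambda>z::complex. norm z * (C + norm ?M)) \<longlongrightarrow> norm (0::complex) * (C + norm ?M)) (at 0 within slit_plane)"
      by (intro tendsto_intros)
    ultimately have "((\<lambda>z. z * stieltjes \<alpha> \<beta> z) \<longlongrightarrow> 0) (at 0 within slit_plane)"
      by (elim Lim_null_comparison) simp
    moreover have "((\<lambda>z. z * singular_part \<alpha> c d z * (1 - z) powr \<beta>) \<longlongrightarrow> 0 * (1 - 0) powr \<beta>) (at 0 within slit_plane)"
      using assms by (intro tendsto_mult_singular_part tendsto_intros) auto
    ultimately have "((\<lambda>z. z * stieltjes \<alpha> \<beta> z - z * singular_part \<alpha> c d z * (1 - z) powr \<beta>) \<longlongrightarrow> 0 - 0 * (1 - 0) powr \<beta>) (at 0 within slit_plane)"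
      by (rule tendsto_diff)
    then show ?thesis by (simp add: f_def algebra_simps)
  qed
  moreover have "\<forall>\<^sub>F z in at 0 within slit_plane. z * f z = z * g z"
    using eventually_at_0_slit_ball[OF zero_less_one] by eventually_elim (use g(2) in auto)
  ultimately have "((\<lambda>z. z * g z) \<longlongrightarrow> 0) (at 0 within slit_plane)"
    by (rule Lim_transform_eventually)
  then have "((\<lambda>z. z * g z) \<longlongrightarrow> 0) (at 0)"
    by (rule tendsto_from_slit[OF zero_less_one, rotated])
       (intro continuous_intros holomorphic_on_imp_continuous_on[OF g1])
  then have "((\<lambda>z. (z - 0) * g z) \<longlongrightarrow> 0) (at 0)" by simp
  then obtain h where h: "h holomorphic_on ball 0 1" "\<forall>z\<in>ball 0 1 - {0}. h z = g z"
    using holomorphic_on_extend_lim[OF g1] by auto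
  show thesis
  proof (rule that[OF h(1) cd(1)])
    show "stieltjes \<alpha> \<beta> z = singular_part \<alpha> c d z * (1 - z) powr \<beta> + h z" if "z \<in> slit_plane \<inter> ball 0 1" for z
      using that g(2)[of z] h(2) slit_plane_ne_0[of z] by (auto simp: f_def)
  qed
qed

text \<open>Lowering \<alpha> divides the regular part minus the moment by z, so one needs h(0) = M.
  This is the limit of the differential equation at 0. Lowering \<beta> divides by 1 - z, which has
  no zero in the unit disc.\<close>

theorem stieltjes_local_0:
  assumes "regular_exponent \<alpha>" "regular_exponent \<beta>"
  shows "\<exists>c d h. h holomorphic_on ball 0 1 \<and> (d \<noteq> 0 \<longrightarrow> \<alpha> \<in> \<nat>) \<and>
    (\<forall>z\<in>slit_plane \<inter> ball 0 1. stieltjes \<alpha> \<beta> z = singular_part \<alpha> c d z * (1 - z) powr \<beta> + h z)"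
  using assms
proof (induct rule: exponent_induct[where r=1])
  case (base \<alpha> \<beta>)
  show ?case
  proof (rule stieltjes_local_large[of \<alpha> \<beta>])
    fix c d h assume "h holomorphic_on ball 0 1" "d \<noteq> 0 \<Longrightarrow> \<alpha> \<in> \<nat>"
      "\<And>z. z \<in> slit_plane \<inter> ball 0 1 \<Longrightarrow> stieltjes \<alpha> \<beta> z = singular_part \<alpha> c d z * (1 - z) powr \<beta> + h z"
    then show ?case by blast
  qed (use base in auto)
next
  case (left \<alpha> \<beta>)
  note reg = left(1,2)
  obtain c d h where h: "h holomorphic_on ball 0 1" "d \<noteq> 0 \<longrightarrow> \<alpha> + 1 \<in> \<nat>"
    "\<forall>z\<in>slit_plane \<inter> ball 0 1. stieltjes (\<alpha> + 1) \<beta> z = singular_part (\<alpha> + 1) c d z * (1 - z) powr \<beta> + h z"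
    using left(3) by blast
  let ?A = "\<alpha> + 1" and ?M = "jacobi_moment \<alpha> \<beta>"
  have A0: "?A \<noteq> 0" by (rule regular_exponent_plus_1_ne_0[OF reg(1)])
  \<comment> \<open>If a logarithm is present, \<alpha> + 1 is a natural number; it is nonzero by
    regularity, so \<alpha> is natural as well.\<close>
  have d: "d \<noteq> 0 \<Longrightarrow> Re ?A > 0 \<and> \<alpha> \<in> \<nat>"
  proof -
    assume "d \<noteq> 0"
    then obtain n where n: "?A = of_nat n" using h(2) by (auto elim: Nats_cases)
    then have "n > 0" using A0 by (cases n) auto
    have "\<alpha> = of_nat n - 1" using n by (simp add: algebra_simps)
    also have "\<dots> = of_nat (n - 1)" using \<open>n > 0\<close> by (simp add: of_nat_diff)
    finally show "Re ?A > 0 \<and> \<alpha> \<in> \<nat>" using n \<open>n > 0\<close> by (metis of_nat_in_Nats Re_complex_of_real of_real_of_nat_eq of_nat_0_less_iff)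
  qed
  have conts: "isCont h 0" "isCont (deriv h) 0"
    using h(1) holomorphic_deriv[OF h(1)]
    by (auto dest!: holomorphic_on_imp_continuous_on simp: continuous_on_eq_continuous_at)
  then have lims: "(h \<longlongrightarrow> h 0) (at 0 within slit_plane)" "(deriv h \<longlongrightarrow> deriv h 0) (at 0 within slit_plane)"
    by (simp_all add: continuous_at_imp_continuous_at_within continuous_within[symmetric])
  \<comment> \<open>What the differential equation says about the regular part: apart from a
    possible trace of the logarithm, the singular part has dropped out.\<close>
  have ode: "(1 - z) powr \<beta> * (1 - z) * (d * (- z) powr ?A) + z * (1 - z) * deriv h z - (?A - (?A + \<beta>) * z) * h z = - (?A * ?M)"
    if z: "z \<in> slit_plane \<inter> ball 0 1" for z
  proof -
    have z1: "norm z < 1" "z \<noteq> 0" "1 - z \<noteq> 0" using z slit_plane_ne_0[of z] slit_plane_ne_1[of z] by auto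
    let ?s = "singular_part ?A c d z" and ?b = "(1 - z) powr \<beta>"
    obtain D where D: "(stieltjes ?A \<beta> has_field_derivative D) (at z)"
      "z * (1 - z) * D = (?A - (?A + \<beta>) * z) * stieltjes ?A \<beta> z - (?A + \<beta> + 1) * jacobi_moment ?A \<beta>"
      using stieltjes_ode[OF regular_exponent_plus_1[OF reg(1)] reg(2)] z by blast
    have ds: "(singular_part ?A c d has_field_derivative (?A * ?s + d * (- z) powr ?A) / z) (at z)"
      using z by (intro has_field_derivative_singular_part) auto
    have db: "((\<lambda>z. (1 - z) powr \<beta>) has_field_derivative - \<beta> * ?b / (1 - z)) (at z)"
      using one_minus_not_nonpos[OF z1(1)] z1(3) by (auto intro!: derivative_eq_intros simp: powr_diff)
    have dh: "(h has_field_derivative deriv h z) (at z)"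
      using z by (intro holomorphic_derivI[OF h(1)]) auto
    from DERIV_add[OF DERIV_mult[OF ds db] dh]
    have "((\<lambda>z. singular_part ?A c d z * (1 - z) powr \<beta> + h z) has_field_derivative
        (?A * ?s + d * (- z) powr ?A) / z * ?b + - \<beta> * ?b / (1 - z) * ?s + deriv h z) (at z)" .
    then have "(stieltjes ?A \<beta> has_field_derivative
        (?A * ?s + d * (- z) powr ?A) / z * ?b + - \<beta> * ?b / (1 - z) * ?s + deriv h z) (at z)"
      by (rule has_field_derivative_transform_within_open[of _ _ _ "slit_plane \<inter> ball 0 1"])
         (use z h(3) in \<open>auto intro!: open_Int\<close>)
    from DERIV_unique[OF D(1) this]
    have "z * (1 - z) * D = (1 - z) * ((?A * ?s + d * (- z) powr ?A) * ?b) - z * (\<beta> * ?b * ?s) + z * (1 - z) * deriv h z"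
      using z1 by (simp add: field_simps)
    moreover have "z * (1 - z) * D = (?A - (?A + \<beta>) * z) * (?s * ?b + h z) - ?A * ?M"
    proof -
      have "stieltjes ?A \<beta> z = ?s * ?b + h z" using h(3) z by blast
      moreover have "(?A + \<beta> + 1) * jacobi_moment ?A \<beta> = ?A * ?M"
        using jacobi_moment_plus_1_left[OF reg] by (simp add: algebra_simps)
      ultimately show ?thesis using D(2) by simp
    qed
    ultimately show ?thesis by (rule hypergeometric_ode_regular_part)
  qed
  have "\<forall>\<^sub>F z in at 0 within slit_plane.
      (1 - z) powr \<beta> * (1 - z) * (d * (- z) powr ?A) + z * (1 - z) * deriv h z - (?A - (?A + \<beta>) * z) * h z = - (?A * ?M)"
    by (rule eventually_mono[OF eventually_at_0_slit_ball[OF zero_less_one] ode])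
  moreover have "((\<lambda>z. (1 - z) powr \<beta> * (1 - z) * (d * (- z) powr ?A) + z * (1 - z) * deriv h z - (?A - (?A + \<beta>) * z) * h z) \<longlongrightarrow>
     (1 - 0) powr \<beta> * (1 - 0) * 0 + 0 * (1 - 0) * deriv h 0 - (?A - (?A + \<beta>) * 0) * h 0) (at 0 within slit_plane)"
  proof -
    \<comment> \<open>The power alone need not tend to 0; Re(\<alpha> + 1) > 0 is known only when d
      is nonzero.\<close>
    have "((\<lambda>z. d * (- z) powr ?A) \<longlongrightarrow> 0) (at 0 within slit_plane)"
    proof (cases "d = 0")
      case False
      from tendsto_mult[OF tendsto_const[of d] powr_neg_tendsto_0[of ?A slit_plane]] d[OF False] show ?thesis by simp
    qed simp
    then show ?thesis by (intro tendsto_intros lims) auto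
  qed
  ultimately have "((\<lambda>z. - (?A * ?M)) \<longlongrightarrow>
     (1 - 0) powr \<beta> * (1 - 0) * 0 + 0 * (1 - 0) * deriv h 0 - (?A - (?A + \<beta>) * 0) * h 0) (at 0 within slit_plane)"
    by (rule Lim_transform_eventually[rotated])
  then have "- (?A * ?M) = - (?A * h 0)" by (simp add: tendsto_const_iff)
  \<comment> \<open>The constant term equals the moment, so \<open>k\<close> below is the
    holomorphic quotient (h - M)/z.\<close>
  then have h0: "h 0 = ?M" using A0 by simp
  define k where "k = (\<lambda>z. if z = 0 then deriv h 0 else (h z - h 0) / (z - 0))"
  have "k holomorphic_on ball 0 1" unfolding k_def by (rule pole_lemma_open[OF h(1) open_ball])
  moreover have "stieltjes \<alpha> \<beta> z = singular_part \<alpha> (- c) (- d) z * (1 - z) powr \<beta> + k z"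
    if z: "z \<in> slit_plane \<inter> ball 0 1" for z
  proof -
    have z0: "z \<noteq> 0" using z slit_plane_ne_0 by auto
    have "z * stieltjes \<alpha> \<beta> z = singular_part ?A c d z * (1 - z) powr \<beta> + (h z - h 0)"
    proof -
      have "z * stieltjes \<alpha> \<beta> z + ?M = singular_part ?A c d z * (1 - z) powr \<beta> + h z"
        using stieltjes_plus_1_left[OF reg, of z] h(3) z by simp
      then show ?thesis by (simp only: h0 add_diff_eq eq_diff_eq)
    qed
    \<comment> \<open>The signs come from (-z)^(\<alpha>+1) = -z (-z)^\<alpha>.\<close>
    also have "singular_part ?A c d z = z * singular_part \<alpha> (- c) (- d) z"
      using z0 by (simp add: singular_part_def powr_add algebra_simps)
    also have "h z - h 0 = z * k z" using z0 by (simp add: k_def)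
    finally have "z * stieltjes \<alpha> \<beta> z = z * (singular_part \<alpha> (- c) (- d) z * (1 - z) powr \<beta> + k z)"
      by (simp add: algebra_simps)
    then show ?thesis using z0 by simp
  qed
  moreover have "- d \<noteq> 0 \<longrightarrow> \<alpha> \<in> \<nat>" using d by auto
  ultimately show ?case by blast
next
  case (right \<alpha> \<beta>)
  note reg = right(1,2)
  obtain c d h where h: "h holomorphic_on ball 0 1" "d \<noteq> 0 \<longrightarrow> \<alpha> \<in> \<nat>"
    "\<forall>z\<in>slit_plane \<inter> ball 0 1. stieltjes \<alpha> (\<beta> + 1) z = singular_part \<alpha> c d z * (1 - z) powr (\<beta> + 1) + h z"
    using right(3) by blast
  have "(\<lambda>z. (h z + jacobi_moment \<alpha> \<beta>) / (1 - z)) holomorphic_on ball 0 1"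
    using h(1) by (intro holomorphic_intros) auto
  moreover have "stieltjes \<alpha> \<beta> z = singular_part \<alpha> c d z * (1 - z) powr \<beta> + (h z + jacobi_moment \<alpha> \<beta>) / (1 - z)"
    if z: "z \<in> slit_plane \<inter> ball 0 1" for z
  proof -
    have z1: "1 - z \<noteq> 0" using z slit_plane_ne_1[of z] by auto
    have "(1 - z) * stieltjes \<alpha> \<beta> z = singular_part \<alpha> c d z * (1 - z) powr (\<beta> + 1) + (h z + jacobi_moment \<alpha> \<beta>)"
    proof -
      have "(1 - z) * stieltjes \<alpha> \<beta> z - jacobi_moment \<alpha> \<beta> = singular_part \<alpha> c d z * (1 - z) powr (\<beta> + 1) + h z"
        using stieltjes_plus_1_right[OF reg, of z] h(3) z by simp
      then show ?thesis by (simp only: diff_eq_eq add.assoc)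
    qed
    also have "(1 - z) powr (\<beta> + 1) = (1 - z) powr \<beta> * (1 - z)" using z1 by (simp add: powr_add)
    also have "h z + jacobi_moment \<alpha> \<beta> = (1 - z) * ((h z + jacobi_moment \<alpha> \<beta>) / (1 - z))" using z1 by simp
    finally have "(1 - z) * stieltjes \<alpha> \<beta> z = (1 - z) * (singular_part \<alpha> c d z * (1 - z) powr \<beta> + (h z + jacobi_moment \<alpha> \<beta>) / (1 - z))"
      by (simp only: ring_distribs mult_ac)
    then show ?thesis using z1 by simp
  qed
  ultimately show ?case using h(2) by blast
qed

section \<open>Polynomial densities and orthogonality\<close>

lemma analytic_on_poly' [analytic_intros]: "poly (p :: complex poly) analytic_on S"
proof -
  have "poly p holomorphic_on UNIV" by (intro holomorphic_intros)
  then have "poly p analytic_on UNIV" by (simp add: analytic_on_open)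
  then show ?thesis by (rule analytic_on_subset) simp
qed

lemma analytic_poly_kernel [analytic_intros]:
  "z \<in> slit_plane \<Longrightarrow> (\<lambda>t. poly p t / (t - z)) analytic_on complex_of_real ` {0..1}"
  by (auto intro!: analytic_intros simp: slit_plane_def)

definition poly_moment :: "complex \<Rightarrow> complex \<Rightarrow> complex poly \<Rightarrow> complex" where
  "poly_moment \<alpha> \<beta> p = fp_integral \<alpha> \<beta> (poly p)"

definition poly_stieltjes :: "complex \<Rightarrow> complex \<Rightarrow> complex poly \<Rightarrow> complex \<Rightarrow> complex" where
  "poly_stieltjes \<alpha> \<beta> p z = fp_integral \<alpha> \<beta> (\<lambda>t. poly p t / (t - z))"

context
  fixes \<alpha> \<beta> :: complex
  assumes reg: "regular_exponent \<alpha>" "regular_exponent \<beta>"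
begin

lemma poly_moment_linear:
  "poly_moment \<alpha> \<beta> (smult a p + smult b q) = a * poly_moment \<alpha> \<beta> p + b * poly_moment \<alpha> \<beta> q"
proof -
  have "poly_moment \<alpha> \<beta> (smult a p + smult b q) = fp_integral \<alpha> \<beta> (\<lambda>t. a * poly p t + b * poly q t)"
    unfolding poly_moment_def by (rule arg_cong[of _ _ "fp_integral \<alpha> \<beta>"]) auto
  also have "\<dots> = a * poly_moment \<alpha> \<beta> p + b * poly_moment \<alpha> \<beta> q"
    unfolding poly_moment_def by (intro fp_integral_linear[OF reg] analytic_intros)
  finally show ?thesis .
qed

lemma poly_moment_0 [simp]: "poly_moment \<alpha> \<beta> 0 = 0"
  using poly_moment_linear[of 0 0 0 0] by simp

lemma poly_moment_smult: "poly_moment \<alpha> \<beta> (smult a p) = a * poly_moment \<alpha> \<beta> p"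
  using poly_moment_linear[of a p 0 0] by simp

lemma poly_moment_add: "poly_moment \<alpha> \<beta> (p + q) = poly_moment \<alpha> \<beta> p + poly_moment \<alpha> \<beta> q"
  using poly_moment_linear[of 1 p 1 q] by simp

lemma poly_moment_diff: "poly_moment \<alpha> \<beta> (p - q) = poly_moment \<alpha> \<beta> p - poly_moment \<alpha> \<beta> q"
  using poly_moment_linear[of 1 p "-1" q] by simp

lemma poly_moment_const: "poly_moment \<alpha> \<beta> [:a:] = a * Beta (\<alpha> + 1) (\<beta> + 1)"
proof -
  have "poly (1 :: complex poly) = (\<lambda>_. 1)" by auto
  then have "poly_moment \<alpha> \<beta> 1 = Beta (\<alpha> + 1) (\<beta> + 1)"
    using jacobi_moment_eq_Beta[OF reg] by (simp add: poly_moment_def jacobi_moment_def)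
  then show ?thesis using poly_moment_smult[of a 1] by simp
qed

lemma poly_moment_shift_left: "poly_moment (\<alpha> + 1) \<beta> p = poly_moment \<alpha> \<beta> ([:0, 1:] * p)"
proof -
  have "poly ([:0, 1:] * p) = (\<lambda>t. t * poly p t)" by auto
  then show ?thesis unfolding poly_moment_def
    using fp_integral_shift_left[OF reg, of "poly p"] by (simp add: analytic_on_poly')
qed

lemma poly_stieltjes_linear:
  assumes "z \<in> slit_plane"
  shows "poly_stieltjes \<alpha> \<beta> (smult a p + smult b q) z = a * poly_stieltjes \<alpha> \<beta> p z + b * poly_stieltjes \<alpha> \<beta> q z"
proof -
  have "poly_stieltjes \<alpha> \<beta> (smult a p + smult b q) z = fp_integral \<alpha> \<beta> (\<lambda>t. a * (poly p t / (t - z)) + b * (poly q t / (t - z)))"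
    unfolding poly_stieltjes_def
    by (rule arg_cong[of _ _ "fp_integral \<alpha> \<beta>"]) (auto simp: add_divide_distrib)
  also have "\<dots> = a * poly_stieltjes \<alpha> \<beta> p z + b * poly_stieltjes \<alpha> \<beta> q z"
    unfolding poly_stieltjes_def using assms by (intro fp_integral_linear[OF reg] analytic_intros)
  finally show ?thesis .
qed

lemma poly_stieltjes_0: "z \<in> slit_plane \<Longrightarrow> poly_stieltjes \<alpha> \<beta> 0 z = 0"
  using poly_stieltjes_linear[of z 0 0 0 0] by simp

lemma poly_stieltjes_smult: "z \<in> slit_plane \<Longrightarrow> poly_stieltjes \<alpha> \<beta> (smult a p) z = a * poly_stieltjes \<alpha> \<beta> p z"
  using poly_stieltjes_linear[of z a p 0 0] by simp

lemma poly_stieltjes_const: "z \<in> slit_plane \<Longrightarrow> poly_stieltjes \<alpha> \<beta> [:a:] z = a * stieltjes \<alpha> \<beta> z"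
  using poly_stieltjes_smult[of z a 1] by (simp add: poly_stieltjes_def stieltjes_def)

lemma poly_stieltjes_times_X:
  assumes "z \<in> slit_plane"
  shows "poly_stieltjes \<alpha> \<beta> ([:0, 1:] * p) z = z * poly_stieltjes \<alpha> \<beta> p z + poly_moment \<alpha> \<beta> p"
proof -
  have "poly_stieltjes \<alpha> \<beta> ([:0, 1:] * p) z = fp_integral \<alpha> \<beta> (\<lambda>t. z * (poly p t / (t - z)) + 1 * poly p t)"
    unfolding poly_stieltjes_def
    using assms slit_plane_ne_of_real[OF assms]
    by (intro fp_integral_cong[OF reg] analytic_intros) (auto simp: field_simps)
  also have "\<dots> = z * poly_stieltjes \<alpha> \<beta> p z + 1 * poly_moment \<alpha> \<beta> p"
    unfolding poly_stieltjes_def poly_moment_def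
    using assms by (intro fp_integral_linear[OF reg] analytic_intros)
  finally show ?thesis by simp
qed

lemma poly_stieltjes_shift_left:
  assumes "z \<in> slit_plane"
  shows "poly_stieltjes (\<alpha> + 1) \<beta> p z = poly_stieltjes \<alpha> \<beta> ([:0, 1:] * p) z"
proof -
  have "(\<lambda>t. poly ([:0, 1:] * p) t / (t - z)) = (\<lambda>t. t * (poly p t / (t - z)))" by auto
  then show ?thesis unfolding poly_stieltjes_def
    using fp_integral_shift_left[OF reg analytic_poly_kernel[OF assms]] by metis
qed

lemma pCons_eq_add_times_X: "pCons a p = smult 1 [:a:] + smult 1 ([:0, 1:] * p)" for a :: complex
  by simp

text \<open>The quotient (p(t) - p(z))/(t - z) is a polynomial in t and z, and \<open>q\<close> is
  its finite part in t, assembled here by Horner's recursion. Analyticity, jump and local form thus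
  reduce to those of the weight alone.\<close>

lemma poly_stieltjes_decomp:
  "\<exists>q. \<forall>z\<in>slit_plane. poly_stieltjes \<alpha> \<beta> p z = poly p z * stieltjes \<alpha> \<beta> z + poly q z"
proof (induction p)
  case 0
  show ?case by (rule exI[of _ 0]) (simp add: poly_stieltjes_0)
next
  case (pCons a p)
  then obtain q where q: "\<forall>z\<in>slit_plane. poly_stieltjes \<alpha> \<beta> p z = poly p z * stieltjes \<alpha> \<beta> z + poly q z" by blast
  show ?case
  proof (intro exI[of _ "pCons (poly_moment \<alpha> \<beta> p) q"] ballI)
    fix z assume z: "z \<in> slit_plane"
    show "poly_stieltjes \<alpha> \<beta> (pCons a p) z = poly (pCons a p) z * stieltjes \<alpha> \<beta> z + poly (pCons (poly_moment \<alpha> \<beta> p) q) z"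
      unfolding pCons_eq_add_times_X[of a p] poly_stieltjes_linear[OF z] poly_stieltjes_const[OF z] poly_stieltjes_times_X[OF z]
      using q z by (simp add: algebra_simps)
  qed
qed

text \<open>A finite expansion at infinity with exact remainder: up to sign the moment of t^j p is
  the coefficient of z^(-j-1), and the remainder is the transform of t^n p over z^n. It links decay
  to orthogonality.\<close>

lemma poly_stieltjes_shift:
  assumes "z \<in> slit_plane"
  shows "poly_stieltjes \<alpha> \<beta> (monom 1 n * p) z =
    z ^ n * poly_stieltjes \<alpha> \<beta> p z + (\<Sum>j<n. z ^ (n - 1 - j) * poly_moment \<alpha> \<beta> (monom 1 j * p))"
proof (induction n)
  case (Suc n)
  have m: "monom 1 (Suc n) * p = [:0, 1:] * (monom 1 n * p)" by (simp add: monom_Suc)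
  have "z * (\<Sum>j<n. z ^ (n - 1 - j) * poly_moment \<alpha> \<beta> (monom 1 j * p)) =
      (\<Sum>j<n. z ^ (Suc n - 1 - j) * poly_moment \<alpha> \<beta> (monom 1 j * p))"
    unfolding sum_distrib_left
  proof (rule sum.cong[OF refl])
    fix j assume "j \<in> {..<n}"
    then have "Suc n - 1 - j = Suc (n - 1 - j)" by auto
    then show "z * (z ^ (n - 1 - j) * poly_moment \<alpha> \<beta> (monom 1 j * p)) = z ^ (Suc n - 1 - j) * poly_moment \<alpha> \<beta> (monom 1 j * p)"
      by simp
  qed
  then show ?case unfolding m poly_stieltjes_times_X[OF assms] Suc.IH by (simp add: algebra_simps)
qed (simp add: monom_0)

end

text \<open>A factor t of the density is moved into the weight as a raised exponent, which is why
  the induction on the polynomial keeps \<alpha> arbitrary.\<close>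

lemma poly_stieltjes_at_infinity:
  assumes "regular_exponent \<alpha>" "regular_exponent \<beta>"
  shows "(poly_stieltjes \<alpha> \<beta> p \<longlongrightarrow> 0) at_infinity"
  using assms
proof (induction p arbitrary: \<alpha>)
  case 0
  have "\<forall>\<^sub>F z in at_infinity. 0 = poly_stieltjes \<alpha> \<beta> 0 z"
    using eventually_slit_plane_at_infinity by eventually_elim (simp add: poly_stieltjes_0[OF 0])
  from Lim_transform_eventually[OF tendsto_const this] show ?case .
next
  case (pCons a p)
  note reg = pCons.prems
  have "((\<lambda>z. 1 * (a * stieltjes \<alpha> \<beta> z) + 1 * poly_stieltjes (\<alpha> + 1) \<beta> p z) \<longlongrightarrow> 1 * (a * 0) + 1 * 0) at_infinity"
    by (intro tendsto_intros stieltjes_at_infinity reg pCons.IH regular_exponent_plus_1)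
  moreover have "\<forall>\<^sub>F z in at_infinity. 1 * (a * stieltjes \<alpha> \<beta> z) + 1 * poly_stieltjes (\<alpha> + 1) \<beta> p z = poly_stieltjes \<alpha> \<beta> (pCons a p) z"
    using eventually_slit_plane_at_infinity
    by eventually_elim (simp only: pCons_eq_add_times_X[OF reg, of a p] poly_stieltjes_linear[OF reg] poly_stieltjes_const[OF reg] poly_stieltjes_shift_left[OF reg])
  ultimately have "(poly_stieltjes \<alpha> \<beta> (pCons a p) \<longlongrightarrow> 1 * (a * 0) + 1 * 0) at_infinity"
    by (rule Lim_transform_eventually)
  then show ?case by simp
qed

lemma poly_moment_reflect:
  assumes "regular_exponent \<alpha>" "regular_exponent \<beta>"
  shows "poly_moment \<beta> \<alpha> (p \<circ>\<^sub>p [:1, -1:]) = poly_moment \<alpha> \<beta> p"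
proof -
  have "poly (p \<circ>\<^sub>p [:1, -1:]) = (\<lambda>t. poly p (1 - t))" by (auto simp: poly_pcompose)
  then show ?thesis unfolding poly_moment_def
    using fp_integral_reflect[OF assms, of "poly p"] by (simp add: analytic_on_poly')
qed

lemma poly_stieltjes_reflect:
  assumes "regular_exponent \<alpha>" "regular_exponent \<beta>" "z \<in> slit_plane"
  shows "poly_stieltjes \<beta> \<alpha> (p \<circ>\<^sub>p [:1, -1:]) (1 - z) = - poly_stieltjes \<alpha> \<beta> p z"
proof -
  let ?q = "p \<circ>\<^sub>p [:1, -1:]"
  have "poly_stieltjes \<alpha> \<beta> p z = fp_integral \<beta> \<alpha> (\<lambda>t. poly p (1 - t) / (1 - t - z))"
    unfolding poly_stieltjes_def using assms by (intro fp_integral_reflect[symmetric] analytic_intros)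
  also have "\<dots> = fp_integral \<beta> \<alpha> (\<lambda>t. poly (smult (-1) ?q) t / (t - (1 - z)))"
  proof (rule arg_cong[of _ _ "fp_integral \<beta> \<alpha>"], rule ext)
    fix t
    have e: "1 - t - z = - (t - (1 - z))" by simp
    show "poly p (1 - t) / (1 - t - z) = poly (smult (-1) ?q) t / (t - (1 - z))"
    proof -
      have q: "poly (smult (-1) ?q) t = - poly p (1 - t)" by (simp add: poly_pcompose)
      show ?thesis unfolding e q by (simp only: divide_minus_right minus_divide_left)
    qed
  qed
  also have "\<dots> = - poly_stieltjes \<beta> \<alpha> ?q (1 - z)"
    using poly_stieltjes_smult[OF assms(2,1) one_minus_slit_plane[OF assms(3)], of "-1" ?q]
    by (simp add: poly_stieltjes_def)
  finally show ?thesis by simp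
qed

lemma poly_moment_shift_right:
  assumes "regular_exponent \<alpha>" "regular_exponent \<beta>"
  shows "poly_moment \<alpha> (\<beta> + 1) p = poly_moment \<alpha> \<beta> ([:1, -1:] * p)"
proof -
  have "poly_moment \<alpha> (\<beta> + 1) p = poly_moment (\<beta> + 1) \<alpha> (p \<circ>\<^sub>p [:1, -1:])"
    using poly_moment_reflect[OF assms(1) regular_exponent_plus_1[OF assms(2)]] by simp
  also have "\<dots> = poly_moment \<beta> \<alpha> ([:0, 1:] * (p \<circ>\<^sub>p [:1, -1:]))"
    by (rule poly_moment_shift_left[OF assms(2,1)])
  also have "[:0, 1:] * (p \<circ>\<^sub>p [:1, -1:]) = ([:1, -1:] * p) \<circ>\<^sub>p [:1, -1:]"
    by (subst poly_eq_poly_eq_iff[symmetric]) (auto simp: poly_pcompose algebra_simps)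
  also have "poly_moment \<beta> \<alpha> \<dots> = poly_moment \<alpha> \<beta> ([:1, -1:] * p)" by (rule poly_moment_reflect[OF assms])
  finally show ?thesis .
qed

text \<open>\<open>weight_deriv \<alpha> \<beta> p\<close> is the polynomial \<open>q\<close> with
  \<open>(t powr (\<alpha> + 1) * (1 - t) powr (\<beta> + 1) * p)' = t powr \<alpha> * (1 - t) powr \<beta> * q\<close>.\<close>

definition weight_deriv :: "complex \<Rightarrow> complex \<Rightarrow> complex poly \<Rightarrow> complex poly" where
  "weight_deriv \<alpha> \<beta> p = [:\<alpha> + 1, - (\<alpha> + \<beta> + 2):] * p + [:0, 1, -1:] * pderiv p"

text \<open>The outermost of the m + 1 derivatives is split off. The inner m act on (t - t^2)^m
  times the weight with both exponents raised by one, since one factor t - t^2 joins the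
  weight.\<close>

primrec rodrigues_poly :: "nat \<Rightarrow> complex \<Rightarrow> complex \<Rightarrow> complex poly" where
  "rodrigues_poly 0 \<alpha> \<beta> = 1"
| "rodrigues_poly (Suc m) \<alpha> \<beta> = weight_deriv \<alpha> \<beta> (rodrigues_poly m (\<alpha> + 1) (\<beta> + 1))"

lemma poly_weight_deriv:
  "poly (weight_deriv \<alpha> \<beta> p) t = ((\<alpha> + 1) * (1 - t) - (\<beta> + 1) * t) * poly p t + t * (1 - t) * poly (pderiv p) t"
  by (simp add: weight_deriv_def algebra_simps)

text \<open>A product rule; since weighted derivatives have zero moment, it becomes integration by
  parts.\<close>

lemma weight_deriv_mult: "weight_deriv \<alpha> \<beta> (p * q) = weight_deriv \<alpha> \<beta> p * q + [:0, 1:] * ([:1, -1:] * (p * pderiv q))"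
proof -
  have "[:0, 1, -1:] = [:0, 1:] * [:1, -1 :: complex:]" by simp
  then show ?thesis by (simp only: weight_deriv_def pderiv_mult) (simp only: ring_distribs mult_ac add_ac)
qed

lemma poly_moment_weight_deriv:
  assumes "regular_exponent \<alpha>" "regular_exponent \<beta>"
  shows "poly_moment \<alpha> \<beta> (weight_deriv \<alpha> \<beta> p) = 0"
proof -
  have "deriv (poly p) = poly (pderiv p)" by (intro ext DERIV_imp_deriv poly_DERIV)
  then have "poly (weight_deriv \<alpha> \<beta> p) = (\<lambda>t. ((\<alpha> + 1) * (1 - t) - (\<beta> + 1) * t) * poly p t + t * (1 - t) * deriv (poly p) t)"
    by (intro ext) (simp add: poly_weight_deriv)
  then show ?thesis unfolding poly_moment_def
    using fp_integral_derivative[OF assms, of "poly p"] by (simp add: analytic_on_poly')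
qed

text \<open>Integration by parts m times without boundary terms. Each step moves one derivative onto
  q and raises both exponents by one.\<close>

lemma poly_moment_rodrigues:
  assumes "regular_exponent \<alpha>" "regular_exponent \<beta>"
  shows "poly_moment \<alpha> \<beta> (rodrigues_poly m \<alpha> \<beta> * q) =
    (-1) ^ m * poly_moment (\<alpha> + of_nat m) (\<beta> + of_nat m) ((pderiv ^^ m) q)"
  using assms
proof (induction m arbitrary: \<alpha> \<beta> q)
  case (Suc m)
  note reg = Suc.prems
  let ?R = "rodrigues_poly m (\<alpha> + 1) (\<beta> + 1)"
  have "0 = poly_moment \<alpha> \<beta> (weight_deriv \<alpha> \<beta> (?R * q))"
    by (rule poly_moment_weight_deriv[OF reg, symmetric])
  also have "\<dots> = poly_moment \<alpha> \<beta> (weight_deriv \<alpha> \<beta> ?R * q) + poly_moment \<alpha> \<beta> ([:0, 1:] * ([:1, -1:] * (?R * pderiv q)))"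
    unfolding weight_deriv_mult by (rule poly_moment_add[OF reg])
  also have "poly_moment \<alpha> \<beta> ([:0, 1:] * ([:1, -1:] * (?R * pderiv q))) = poly_moment (\<alpha> + 1) (\<beta> + 1) (?R * pderiv q)"
    using poly_moment_shift_left[OF reg] poly_moment_shift_right[OF regular_exponent_plus_1[OF reg(1)] reg(2)] by simp
  also have "\<dots> = (-1) ^ m * poly_moment (\<alpha> + 1 + of_nat m) (\<beta> + 1 + of_nat m) ((pderiv ^^ m) (pderiv q))"
    by (intro Suc.IH regular_exponent_plus_1 reg)
  finally have "poly_moment \<alpha> \<beta> (weight_deriv \<alpha> \<beta> ?R * q) =
      - ((-1) ^ m * poly_moment (\<alpha> + 1 + of_nat m) (\<beta> + 1 + of_nat m) ((pderiv ^^ m) (pderiv q)))"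
    by (simp add: eq_neg_iff_add_eq_0)
  then show ?case by (simp add: funpow_Suc_right del: funpow.simps) (simp add: add_ac)
qed simp

lemma poly_moment_rodrigues_degree:
  assumes "regular_exponent \<alpha>" "regular_exponent \<beta>" "degree q \<le> m"
  shows "poly_moment \<alpha> \<beta> (rodrigues_poly m \<alpha> \<beta> * q) =
    (-1) ^ m * (fact m * coeff q m * Beta (\<alpha> + of_nat m + 1) (\<beta> + of_nat m + 1))"
proof -
  have "(pderiv ^^ m) q = [:fact m * coeff q m:]"
  proof (rule poly_eqI)
    fix n
    show "coeff ((pderiv ^^ m) q) n = coeff [:fact m * coeff q m:] n"
    proof (cases n)
      case 0
      then show ?thesis by (simp add: coeff_higher_pderiv pochhammer_fact)
    next
      case (Suc k)
      then have "coeff q (n + m) = 0" using assms(3) by (intro coeff_eq_0) auto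
      then show ?thesis using Suc by (simp add: coeff_higher_pderiv)
    qed
  qed
  then show ?thesis
    unfolding poly_moment_rodrigues[OF assms(1,2)]
    using poly_moment_const[OF regular_exponent_plus_nat[OF assms(1)] regular_exponent_plus_nat[OF assms(2)], of m m] by simp
qed

text \<open>The degree is only bounded, since without a condition on \<alpha> + \<beta> the
  coefficient \<open>jacobi_C\<close> may vanish.\<close>

lemma rodrigues_poly_degree:
  "degree (rodrigues_poly m \<alpha> \<beta>) \<le> m \<and> coeff (rodrigues_poly m \<alpha> \<beta>) m = jacobi_C \<alpha> \<beta> m"
proof (induction m arbitrary: \<alpha> \<beta>)
  case 0
  show ?case
    by (simp_all add: jacobi_C_def)
next
  case (Suc m)
  let ?R = "rodrigues_poly m (\<alpha> + 1) (\<beta> + 1)"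
  have IH: "degree ?R \<le> m" "coeff ?R m = jacobi_C (\<alpha> + 1) (\<beta> + 1) m"
    using Suc.IH by blast+
  have co: "coeff (weight_deriv \<alpha> \<beta> ?R) (Suc n) =
     (\<alpha> + 1) * coeff ?R (Suc n) - (\<alpha> + \<beta> + 2) * coeff ?R n + of_nat (Suc n) * coeff ?R (Suc n) - of_nat n * coeff ?R n" for n
    by (cases n) (simp_all add: weight_deriv_def coeff_pderiv algebra_simps)
  have deg: "degree (rodrigues_poly (Suc m) \<alpha> \<beta>) \<le> Suc m"
  proof (rule degree_le, intro allI impI)
    fix i assume "Suc m < i"
    then obtain n where n: "i = Suc n" "m < n" by (cases i) auto
    then have "coeff ?R n = 0" "coeff ?R (Suc n) = 0" using IH(1) by (auto intro!: coeff_eq_0)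
    then show "coeff (rodrigues_poly (Suc m) \<alpha> \<beta>) i = 0" by (simp add: n co)
  qed
  have "coeff ?R (Suc m) = 0" using IH(1) by (intro coeff_eq_0) auto
  then have "coeff (rodrigues_poly (Suc m) \<alpha> \<beta>) (Suc m) = - (\<alpha> + \<beta> + 2 + of_nat m) * jacobi_C (\<alpha> + 1) (\<beta> + 1) m"
    by (simp only: rodrigues_poly.simps co IH(2)) (simp add: algebra_simps)
  also have "\<dots> = jacobi_C \<alpha> \<beta> (Suc m)"
  proof -
    \<comment> \<open>The first factor is \<alpha> + \<beta> + m + 2; after an index shift the
      others form the product for m with both exponents raised, because (k + 1) + (m + 1) = k + m +
      2.\<close>
    have "(\<Prod>k=1..Suc m. of_nat k + of_nat (Suc m) + \<alpha> + \<beta>) = (\<Prod>k=0..m. of_nat (Suc k) + of_nat (Suc m) + \<alpha> + \<beta>)"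
      by (subst prod.atLeast_Suc_atMost_Suc_shift[of _ 0 m, symmetric, unfolded o_def]) simp
    also have "\<dots> = (of_nat (Suc 0) + of_nat (Suc m) + \<alpha> + \<beta>) * (\<Prod>k=1..m. of_nat (Suc k) + of_nat (Suc m) + \<alpha> + \<beta>)"
      by (subst prod.atLeast_Suc_atMost) auto
    also have "(\<Prod>k=1..m. of_nat (Suc k) + of_nat (Suc m) + \<alpha> + \<beta>) = (\<Prod>k=1..m. of_nat k + of_nat m + (\<alpha> + 1) + (\<beta> + 1))"
      by (intro prod.cong) (auto simp: algebra_simps)
    finally show ?thesis by (simp add: jacobi_C_def algebra_simps)
  qed
  finally have "coeff (rodrigues_poly (Suc m) \<alpha> \<beta>) (Suc m) = jacobi_C \<alpha> \<beta> (Suc m)" .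
  with deg show ?case by blast
qed

text \<open>The formula is proved on a complex strip, because one more complex derivative requires
  the inductive identity on a neighbourhood of the point.\<close>

lemma rodrigues_formula:
  assumes "0 < Re z" "Re z < 1"
  shows "(deriv ^^ m) (\<lambda>t. (t - t\<^sup>2) ^ m * jacobi_weight \<alpha> \<beta> t) z = jacobi_weight \<alpha> \<beta> z * poly (rodrigues_poly m \<alpha> \<beta>) z"
  using assms
proof (induction m arbitrary: \<alpha> \<beta> z)
  case (Suc m)
  let ?V = "{z. Re z > 0} \<inter> {z. Re z < 1}"
  let ?R = "rodrigues_poly m (\<alpha> + 1) (\<beta> + 1)"
  have V: "open ?V" by (intro open_Int open_halfspace_Re_gt open_halfspace_Re_lt)
  have "z \<in> ?V" using Suc.prems by auto
  have shift: "jacobi_weight (\<alpha> + 1) (\<beta> + 1) w = (w - w\<^sup>2) * jacobi_weight \<alpha> \<beta> w" if "w \<in> ?V" for w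
  proof -
    have "w \<noteq> 0" "1 - w \<noteq> 0" using that by auto
    then show ?thesis by (simp add: jacobi_weight_def powr_add power2_eq_square algebra_simps)
  qed
  have "(deriv ^^ m) (\<lambda>t. (t - t\<^sup>2) ^ Suc m * jacobi_weight \<alpha> \<beta> t) w = jacobi_weight (\<alpha> + 1) (\<beta> + 1) w * poly ?R w"
    if w: "w \<in> ?V" for w
  proof -
    have "\<forall>\<^sub>F t in nhds w. t \<in> ?V" using V w by (rule eventually_nhds_in_open)
    then have "\<forall>\<^sub>F t in nhds w. (t - t\<^sup>2) ^ Suc m * jacobi_weight \<alpha> \<beta> t = (t - t\<^sup>2) ^ m * jacobi_weight (\<alpha> + 1) (\<beta> + 1) t"
      by eventually_elim (simp only: shift power_Suc mult_ac)
    then have "(deriv ^^ m) (\<lambda>t. (t - t\<^sup>2) ^ Suc m * jacobi_weight \<alpha> \<beta> t) w =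
        (deriv ^^ m) (\<lambda>t. (t - t\<^sup>2) ^ m * jacobi_weight (\<alpha> + 1) (\<beta> + 1) t) w"
      by (rule higher_deriv_cong_ev) simp
    then show ?thesis using Suc.IH[of w "\<alpha> + 1" "\<beta> + 1"] w by simp
  qed
  then have "\<forall>\<^sub>F w in nhds z. (deriv ^^ m) (\<lambda>t. (t - t\<^sup>2) ^ Suc m * jacobi_weight \<alpha> \<beta> t) w = jacobi_weight (\<alpha> + 1) (\<beta> + 1) w * poly ?R w"
    using eventually_nhds_in_open[OF V \<open>z \<in> ?V\<close>] by (rule eventually_mono[rotated])
  then have "deriv ((deriv ^^ m) (\<lambda>t. (t - t\<^sup>2) ^ Suc m * jacobi_weight \<alpha> \<beta> t)) z =
      deriv (\<lambda>w. jacobi_weight (\<alpha> + 1) (\<beta> + 1) w * poly ?R w) z"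
    by (intro deriv_cong_ev) auto
  also have "\<dots> = jacobi_weight \<alpha> \<beta> z * poly (weight_deriv \<alpha> \<beta> ?R) z"
  proof (rule DERIV_imp_deriv)
    have n: "z \<notin> \<real>\<^sub>\<le>\<^sub>0" "1 - z \<notin> \<real>\<^sub>\<le>\<^sub>0" "z \<noteq> 0" "1 - z \<noteq> 0" using Suc.prems by (auto simp: complex_nonpos_Reals_iff)
    have d1: "((\<lambda>w. w powr (\<alpha> + 1)) has_field_derivative (\<alpha> + 1) * z powr \<alpha>) (at z)"
      using n(1) by (auto intro!: derivative_eq_intros)
    have d2: "((\<lambda>w. (1 - w) powr (\<beta> + 1)) has_field_derivative - (\<beta> + 1) * (1 - z) powr \<beta>) (at z)"
      using n(2) by (auto intro!: derivative_eq_intros simp: algebra_simps)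
    have e: "z powr (\<alpha> + 1) = z powr \<alpha> * z" "(1 - z) powr (\<beta> + 1) = (1 - z) powr \<beta> * (1 - z)"
      using n by (simp_all add: powr_add)
    from DERIV_mult[OF DERIV_mult[OF d1 d2] poly_DERIV[of ?R z]]
    show "((\<lambda>w. jacobi_weight (\<alpha> + 1) (\<beta> + 1) w * poly ?R w) has_field_derivative
        jacobi_weight \<alpha> \<beta> z * poly (weight_deriv \<alpha> \<beta> ?R) z) (at z)"
      unfolding jacobi_weight_def poly_weight_deriv by (rule DERIV_cong) (unfold e, simp add: algebra_simps)
  qed
  finally show ?case by simp
qed simp

lemma jacobi_poly_eq_rodrigues: "jacobi_poly \<alpha> \<beta> m = rodrigues_poly m \<alpha> \<beta>"
  unfolding jacobi_poly_def
proof (rule the_equality)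
  have eq: "inverse (jacobi_weight \<alpha> \<beta> (of_real x)) * (deriv ^^ m) (\<lambda>t. (t - t\<^sup>2) ^ m * jacobi_weight \<alpha> \<beta> t) (of_real x)
      = poly (rodrigues_poly m \<alpha> \<beta>) (of_real x)" if "0 < x \<and> x < 1" for x :: real
  proof -
    have "1 - complex_of_real x \<noteq> 0" using that by (simp add: complex_eq_iff)
    then have "jacobi_weight \<alpha> \<beta> (of_real x) \<noteq> 0" using that by (simp add: jacobi_weight_def)
    then show ?thesis using rodrigues_formula[of "of_real x"] that by simp
  qed
  then show "\<forall>x. 0 < x \<and> x < 1 \<longrightarrow> poly (rodrigues_poly m \<alpha> \<beta>) (of_real x) = inverse (jacobi_weight \<alpha> \<beta> (of_real x)) *
       (deriv ^^ m) (\<lambda>t. (t - t\<^sup>2) ^ m * jacobi_weight \<alpha> \<beta> t) (of_real x)" by simp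
  fix p assume p: "\<forall>x. 0 < x \<and> x < 1 \<longrightarrow> poly p (of_real x) = inverse (jacobi_weight \<alpha> \<beta> (of_real x)) *
       (deriv ^^ m) (\<lambda>t. (t - t\<^sup>2) ^ m * jacobi_weight \<alpha> \<beta> t) (of_real x)"
  have "complex_of_real ` {0<..<1} \<subseteq> {x. poly (p - rodrigues_poly m \<alpha> \<beta>) x = 0}" using p eq by auto
  moreover have "infinite (complex_of_real ` {0<..<1})"
    by (subst finite_image_iff) (auto simp: inj_on_def infinite_Ioo)
  ultimately have "p - rodrigues_poly m \<alpha> \<beta> = 0" using poly_roots_finite finite_subset by blast
  then show "p = rodrigues_poly m \<alpha> \<beta>" by simp
qed

section \<open>Endpoint behaviour of polynomial transforms\<close>

text \<open>Replacing O(1) by o(1/z) keeps enough to remove an isolated singularity, but also admits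
  a logarithm. The transform therefore satisfies it for every regular exponent, including 0, as
  uniqueness requires.\<close>

definition weak_sing_at_0 :: "complex \<Rightarrow> (complex \<Rightarrow> complex) \<Rightarrow> bool" where
  "weak_sing_at_0 \<alpha> f \<longleftrightarrow> (\<exists>u. u analytic_on {0} \<and>
     ((\<lambda>z. z * (f z - (- z) powr \<alpha> * u z)) \<longlongrightarrow> 0) (at 0 within slit_plane))"

lemma bounded_imp_times_tendsto_0:
  assumes "f \<in> O[at 0 within slit_plane](\<lambda>_. 1)"
  shows "((\<lambda>z. z * f z) \<longlongrightarrow> (0::complex)) (at 0 within slit_plane)"
proof -
  obtain c where c: "\<forall>\<^sub>F z in at 0 within slit_plane. norm (f z) \<le> c * norm (1::complex)"
    using assms by (rule landau_o.bigE)
  have "\<forall>\<^sub>F z in at 0 within slit_plane. norm (z * f z) \<le> norm z * c"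
    using c by eventually_elim (auto simp: norm_mult intro!: mult_left_mono)
  moreover have "((\<lambda>z::complex. norm z * c) \<longlongrightarrow> norm (0::complex) * c) (at 0 within slit_plane)"
    by (intro tendsto_intros)
  ultimately show ?thesis by (elim Lim_null_comparison) simp
qed

lemma sing_imp_weak_sing_at_0: "sing_at_0 \<alpha> f \<Longrightarrow> weak_sing_at_0 \<alpha> f"
  unfolding sing_at_0_def weak_sing_at_0_def using bounded_imp_times_tendsto_0 by blast

lemma bounded_imp_weak_sing_at_0:
  assumes "f \<in> O[at 0 within slit_plane](\<lambda>_. 1)"
  shows "weak_sing_at_0 \<alpha> f"
  unfolding weak_sing_at_0_def
  using bounded_imp_times_tendsto_0[OF assms] by (intro exI[of _ "\<lambda>_. 0"]) simp

lemma weak_sing_at_0_linear: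
  assumes "weak_sing_at_0 \<alpha> f" "weak_sing_at_0 \<alpha> g"
  shows "weak_sing_at_0 \<alpha> (\<lambda>z. f z - c * g z)"
proof -
  obtain u v where u: "u analytic_on {0}" "((\<lambda>z. z * (f z - (- z) powr \<alpha> * u z)) \<longlongrightarrow> 0) (at 0 within slit_plane)"
    and v: "v analytic_on {0}" "((\<lambda>z. z * (g z - (- z) powr \<alpha> * v z)) \<longlongrightarrow> 0) (at 0 within slit_plane)"
    using assms unfolding weak_sing_at_0_def by blast
  have "((\<lambda>z. z * (f z - (- z) powr \<alpha> * u z) - c * (z * (g z - (- z) powr \<alpha> * v z))) \<longlongrightarrow> 0 - c * 0) (at 0 within slit_plane)"
    by (intro tendsto_intros u v)
  then have "((\<lambda>z. z * ((f z - c * g z) - (- z) powr \<alpha> * (u z - c * v z))) \<longlongrightarrow> 0) (at 0 within slit_plane)"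
    by (simp add: algebra_simps)
  moreover have "(\<lambda>z. u z - c * v z) analytic_on {0}" using u v by (intro analytic_intros)
  ultimately show ?thesis unfolding weak_sing_at_0_def by blast
qed

lemma tendsto_imp_bounded: "(f \<longlongrightarrow> (L::complex)) F \<Longrightarrow> f \<in> O[F](\<lambda>_. 1)"
  by (rule bigoI_tendsto[where c=L]) auto

lemma poly_stieltjes_local_0:
  assumes "regular_exponent \<alpha>" "regular_exponent \<beta>"
  obtains c d q h where "h holomorphic_on ball 0 1" "q holomorphic_on ball 0 1" "d \<noteq> 0 \<Longrightarrow> \<alpha> \<in> \<nat>"
    "\<And>z. z \<in> slit_plane \<inter> ball 0 1 \<Longrightarrow> poly_stieltjes \<alpha> \<beta> p z = singular_part \<alpha> c d z * q z + h z"
proof -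
  obtain c d h where h: "h holomorphic_on ball 0 1" "d \<noteq> 0 \<longrightarrow> \<alpha> \<in> \<nat>"
    "\<forall>z\<in>slit_plane \<inter> ball 0 1. stieltjes \<alpha> \<beta> z = singular_part \<alpha> c d z * (1 - z) powr \<beta> + h z"
    using stieltjes_local_0[OF assms] by blast
  obtain r where r: "\<forall>z\<in>slit_plane. poly_stieltjes \<alpha> \<beta> p z = poly p z * stieltjes \<alpha> \<beta> z + poly r z"
    using poly_stieltjes_decomp[OF assms] by blast
  show thesis
  proof (rule that[of "\<lambda>z. poly p z * h z + poly r z" "\<lambda>z. poly p z * (1 - z) powr \<beta>" d c])
    show "(\<lambda>z. poly p z * h z + poly r z) holomorphic_on ball 0 1"
      using h(1) by (intro holomorphic_intros)
    show "(\<lambda>z. poly p z * (1 - z) powr \<beta>) holomorphic_on ball 0 1"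
      by (intro holomorphic_intros) (auto simp: one_minus_not_nonpos)
    show "poly_stieltjes \<alpha> \<beta> p z = singular_part \<alpha> c d z * (poly p z * (1 - z) powr \<beta>) + (poly p z * h z + poly r z)"
      if "z \<in> slit_plane \<inter> ball 0 1" for z
      using r h(3) that by (simp add: algebra_simps)
  qed (use h(2) in blast)
qed

lemma holomorphic_ball_0_tendsto:
  assumes "h holomorphic_on ball 0 1"
  shows "(h \<longlongrightarrow> h (0::complex)) (at 0 within slit_plane)" "h analytic_on {0}"
proof -
  show "h analytic_on {0}" using assms by (auto simp: analytic_on_def intro!: exI[of _ 1])
  from analytic_at_imp_isCont[OF this] show "(h \<longlongrightarrow> h 0) (at 0 within slit_plane)"
    by (simp add: continuous_at_imp_continuous_at_within continuous_within[symmetric])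
qed

text \<open>A logarithm can occur only for natural \<alpha>, and there z (-z)^\<alpha> Ln(-z) tends
  to 0.\<close>

lemma weak_sing_poly_stieltjes:
  assumes "regular_exponent \<alpha>" "regular_exponent \<beta>"
  shows "weak_sing_at_0 \<alpha> (poly_stieltjes \<alpha> \<beta> p)"
proof (rule poly_stieltjes_local_0[OF assms, of p])
  fix c d q h
  assume h: "h holomorphic_on ball 0 1" "q holomorphic_on ball 0 1" "d \<noteq> 0 \<Longrightarrow> \<alpha> \<in> \<nat>"
    "\<And>z. z \<in> slit_plane \<inter> ball 0 1 \<Longrightarrow> poly_stieltjes \<alpha> \<beta> p z = singular_part \<alpha> c d z * q z + h z"
  note hq = holomorphic_ball_0_tendsto[OF h(1)] holomorphic_ball_0_tendsto[OF h(2)]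
  have "((\<lambda>z. d * (z * singular_part \<alpha> 0 1 z) * q z + z * h z) \<longlongrightarrow> d * 0 * q 0 + 0 * h 0) (at 0 within slit_plane)"
  proof (cases "d = 0")
    case False
    then have "\<alpha> \<in> \<nat>" by (rule h(3))
    then have "Re (\<alpha> + 1) > 0" by (auto elim!: Nats_cases)
    then show ?thesis by (intro tendsto_intros tendsto_mult_singular_part hq)
  next
    case True
    then show ?thesis by (auto intro!: tendsto_eq_intros hq)
  qed
  moreover have "\<forall>\<^sub>F z in at 0 within slit_plane. d * (z * singular_part \<alpha> 0 1 z) * q z + z * h z =
      z * (poly_stieltjes \<alpha> \<beta> p z - (- z) powr \<alpha> * (c * q z))"
    using eventually_at_0_slit_ball[OF zero_less_one]
    by eventually_elim (subst h(4), auto simp: singular_part_def algebra_simps)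
  ultimately have "((\<lambda>z. z * (poly_stieltjes \<alpha> \<beta> p z - (- z) powr \<alpha> * (c * q z))) \<longlongrightarrow> d * 0 * q 0 + 0 * h 0) (at 0 within slit_plane)"
    by (rule Lim_transform_eventually)
  moreover have "(\<lambda>z. c * q z) analytic_on {0}" using hq by (intro analytic_intros)
  ultimately show ?thesis unfolding weak_sing_at_0_def by (intro exI[of _ "\<lambda>z. c * q z"]) simp
qed

text \<open>For \<open>\<alpha> = 0\<close> the Cauchy transform has an unbounded logarithmic term at \<open>0\<close>; for \<open>\<alpha> = 1, 2, \<dots>\<close>
  the factor \<open>z\<^sup>\<alpha>\<close> makes it bounded.\<close>

lemma sing_poly_stieltjes:
  assumes "regular_exponent \<alpha>" "regular_exponent \<beta>" "\<alpha> \<noteq> 0"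
  shows "sing_at_0 \<alpha> (poly_stieltjes \<alpha> \<beta> p)"
proof (rule poly_stieltjes_local_0[OF assms(1,2), of p])
  fix c d q h
  assume h: "h holomorphic_on ball 0 1" "q holomorphic_on ball 0 1" "d \<noteq> 0 \<Longrightarrow> \<alpha> \<in> \<nat>"
    "\<And>z. z \<in> slit_plane \<inter> ball 0 1 \<Longrightarrow> poly_stieltjes \<alpha> \<beta> p z = singular_part \<alpha> c d z * q z + h z"
  note hq = holomorphic_ball_0_tendsto[OF h(1)] holomorphic_ball_0_tendsto[OF h(2)]
  have "((\<lambda>z. d * ((- z) powr \<alpha> * Ln (- z)) * q z + h z) \<longlongrightarrow> d * 0 * q 0 + h 0) (at 0 within slit_plane)"
  proof (cases "d = 0")
    case False
    then have "\<alpha> \<in> \<nat>" by (rule h(3))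
    then have "Re \<alpha> > 0" using assms(3) by (auto elim!: Nats_cases)
    then show ?thesis by (intro tendsto_intros powr_Ln_neg_tendsto_0 hq)
  next
    case True
    then show ?thesis by (auto intro!: tendsto_eq_intros hq)
  qed
  moreover have "\<forall>\<^sub>F z in at 0 within slit_plane. d * ((- z) powr \<alpha> * Ln (- z)) * q z + h z =
      poly_stieltjes \<alpha> \<beta> p z - (- z) powr \<alpha> * (c * q z)"
    using eventually_at_0_slit_ball[OF zero_less_one]
    by eventually_elim (subst h(4), auto simp: singular_part_def algebra_simps)
  ultimately have "((\<lambda>z. poly_stieltjes \<alpha> \<beta> p z - (- z) powr \<alpha> * (c * q z)) \<longlongrightarrow> d * 0 * q 0 + h 0) (at 0 within slit_plane)"
    by (rule Lim_transform_eventually)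
  then have "(\<lambda>z. poly_stieltjes \<alpha> \<beta> p z - (- z) powr \<alpha> * (c * q z)) \<in> O[at 0 within slit_plane](\<lambda>_. 1)"
    by (rule tendsto_imp_bounded)
  moreover have "(\<lambda>z. c * q z) analytic_on {0}" using hq by (intro analytic_intros)
  ultimately show ?thesis unfolding sing_at_0_def by blast
qed

lemma sing_at_0_cmult:
  assumes "sing_at_0 \<alpha> f"
  shows "sing_at_0 \<alpha> (\<lambda>z. c * f z)"
proof -
  obtain g where g: "g analytic_on {0}" "(\<lambda>z. f z - (- z) powr \<alpha> * g z) \<in> O[at 0 within slit_plane](\<lambda>_. 1)"
    using assms unfolding sing_at_0_def by blast
  have "(\<lambda>z. c * (f z - (- z) powr \<alpha> * g z)) \<in> O[at 0 within slit_plane](\<lambda>_. 1)"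
    using landau_o.big.cmult_in_iff' g(2) by (cases "c = 0") auto
  then have "(\<lambda>z. c * f z - (- z) powr \<alpha> * (c * g z)) \<in> O[at 0 within slit_plane](\<lambda>_. 1)"
    by (simp add: algebra_simps)
  moreover have "(\<lambda>z. c * g z) analytic_on {0}" using g by (intro analytic_intros)
  ultimately show ?thesis unfolding sing_at_0_def by blast
qed

lemma filtermap_one_minus_slit: "filtermap (\<lambda>z. 1 - z) (at 0 within slit_plane) = at 1 within slit_plane"
  unfolding filter_eq_iff eventually_filtermap eventually_at
proof (intro allI iffI)
  fix P :: "complex \<Rightarrow> bool"
  assume "\<exists>d>0. \<forall>x\<in>slit_plane. x \<noteq> 0 \<and> dist x 0 < d \<longrightarrow> P (1 - x)"
  then obtain d where d: "d > 0" "\<forall>x\<in>slit_plane. x \<noteq> 0 \<and> dist x 0 < d \<longrightarrow> P (1 - x)" by blast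
  have "P x" if "x \<in> slit_plane" "x \<noteq> 1" "dist x 1 < d" for x
    using d(2)[rule_format, of "1 - x"] that one_minus_slit_plane[of x] by (simp add: dist_norm norm_minus_commute)
  then show "\<exists>d>0. \<forall>x\<in>slit_plane. x \<noteq> 1 \<and> dist x 1 < d \<longrightarrow> P x" using d(1) by blast
next
  fix P :: "complex \<Rightarrow> bool"
  assume "\<exists>d>0. \<forall>x\<in>slit_plane. x \<noteq> 1 \<and> dist x 1 < d \<longrightarrow> P x"
  then obtain d where d: "d > 0" "\<forall>x\<in>slit_plane. x \<noteq> 1 \<and> dist x 1 < d \<longrightarrow> P x" by blast
  have "P (1 - x)" if "x \<in> slit_plane" "x \<noteq> 0" "dist x 0 < d" for x
    using d(2)[rule_format, of "1 - x"] that one_minus_slit_plane[of x] by (simp add: dist_norm)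
  then show "\<exists>d>0. \<forall>x\<in>slit_plane. x \<noteq> 0 \<and> dist x 0 < d \<longrightarrow> P (1 - x)" using d(1) by blast
qed

lemma bounded_at_1_iff:
  "f \<in> O[at 1 within slit_plane](\<lambda>_. 1) \<longleftrightarrow> (\<lambda>z. f (1 - z)) \<in> O[at 0 within slit_plane](\<lambda>_. 1)"
  unfolding filtermap_one_minus_slit[symmetric] landau_o.big.in_filtermap_iff ..

lemma analytic_at_reflect:
  assumes "g analytic_on {1 - a}"
  shows "(\<lambda>z. g (1 - z)) analytic_on {a :: complex}"
proof -
  have "(\<lambda>z. 1 - z) analytic_on {a}" by (intro analytic_intros)
  from analytic_on_compose_gen[OF this assms] show ?thesis by (simp add: o_def)
qed

text \<open>Under z \<mapsto> 1 - z the branch (z - 1)^\<beta> becomes (-z)^\<beta> exactly, without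
  a constant factor. So the endpoint 1 needs no separate analysis.\<close>

lemma sing_at_1_iff: "sing_at_1 \<beta> f \<longleftrightarrow> sing_at_0 \<beta> (\<lambda>z. f (1 - z))"
proof
  assume "sing_at_1 \<beta> f"
  then obtain g where g: "g analytic_on {1}" "(\<lambda>z. f z - (z - 1) powr \<beta> * g z) \<in> O[at 1 within slit_plane](\<lambda>_. 1)"
    unfolding sing_at_1_def by blast
  have "(\<lambda>z. g (1 - z)) analytic_on {0}" using g(1) by (intro analytic_at_reflect) simp
  with g(2) show "sing_at_0 \<beta> (\<lambda>z. f (1 - z))"
    unfolding sing_at_0_def bounded_at_1_iff by (intro exI[of _ "\<lambda>z. g (1 - z)"]) simp
next
  assume "sing_at_0 \<beta> (\<lambda>z. f (1 - z))"
  then obtain g where g: "g analytic_on {0}" "(\<lambda>z. f (1 - z) - (- z) powr \<beta> * g z) \<in> O[at 0 within slit_plane](\<lambda>_. 1)"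
    unfolding sing_at_0_def by blast
  have "(\<lambda>z. g (1 - z)) analytic_on {1}" using g(1) by (intro analytic_at_reflect) simp
  with g(2) show "sing_at_1 \<beta> f"
    unfolding sing_at_1_def bounded_at_1_iff by (intro exI[of _ "\<lambda>z. g (1 - z)"]) simp
qed

lemma weak_sing_at_0_cong:
  assumes "\<And>z. z \<in> slit_plane \<Longrightarrow> f z = g z" "weak_sing_at_0 \<alpha> f"
  shows "weak_sing_at_0 \<alpha> g"
proof -
  obtain u where u: "u analytic_on {0}" "((\<lambda>z. z * (f z - (- z) powr \<alpha> * u z)) \<longlongrightarrow> 0) (at 0 within slit_plane)"
    using assms(2) unfolding weak_sing_at_0_def by blast
  have "\<forall>\<^sub>F z in at 0 within slit_plane. z * (f z - (- z) powr \<alpha> * u z) = z * (g z - (- z) powr \<alpha> * u z)"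
    using eventually_at_0_slit_ball[OF zero_less_one] by eventually_elim (use assms(1) in auto)
  from Lim_transform_eventually[OF u(2) this] u(1) show ?thesis unfolding weak_sing_at_0_def by blast
qed

lemma sing_at_0_cong:
  assumes "\<And>z. z \<in> slit_plane \<Longrightarrow> f z = g z" "sing_at_0 \<alpha> f"
  shows "sing_at_0 \<alpha> g"
proof -
  obtain u where u: "u analytic_on {0}" "(\<lambda>z. f z - (- z) powr \<alpha> * u z) \<in> O[at 0 within slit_plane](\<lambda>_. 1)"
    using assms(2) unfolding sing_at_0_def by blast
  have "\<forall>\<^sub>F z in at 0 within slit_plane. f z - (- z) powr \<alpha> * u z = g z - (- z) powr \<alpha> * u z"
    using eventually_at_0_slit_ball[OF zero_less_one] by eventually_elim (use assms(1) in auto)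
  from landau_o.big.in_cong[OF this] u show ?thesis unfolding sing_at_0_def by blast
qed

lemma poly_stieltjes_one_minus:
  assumes "regular_exponent \<alpha>" "regular_exponent \<beta>" "z \<in> slit_plane"
  shows "poly_stieltjes \<alpha> \<beta> p (1 - z) = - 1 * poly_stieltjes \<beta> \<alpha> (p \<circ>\<^sub>p [:1, -1:]) z"
  using poly_stieltjes_reflect[OF assms(1,2) one_minus_slit_plane[OF assms(3)], of p] by simp

lemma weak_sing_poly_stieltjes_1:
  assumes "regular_exponent \<alpha>" "regular_exponent \<beta>"
  shows "weak_sing_at_0 \<beta> (\<lambda>z. poly_stieltjes \<alpha> \<beta> p (1 - z))"
proof (rule weak_sing_at_0_cong)
  show "weak_sing_at_0 \<beta> (\<lambda>z. 0 - 1 * poly_stieltjes \<beta> \<alpha> (p \<circ>\<^sub>p [:1, -1:]) z)"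
    by (intro weak_sing_at_0_linear weak_sing_poly_stieltjes assms bounded_imp_weak_sing_at_0) simp
qed (simp add: poly_stieltjes_one_minus[OF assms])

lemma sing_poly_stieltjes_1:
  assumes "regular_exponent \<alpha>" "regular_exponent \<beta>" "\<beta> \<noteq> 0"
  shows "sing_at_0 \<beta> (\<lambda>z. poly_stieltjes \<alpha> \<beta> p (1 - z))"
proof (rule sing_at_0_cong)
  show "sing_at_0 \<beta> (\<lambda>z. - 1 * poly_stieltjes \<beta> \<alpha> (p \<circ>\<^sub>p [:1, -1:]) z)"
    by (intro sing_at_0_cmult sing_poly_stieltjes assms)
qed (simp add: poly_stieltjes_one_minus[OF assms(1,2)])

section \<open>Entire functions and behaviour at infinity\<close>

text \<open>Equal limits remove the open slit; 0 and 1 are then isolated singularities, and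
  \<open>removable_at_0\<close> treats both, the latter after reflection.\<close>

lemma entire_extension:
  assumes reg: "regular_exponent \<alpha>" "regular_exponent \<beta>"
    and f: "f holomorphic_on slit_plane"
    and lim: "\<And>x. 0 < x \<Longrightarrow> x < 1 \<Longrightarrow> \<exists>L. (f \<longlongrightarrow> L) (upper_at x) \<and> (f \<longlongrightarrow> L) (lower_at x)"
    and sing: "weak_sing_at_0 \<alpha> f" "weak_sing_at_0 \<beta> (\<lambda>z. f (1 - z))"
  obtains g where "g holomorphic_on UNIV" "\<And>z. z \<in> slit_plane \<Longrightarrow> g z = f z"
proof -
  obtain g0 where "g0 holomorphic_on UNIV - {0, 1}" "\<And>z. z \<in> UNIV \<inter> slit_plane \<Longrightarrow> g0 z = f z"
    by (rule holomorphic_across_slit[of UNIV f]) (use f lim that in auto)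
  then have g0: "g0 holomorphic_on UNIV - {0, 1}" "\<And>z. z \<in> slit_plane \<Longrightarrow> g0 z = f z" by auto
  have removable: "((\<lambda>z. z * h z) \<longlongrightarrow> 0) (at 0)"
    if "regular_exponent \<gamma>" "h holomorphic_on UNIV - {0, 1}" "weak_sing_at_0 \<gamma> h" for \<gamma> h
  proof -
    have "ball 0 1 - {0} \<subseteq> UNIV - {0, 1::complex}" by auto
    then have "h holomorphic_on ball 0 1 - {0}" using that(2) holomorphic_on_subset by blast
    then show ?thesis using removable_at_0[OF that(1) zero_less_one] that(3) unfolding weak_sing_at_0_def by blast
  qed
  have r0: "((\<lambda>z. z * g0 z) \<longlongrightarrow> 0) (at 0)"
    using g0 by (intro removable[OF reg(1)] weak_sing_at_0_cong[OF _ sing(1)]) auto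
  have "((\<lambda>z. z * g0 (1 - z)) \<longlongrightarrow> 0) (at 0)"
  proof (intro removable[OF reg(2)] weak_sing_at_0_cong[OF _ sing(2)])
    have "(g0 \<circ> (\<lambda>z. 1 - z)) holomorphic_on UNIV - {0, 1}"
      by (rule holomorphic_on_compose_gen[OF _ g0(1)]) (auto intro!: holomorphic_intros)
    then show "(\<lambda>z. g0 (1 - z)) holomorphic_on UNIV - {0, 1}" by (simp add: o_def)
  qed (use g0 one_minus_slit_plane in auto)
  moreover have "filterlim (\<lambda>z::complex. 1 - z) (at 0) (at 1)"
    by (rule filterlim_atI) (auto intro!: tendsto_eq_intros simp: eventually_at_filter)
  ultimately have "((\<lambda>z. (1 - z) * g0 (1 - (1 - z))) \<longlongrightarrow> 0) (at 1)"
    by (rule filterlim_compose)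
  from tendsto_minus[OF this] have r1: "((\<lambda>z. (z - 1) * g0 z) \<longlongrightarrow> 0) (at 1)"
    by (simp add: algebra_simps)
  have "UNIV - {0, 1} = (UNIV - {1}) - {0::complex}" by auto
  with g0(1) have "g0 holomorphic_on (UNIV - {1}) - {0}" by simp
  moreover have "0 \<in> interior (UNIV - {1::complex})" by (simp add: interior_open open_Diff)
  ultimately obtain g1 where g1: "g1 holomorphic_on UNIV - {1}" "\<forall>z\<in>(UNIV - {1}) - {0}. g1 z = g0 z"
    using holomorphic_on_extend_lim[of g0 "UNIV - {1}" 0] r0 by auto
  have "\<forall>\<^sub>F z in at 1. (z - 1) * g0 z = (z - 1) * g1 z"
  proof -
    have "\<forall>\<^sub>F z in nhds 1. z \<in> - {0::complex}" by (intro eventually_nhds_in_open) auto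
    then show ?thesis unfolding eventually_at_filter by eventually_elim (use g1(2) in auto)
  qed
  from Lim_transform_eventually[OF r1 this] obtain g where g: "g holomorphic_on UNIV" "\<forall>z\<in>UNIV - {1}. g z = g1 z"
    using holomorphic_on_extend_lim[of g1 UNIV 1] g1(1) by auto
  show thesis
  proof (rule that[OF g(1)])
    fix z assume "z \<in> slit_plane"
    then show "g z = f z" using g(2) g1(2) g0(2) slit_plane_ne_0[of z] slit_plane_ne_1[of z] by auto
  qed
qed

lemma poly_over_power_at_infinity:
  assumes "degree (p :: complex poly) \<le> n"
  shows "((\<lambda>z. poly p z / z ^ n) \<longlongrightarrow> coeff p n) at_infinity"
proof -
  have "((\<lambda>z::complex. \<Sum>k\<le>n. coeff p k * inverse z ^ (n - k)) \<longlongrightarrow> (\<Sum>k\<le>n. coeff p k * 0 ^ (n - k))) at_infinity"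
    by (intro tendsto_intros tendsto_inverse_0)
  moreover have "(\<Sum>k\<le>n. coeff p k * 0 ^ (n - k)) = coeff p n"
  proof -
    have "(\<Sum>k\<le>n. coeff p k * 0 ^ (n - k)) = (\<Sum>k\<in>{n}. coeff p k * 0 ^ (n - k))"
      by (rule sum.mono_neutral_right) auto
    then show ?thesis by simp
  qed
  moreover have "\<forall>\<^sub>F z::complex in at_infinity. (\<Sum>k\<le>n. coeff p k * inverse z ^ (n - k)) = poly p z / z ^ n"
    using eventually_slit_plane_at_infinity
  proof eventually_elim
    case (elim z)
    have z: "z \<noteq> 0" using elim by (rule slit_plane_ne_0)
    have "poly p z = (\<Sum>k\<le>n. coeff p k * z ^ k)" 
      unfolding poly_altdef using assms by (intro sum.mono_neutral_left) (auto simp: coeff_eq_0)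
    then have "poly p z / z ^ n = (\<Sum>k\<le>n. coeff p k * (z ^ k / z ^ n))" by (simp add: sum_divide_distrib)
    also have "\<dots> = (\<Sum>k\<le>n. coeff p k * inverse z ^ (n - k))"
    proof (intro sum.cong refl)
      fix k assume "k \<in> {..n}"
      then have "z ^ n = z ^ k * z ^ (n - k)" by (simp flip: power_add)
      then have "z ^ k / z ^ n = inverse z ^ (n - k)" using z by (simp add: divide_inverse power_inverse)
      then show "coeff p k * (z ^ k / z ^ n) = coeff p k * inverse z ^ (n - k)" by (rule arg_cong)
    qed
    finally show ?case by simp
  qed
  ultimately show ?thesis using Lim_transform_eventually by fastforce
qed

lemma entire_power_asymptotic_imp_poly:
  assumes g: "g holomorphic_on UNIV" and lim: "((\<lambda>z. g z / z ^ n) \<longlongrightarrow> (c::complex)) at_infinity"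
  obtains p where "g = poly p" "degree p \<le> n" "coeff p n = c"
proof -
  have "\<forall>\<^sub>F z in at_infinity. dist (g z / z ^ n) c < 1" using tendstoD[OF lim] by simp
  with eventually_slit_plane_at_infinity have "\<forall>\<^sub>F z in at_infinity. norm (g z) \<le> (norm c + 1) * norm z ^ n"
  proof eventually_elim
    case (elim z)
    have z: "z \<noteq> 0" using elim(1) by (rule slit_plane_ne_0)
    have "norm (g z / z ^ n) \<le> norm c + 1"
      using elim norm_triangle_sub[of "g z / z ^ n" c] by (simp add: dist_norm)
    then show ?case using z by (simp add: norm_divide norm_power pos_divide_le_eq)
  qed
  then obtain A where A: "\<And>z. A \<le> norm z \<Longrightarrow> norm (g z) \<le> (norm c + 1) * norm z ^ n"
    unfolding eventually_at_infinity by blast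
  define p where "p = (\<Sum>k\<le>n. monom ((deriv ^^ k) g 0 / fact k) k)"
  have "g = poly p"
    using Liouville_polynomial[OF g A] by (auto simp: p_def poly_sum poly_monom)
  moreover have deg: "degree p \<le> n"
    unfolding p_def by (intro degree_sum_le) (auto intro: order_trans[OF degree_monom_le])
  moreover have "coeff p n = c"
    using poly_over_power_at_infinity[OF deg] lim \<open>g = poly p\<close> tendsto_unique[OF trivial_limit_at_infinity] by metis
  ultimately show thesis by (rule that)
qed

lemma poly_stieltjes_holomorphic:
  assumes "regular_exponent \<alpha>" "regular_exponent \<beta>"
  shows "poly_stieltjes \<alpha> \<beta> p holomorphic_on slit_plane"
proof -
  obtain q where q: "\<forall>z\<in>slit_plane. poly_stieltjes \<alpha> \<beta> p z = poly p z * stieltjes \<alpha> \<beta> z + poly q z"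
    using poly_stieltjes_decomp[OF assms] by blast
  have "(\<lambda>z. poly p z * stieltjes \<alpha> \<beta> z + poly q z) holomorphic_on slit_plane"
    using stieltjes_holomorphic[OF assms] by (intro holomorphic_intros)
  then show ?thesis by (rule holomorphic_transform) (simp add: q)
qed

lemma poly_stieltjes_boundary:
  assumes "regular_exponent \<alpha>" "regular_exponent \<beta>" "0 < x" "x < 1"
  shows "\<exists>L. (poly_stieltjes \<alpha> \<beta> p \<longlongrightarrow> L + 2 * of_real pi * \<i> * (poly p (of_real x) * jacobi_weight \<alpha> \<beta> (of_real x))) (upper_at x) \<and>
     (poly_stieltjes \<alpha> \<beta> p \<longlongrightarrow> L) (lower_at x)"
proof -
  obtain q where q: "\<forall>z\<in>slit_plane. poly_stieltjes \<alpha> \<beta> p z = poly p z * stieltjes \<alpha> \<beta> z + poly q z"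
    using poly_stieltjes_decomp[OF assms(1,2)] by blast
  obtain L where L: "(stieltjes \<alpha> \<beta> \<longlongrightarrow> L + 2 * of_real pi * \<i> * jacobi_weight \<alpha> \<beta> (of_real x)) (upper_at x)"
     "(stieltjes \<alpha> \<beta> \<longlongrightarrow> L) (lower_at x)"
    using stieltjes_boundary[OF assms(1,2)] assms(3,4) by blast
  have lim: "(poly_stieltjes \<alpha> \<beta> p \<longlongrightarrow> poly p (of_real x) * c + poly q (of_real x)) (at (of_real x) within S)"
    if "(stieltjes \<alpha> \<beta> \<longlongrightarrow> c) (at (of_real x) within S)" "\<And>z. z \<in> S \<Longrightarrow> Im z \<noteq> 0" for c S
  proof (rule Lim_transform_eventually)
    show "((\<lambda>z. poly p z * stieltjes \<alpha> \<beta> z + poly q z) \<longlongrightarrow> poly p (of_real x) * c + poly q (of_real x)) (at (of_real x) within S)"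
      by (intro tendsto_intros that)
    show "\<forall>\<^sub>F z in at (of_real x) within S. poly p z * stieltjes \<alpha> \<beta> z + poly q z = poly_stieltjes \<alpha> \<beta> p z"
      unfolding eventually_at_filter
    proof (rule always_eventually, intro allI impI)
      fix z assume "z \<in> S"
      then have "z \<in> slit_plane" using that(2) in_slit_plane_Im by blast
      then show "poly p z * stieltjes \<alpha> \<beta> z + poly q z = poly_stieltjes \<alpha> \<beta> p z" using q by simp
    qed
  qed
  have e: "poly p (of_real x) * (L + 2 * of_real pi * \<i> * jacobi_weight \<alpha> \<beta> (of_real x)) + poly q (of_real x) =
     (poly p (of_real x) * L + poly q (of_real x)) + 2 * of_real pi * \<i> * (poly p (of_real x) * jacobi_weight \<alpha> \<beta> (of_real x))"
    by (simp add: algebra_simps)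
  have "(poly_stieltjes \<alpha> \<beta> p \<longlongrightarrow> poly p (of_real x) * (L + 2 * of_real pi * \<i> * jacobi_weight \<alpha> \<beta> (of_real x)) + poly q (of_real x)) (upper_at x)"
    "(poly_stieltjes \<alpha> \<beta> p \<longlongrightarrow> poly p (of_real x) * L + poly q (of_real x)) (lower_at x)"
    using lim[OF L(1)[unfolded upper_at_def]] lim[OF L(2)[unfolded lower_at_def]]
    unfolding upper_at_def lower_at_def by simp_all
  then show ?thesis unfolding e by blast
qed

text \<open>z times the transform of p is the transform of t p minus the moment of p, hence it
  converges.\<close>

lemma poly_stieltjes_bigo:
  assumes "regular_exponent \<alpha>" "regular_exponent \<beta>"
  shows "poly_stieltjes \<alpha> \<beta> p \<in> O[at_infinity](\<lambda>z. inverse z)"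
proof (rule bigoI_tendsto)
  have "((\<lambda>z. poly_stieltjes \<alpha> \<beta> ([:0, 1:] * p) z - poly_moment \<alpha> \<beta> p) \<longlongrightarrow> 0 - poly_moment \<alpha> \<beta> p) at_infinity"
    by (intro tendsto_intros poly_stieltjes_at_infinity assms)
  moreover have "\<forall>\<^sub>F z in at_infinity. poly_stieltjes \<alpha> \<beta> ([:0, 1:] * p) z - poly_moment \<alpha> \<beta> p = poly_stieltjes \<alpha> \<beta> p z / inverse z"
    using eventually_slit_plane_at_infinity
    by eventually_elim (simp only: poly_stieltjes_times_X[OF assms], simp add: divide_inverse mult.commute)
  ultimately show "((\<lambda>z. poly_stieltjes \<alpha> \<beta> p z / inverse z) \<longlongrightarrow> 0 - poly_moment \<alpha> \<beta> p) at_infinity"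
    by (rule Lim_transform_eventually)
  show "\<forall>\<^sub>F z::complex in at_infinity. inverse z \<noteq> 0"
    using eventually_slit_plane_at_infinity by eventually_elim (simp add: slit_plane_ne_0)
qed

lemma poly_over_power_bigo:
  assumes "\<forall>k\<ge>n. coeff (q :: complex poly) k = 0" "n \<ge> 1"
  shows "(\<lambda>z. poly q z / z ^ n) \<in> O[at_infinity](\<lambda>z. inverse z)"
proof (rule bigoI_tendsto)
  have "degree q \<le> n - 1" using assms by (intro degree_le) auto
  from poly_over_power_at_infinity[OF this]
  have "((\<lambda>z. poly q z / z ^ (n - 1)) \<longlongrightarrow> coeff q (n - 1)) at_infinity" .
  moreover have "\<forall>\<^sub>F z in at_infinity. poly q z / z ^ (n - 1) = poly q z / z ^ n / inverse z"
    using eventually_slit_plane_at_infinity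
  proof eventually_elim
    case (elim z)
    have "z ^ n = z * z ^ (n - 1)" using assms(2) by (metis One_nat_def Suc_le_D diff_Suc_1 power_Suc)
    then show ?case using slit_plane_ne_0[OF elim] by (simp add: field_simps)
  qed
  ultimately show "((\<lambda>z. poly q z / z ^ n / inverse z) \<longlongrightarrow> coeff q (n - 1)) at_infinity"
    by (rule Lim_transform_eventually)
  show "\<forall>\<^sub>F z::complex in at_infinity. inverse z \<noteq> 0"
    using eventually_slit_plane_at_infinity by eventually_elim (simp add: slit_plane_ne_0)
qed

lemma bigo_inverse_tendsto_0:
  assumes "f \<in> O[at_infinity](\<lambda>z::complex. inverse z)"
  shows "(f \<longlongrightarrow> (0::complex)) at_infinity"
proof -
  obtain c where "\<forall>\<^sub>F z in at_infinity. norm (f z) \<le> c * norm (inverse z)"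
    using assms by (rule landau_o.bigE)
  moreover have "((\<lambda>z::complex. c * norm (inverse z)) \<longlongrightarrow> c * norm (0::complex)) at_infinity"
    by (intro tendsto_intros tendsto_inverse_0)
  ultimately show ?thesis by (elim Lim_null_comparison) simp
qed

text \<open>By the shift formula the polynomial with coefficients given by the moments tends to -c
  at infinity, hence is the constant -c. The moment of t^j p is its coefficient of degree n - 1 - j,
  so only j = n - 1 survives.\<close>

lemma poly_moments_from_decay:
  assumes reg: "regular_exponent \<alpha>" "regular_exponent \<beta>"
    and lim: "((\<lambda>z. z ^ n * poly_stieltjes \<alpha> \<beta> p z) \<longlongrightarrow> c) at_infinity" and "j < n"
  shows "poly_moment \<alpha> \<beta> (monom 1 j * p) = (if j = n - 1 then - c else 0)"
proof -
  define m where "m = (\<lambda>j. poly_moment \<alpha> \<beta> (monom 1 j * p))"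
  define q where "q = (\<Sum>j<n. monom (m j) (n - 1 - j))"
  have q: "poly q z = (\<Sum>j<n. z ^ (n - 1 - j) * m j)" for z
    by (simp add: q_def poly_sum poly_monom mult.commute)
  have "((\<lambda>z. (poly_stieltjes \<alpha> \<beta> (monom 1 n * p) z - z ^ n * poly_stieltjes \<alpha> \<beta> p z) + c) \<longlongrightarrow> (0 - c) + c) at_infinity"
    by (intro tendsto_intros poly_stieltjes_at_infinity reg lim)
  moreover have "\<forall>\<^sub>F z in at_infinity. (poly_stieltjes \<alpha> \<beta> (monom 1 n * p) z - z ^ n * poly_stieltjes \<alpha> \<beta> p z) + c = poly q z + c"
    using eventually_slit_plane_at_infinity
    by eventually_elim (simp add: poly_stieltjes_shift[OF reg] q m_def)
  ultimately have "((\<lambda>z. poly q z + c) \<longlongrightarrow> (0 - c) + c) at_infinity" by (rule Lim_transform_eventually)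
  then have l0: "((\<lambda>z. poly q z + c) \<longlongrightarrow> 0) at_infinity" by simp
  have "poly q z + c = 0" for z
    by (rule Liouville_weak_0[OF _ l0]) (intro holomorphic_intros)
  then have "poly q = poly [:- c:]" by (auto simp: eq_neg_iff_add_eq_0)
  then have "q = [:- c:]" by (simp add: poly_eq_poly_eq_iff)
  moreover have "coeff q (n - 1 - j) = m j"
  proof -
    have "coeff q (n - 1 - j) = (\<Sum>i<n. if i = j then m i else 0)"
      unfolding q_def coeff_sum using \<open>j < n\<close> by (intro sum.cong refl) auto
    then show ?thesis using \<open>j < n\<close> by simp
  qed
  ultimately show ?thesis using \<open>j < n\<close> by (auto simp: m_def coeff_pCons split: nat.splits)
qed

lemma poly_moment_mult_eq_0:
  assumes reg: "regular_exponent \<alpha>" "regular_exponent \<beta>"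
    and "\<And>j. j \<le> degree q \<Longrightarrow> poly_moment \<alpha> \<beta> (monom 1 j * p) = 0"
  shows "poly_moment \<alpha> \<beta> (q * p) = 0"
proof -
  have "q = (\<Sum>j\<le>degree q. smult (coeff q j) (monom 1 j))"
    by (simp add: smult_monom poly_as_sum_of_monoms)
  then have "q * p = (\<Sum>j\<le>degree q. smult (coeff q j) (monom 1 j * p))"
    by (metis (no_types, lifting) sum.cong sum_distrib_right mult_smult_left)
  moreover have "poly_moment \<alpha> \<beta> (\<Sum>j\<in>A. smult (coeff q j) (monom 1 j * p)) = (\<Sum>j\<in>A. coeff q j * poly_moment \<alpha> \<beta> (monom 1 j * p))"
    if "finite A" for A
    using that by (induction A rule: finite_induct) (simp_all add: poly_moment_add[OF reg] poly_moment_smult[OF reg] poly_moment_0[OF reg])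
  ultimately show ?thesis using assms(3) by simp
qed

section \<open>Norms of the Jacobi polynomials\<close>

text \<open>This is the moment of \<open>monic_jacobi\<close> times any monic polynomial of the same
  degree, in particular its square: the norm in the bilinear, not the Hermitian, sense.\<close>

definition jacobi_norm :: "complex \<Rightarrow> complex \<Rightarrow> nat \<Rightarrow> complex" where
  "jacobi_norm \<alpha> \<beta> m = inverse (jacobi_C \<alpha> \<beta> m) * ((-1) ^ m * (fact m * Beta (\<alpha> + of_nat m + 1) (\<beta> + of_nat m + 1)))"

context
  fixes \<alpha> \<beta> :: complex
  assumes reg: "regular_exponent \<alpha>" "regular_exponent \<beta>"
    and sum_reg: "\<forall>k::nat. k \<ge> 2 \<longrightarrow> \<alpha> + \<beta> \<noteq> - of_nat k"
begin

lemma jacobi_C_ne_0: "jacobi_C \<alpha> \<beta> m \<noteq> 0"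
proof
  assume "jacobi_C \<alpha> \<beta> m = 0"
  then obtain k where k: "k \<in> {1..m}" "of_nat k + of_nat m + \<alpha> + \<beta> = 0"
    by (auto simp: jacobi_C_def)
  then have "\<alpha> + \<beta> = - of_nat (k + m)" by (simp add: eq_neg_iff_add_eq_0 algebra_simps)
  moreover have "k + m \<ge> 2" using k by auto
  ultimately show False using sum_reg by blast
qed

text \<open>Beta is written with 1/Gamma of the sum, which vanishes only if \<alpha> + \<beta> is an
  excluded integer. In HOL, Gamma takes the value 0 at its poles, so regularity keeps the other two
  factors nonzero.\<close>

lemma jacobi_norm_ne_0: "jacobi_norm \<alpha> \<beta> m \<noteq> 0"
proof -
  have "Gamma (\<gamma> + of_nat m + 1) \<noteq> 0" if "regular_exponent \<gamma>" for \<gamma>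
    using regular_exponent_plus_nat[OF that, of m] by (simp add: regular_exponent_def Gamma_eq_zero_iff)
  moreover have "rGamma ((\<alpha> + of_nat m + 1) + (\<beta> + of_nat m + 1)) \<noteq> 0"
  proof
    assume "rGamma ((\<alpha> + of_nat m + 1) + (\<beta> + of_nat m + 1)) = 0"
    then obtain j where "(\<alpha> + of_nat m + 1) + (\<beta> + of_nat m + 1) = - of_nat j"
      unfolding rGamma_eq_zero_iff by (auto elim: nonpos_Ints_cases')
    then have "\<alpha> + \<beta> = - of_nat (j + 2 * m + 2)" by (simp add: eq_neg_iff_add_eq_0 algebra_simps)
    moreover have "j + 2 * m + 2 \<ge> 2" by simp
    ultimately show False using sum_reg by blast
  qed
  ultimately show ?thesis using reg by (simp add: jacobi_norm_def jacobi_C_ne_0 Beta_altdef)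
qed

lemma monic_jacobi_coeff: "degree (monic_jacobi \<alpha> \<beta> m) \<le> m" "coeff (monic_jacobi \<alpha> \<beta> m) m = 1"
  using rodrigues_poly_degree[of m \<alpha> \<beta>] jacobi_C_ne_0
  by (auto simp: monic_jacobi_def jacobi_poly_eq_rodrigues intro: order_trans[OF degree_smult_le])

lemma poly_moment_monic_jacobi:
  assumes "degree q \<le> m"
  shows "poly_moment \<alpha> \<beta> (monic_jacobi \<alpha> \<beta> m * q) = jacobi_norm \<alpha> \<beta> m * coeff q m"
  unfolding monic_jacobi_def jacobi_poly_eq_rodrigues mult_smult_left poly_moment_smult[OF reg]
    poly_moment_rodrigues_degree[OF reg assms] jacobi_norm_def
  by (simp add: mult_ac)

lemma poly_moment_monom_monic_jacobi:
  assumes "j \<le> m"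
  shows "poly_moment \<alpha> \<beta> (monom 1 j * monic_jacobi \<alpha> \<beta> m) = (if j = m then jacobi_norm \<alpha> \<beta> m else 0)"
  using poly_moment_monic_jacobi[of "monom 1 j" m] assms
  by (simp add: degree_monom_eq mult.commute)

text \<open>This is the origin of c_n. The transform of the monic polynomial of degree n - 1 begins
  with minus its norm times z^(-n); after division by 2 pi i, the factor c_n makes the leading term
  of the lower right entry exactly z^(-n).\<close>

lemma jacobi_c_norm:
  assumes "n \<ge> 1"
  shows "jacobi_c \<alpha> \<beta> n * jacobi_norm \<alpha> \<beta> (n - 1) = - (2 * of_real pi * \<i>)"
proof -
  obtain m where n: "n = Suc m" using assms by (cases n) auto
  define B where "B = fact m * Beta (\<alpha> + of_nat m + 1) (\<beta> + of_nat m + 1)"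
  have "B \<noteq> 0" "jacobi_C \<alpha> \<beta> m \<noteq> 0" using jacobi_norm_ne_0[of m] by (auto simp: jacobi_norm_def B_def)
  then have i: "inverse B * B = 1" "jacobi_C \<alpha> \<beta> m * inverse (jacobi_C \<alpha> \<beta> m) = 1" by simp_all
  have s: "(-1) ^ m * (-1) ^ m = (1 :: complex)" by (simp flip: power_mult_distrib)
  have g: "(-1 * a * P * C * X) * (Y * (a * Z)) = - P * (a * a) * (C * Y) * (X * Z)" for a P C X Y Z :: complex
    by (simp add: algebra_simps)
  have "jacobi_c \<alpha> \<beta> n * jacobi_norm \<alpha> \<beta> (n - 1) =
      ((-1) ^ Suc m * (2 * of_real pi * \<i>) * jacobi_C \<alpha> \<beta> m * inverse B) * (inverse (jacobi_C \<alpha> \<beta> m) * ((-1) ^ m * B))"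
    by (simp add: jacobi_c_def jacobi_norm_def n B_def add_ac)
  also have "\<dots> = - (2 * of_real pi * \<i>) * ((-1) ^ m * (-1) ^ m) * (jacobi_C \<alpha> \<beta> m * inverse (jacobi_C \<alpha> \<beta> m)) * (inverse B * B)"
    unfolding power_Suc by (rule g)
  also have "\<dots> = - (2 * of_real pi * \<i>)" unfolding i s by simp
  finally show ?thesis .
qed

text \<open>Testing against the monic Jacobi polynomial of degree \<open>degree d\<close> isolates the leading coefficient.\<close>

lemma orthogonal_imp_0:
  assumes "\<And>j. j < n \<Longrightarrow> poly_moment \<alpha> \<beta> (monom 1 j * d) = 0" "\<forall>k\<ge>n. coeff d k = 0"
  shows "d = 0"
proof (rule ccontr)
  assume "d \<noteq> 0"
  define m where "m = degree d"
  have "m < n" using assms(2) \<open>d \<noteq> 0\<close> by (metis m_def leading_coeff_0_iff not_le)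
  have "poly_moment \<alpha> \<beta> (monic_jacobi \<alpha> \<beta> m * d) = 0"
    by (rule poly_moment_mult_eq_0[OF reg], rule assms(1)) (use monic_jacobi_coeff(1)[of m] \<open>m < n\<close> in simp)
  moreover have "poly_moment \<alpha> \<beta> (monic_jacobi \<alpha> \<beta> m * d) = jacobi_norm \<alpha> \<beta> m * coeff d m"
    by (rule poly_moment_monic_jacobi) (simp add: m_def)
  ultimately show False using jacobi_norm_ne_0 \<open>d \<noteq> 0\<close> by (simp add: m_def)
qed

end

section \<open>The Riemann-Hilbert problem\<close>

lemma jacobi_Y_components:
  "jacobi_Y \<alpha> \<beta> n z $ 1 $ 1 = poly (monic_jacobi \<alpha> \<beta> n) z"
  "jacobi_Y \<alpha> \<beta> n z $ 1 $ 2 = 1 / (2 * of_real pi * \<i>) * poly_stieltjes \<alpha> \<beta> (monic_jacobi \<alpha> \<beta> n) z"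
  "jacobi_Y \<alpha> \<beta> n z $ 2 $ 1 = jacobi_c \<alpha> \<beta> n * poly (monic_jacobi \<alpha> \<beta> (n - 1)) z"
  "jacobi_Y \<alpha> \<beta> n z $ 2 $ 2 =
     jacobi_c \<alpha> \<beta> n * (1 / (2 * of_real pi * \<i>) * poly_stieltjes \<alpha> \<beta> (monic_jacobi \<alpha> \<beta> (n - 1)) z)"
  by (simp_all add: jacobi_Y_def vector_2 jacobi_cauchy_def poly_stieltjes_def)

lemma jump_matrix_components:
  fixes A :: "complex^2^2"
  shows "(A ** vector [vector [1, w], vector [0, 1]] :: complex^2^2) $ i $ 1 = A $ i $ 1"
    "(A ** vector [vector [1, w], vector [0, 1]] :: complex^2^2) $ i $ 2 = A $ i $ 1 * w + A $ i $ 2"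
  by (simp_all add: matrix_matrix_mult_def sum_2 vector_2)

lemma infinity_matrix_components:
  fixes E :: "complex^2^2"
  shows "((mat 1 + E) ** vector [vector [a, 0], vector [0, b]] :: complex^2^2) $ i $ 1 = ((if i = 1 then 1 else 0) + E $ i $ 1) * a"
    "((mat 1 + E) ** vector [vector [a, 0], vector [0, b]] :: complex^2^2) $ i $ 2 = ((if i = 2 then 1 else 0) + E $ i $ 2) * b"
  by (simp_all add: matrix_matrix_mult_def sum_2 vector_2 mat_def)

lemma matrix_2_eqI:
  fixes A B :: "'a^2^2"
  assumes "A $ 1 $ 1 = B $ 1 $ 1" "A $ 1 $ 2 = B $ 1 $ 2" "A $ 2 $ 1 = B $ 2 $ 1" "A $ 2 $ 2 = B $ 2 $ 2"
  shows "A = B"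
  using assms by (simp add: vec_eq_iff forall_2)

lemma tendsto_matrix_2:
  fixes Y :: "complex \<Rightarrow> complex^2^2"
  assumes "((\<lambda>z. Y z $ 1 $ 1) \<longlongrightarrow> a) F" "((\<lambda>z. Y z $ 1 $ 2) \<longlongrightarrow> b) F"
    "((\<lambda>z. Y z $ 2 $ 1) \<longlongrightarrow> c) F" "((\<lambda>z. Y z $ 2 $ 2) \<longlongrightarrow> d) F"
  shows "(Y \<longlongrightarrow> vector [vector [a, b], vector [c, d]]) F"
proof (intro vec_tendstoI)
  fix i j :: 2
  show "((\<lambda>z. Y z $ i $ j) \<longlongrightarrow> vector [vector [a, b], vector [c, d]] $ i $ j) F"
    using exhaust_2[of i] exhaust_2[of j] assms by (auto simp: vector_2)
qed

context
  fixes \<alpha> \<beta> :: complex and n :: nat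
  assumes reg: "regular_exponent \<alpha>" "regular_exponent \<beta>"
    and sum_reg: "\<forall>k::nat. k \<ge> 2 \<longrightarrow> \<alpha> + \<beta> \<noteq> - of_nat k"
    and n: "n \<ge> 1"
begin

lemma jacobi_Y_boundary:
  assumes "0 < x" "x < 1"
  obtains U L where "(jacobi_Y \<alpha> \<beta> n \<longlongrightarrow> U) (upper_at x)" "(jacobi_Y \<alpha> \<beta> n \<longlongrightarrow> L) (lower_at x)"
    "U = L ** vector [vector [1, jacobi_weight \<alpha> \<beta> (of_real x)], vector [0, 1]]"
proof -
  let ?K = "1 / (2 * of_real pi * \<i>) :: complex" and ?w = "jacobi_weight \<alpha> \<beta> (of_real x)" and ?c = "jacobi_c \<alpha> \<beta> n"
  let ?p = "monic_jacobi \<alpha> \<beta> n" and ?q = "monic_jacobi \<alpha> \<beta> (n - 1)"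
  obtain P where P: "(poly_stieltjes \<alpha> \<beta> ?p \<longlongrightarrow> P + 2 * of_real pi * \<i> * (poly ?p (of_real x) * ?w)) (upper_at x)"
     "(poly_stieltjes \<alpha> \<beta> ?p \<longlongrightarrow> P) (lower_at x)" using poly_stieltjes_boundary[OF reg assms] by blast
  obtain Q where Q: "(poly_stieltjes \<alpha> \<beta> ?q \<longlongrightarrow> Q + 2 * of_real pi * \<i> * (poly ?q (of_real x) * ?w)) (upper_at x)"
     "(poly_stieltjes \<alpha> \<beta> ?q \<longlongrightarrow> Q) (lower_at x)" using poly_stieltjes_boundary[OF reg assms] by blast
  have pol: "(poly r \<longlongrightarrow> poly r (of_real x)) (upper_at x)" "(poly r \<longlongrightarrow> poly r (of_real x)) (lower_at x)" for r :: "complex poly"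
    unfolding upper_at_def lower_at_def by (intro tendsto_intros)+
  have "(jacobi_Y \<alpha> \<beta> n \<longlongrightarrow> vector [vector [poly ?p (of_real x), ?K * (P + 2 * of_real pi * \<i> * (poly ?p (of_real x) * ?w))],
      vector [?c * poly ?q (of_real x), ?c * (?K * (Q + 2 * of_real pi * \<i> * (poly ?q (of_real x) * ?w)))]]) (upper_at x)"
    by (intro tendsto_matrix_2, unfold jacobi_Y_components; intro tendsto_mult tendsto_const P Q pol)
  moreover have "(jacobi_Y \<alpha> \<beta> n \<longlongrightarrow> vector [vector [poly ?p (of_real x), ?K * P],
      vector [?c * poly ?q (of_real x), ?c * (?K * Q)]]) (lower_at x)"
    by (intro tendsto_matrix_2, unfold jacobi_Y_components; intro tendsto_mult tendsto_const P Q pol)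
  moreover have "(vector [vector [poly ?p (of_real x), ?K * (P + 2 * of_real pi * \<i> * (poly ?p (of_real x) * ?w))],
      vector [?c * poly ?q (of_real x), ?c * (?K * (Q + 2 * of_real pi * \<i> * (poly ?q (of_real x) * ?w)))]] :: complex^2^2) =
     (vector [vector [poly ?p (of_real x), ?K * P], vector [?c * poly ?q (of_real x), ?c * (?K * Q)]] :: complex^2^2) **
       (vector [vector [1, ?w], vector [0, 1]] :: complex^2^2)"
    by (rule matrix_2_eqI) (simp_all add: jump_matrix_components vector_2 field_simps)
  ultimately show thesis by (rule that)
qed

lemma jacobi_Y_rh_analytic: "rh_analytic (jacobi_Y \<alpha> \<beta> n)"
  unfolding rh_analytic_def
proof (intro conjI allI impI)
  fix i j :: 2
  have "(\<lambda>z. jacobi_Y \<alpha> \<beta> n z $ i $ j) holomorphic_on slit_plane"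
    using exhaust_2[of i] exhaust_2[of j] poly_stieltjes_holomorphic[OF reg]
    by (elim disjE) (auto simp: jacobi_Y_components intro!: holomorphic_intros)
  then show "(\<lambda>z. jacobi_Y \<alpha> \<beta> n z $ i $ j) analytic_on slit_plane"
    by (simp add: analytic_on_open)
next
  fix x :: real assume x: "0 < x \<and> x < 1"
  then show "\<exists>L. (jacobi_Y \<alpha> \<beta> n \<longlongrightarrow> L) (upper_at x)" by (metis jacobi_Y_boundary)
  show "\<exists>L. (jacobi_Y \<alpha> \<beta> n \<longlongrightarrow> L) (lower_at x)" using x by (metis jacobi_Y_boundary)
qed

lemma jacobi_Y_rh_jump: "rh_jump \<alpha> \<beta> (jacobi_Y \<alpha> \<beta> n)"
  unfolding rh_jump_def
proof (intro allI impI)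
  fix x :: real assume "0 < x \<and> x < 1"
  then obtain U L where "(jacobi_Y \<alpha> \<beta> n \<longlongrightarrow> U) (upper_at x)" "(jacobi_Y \<alpha> \<beta> n \<longlongrightarrow> L) (lower_at x)"
    "U = L ** vector [vector [1, jacobi_weight \<alpha> \<beta> (of_real x)], vector [0, 1]]"
    by (metis jacobi_Y_boundary)
  then show "Lim (upper_at x) (jacobi_Y \<alpha> \<beta> n) = Lim (lower_at x) (jacobi_Y \<alpha> \<beta> n) **
       vector [vector [1, jacobi_weight \<alpha> \<beta> (of_real x)], vector [0, 1]]"
    using tendsto_Lim[OF upper_at_neq_bot] tendsto_Lim[OF lower_at_neq_bot] by metis
qed

text \<open>Orthogonality removes all moments from the shift formula, except the one of degree n - 1
  in the second case, which is the norm.\<close>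

lemma poly_stieltjes_monic_jacobi_shift:
  assumes "z \<in> slit_plane"
  shows "z ^ n * poly_stieltjes \<alpha> \<beta> (monic_jacobi \<alpha> \<beta> n) z = poly_stieltjes \<alpha> \<beta> (monom 1 n * monic_jacobi \<alpha> \<beta> n) z"
    and "z ^ n * poly_stieltjes \<alpha> \<beta> (monic_jacobi \<alpha> \<beta> (n - 1)) z =
      poly_stieltjes \<alpha> \<beta> (monom 1 n * monic_jacobi \<alpha> \<beta> (n - 1)) z - jacobi_norm \<alpha> \<beta> (n - 1)"
proof -
  have "(\<Sum>j<n. z ^ (n - 1 - j) * poly_moment \<alpha> \<beta> (monom 1 j * monic_jacobi \<alpha> \<beta> n)) = 0"
    by (intro sum.neutral) (auto simp: poly_moment_monom_monic_jacobi[OF reg sum_reg])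
  then show "z ^ n * poly_stieltjes \<alpha> \<beta> (monic_jacobi \<alpha> \<beta> n) z = poly_stieltjes \<alpha> \<beta> (monom 1 n * monic_jacobi \<alpha> \<beta> n) z"
    by (simp add: poly_stieltjes_shift[OF reg assms])
  have "(\<Sum>j<n. z ^ (n - 1 - j) * poly_moment \<alpha> \<beta> (monom 1 j * monic_jacobi \<alpha> \<beta> (n - 1))) =
      (\<Sum>j<n. if j = n - 1 then jacobi_norm \<alpha> \<beta> (n - 1) else 0)"
    using n by (intro sum.cong refl) (auto simp: poly_moment_monom_monic_jacobi[OF reg sum_reg])
  also have "\<dots> = jacobi_norm \<alpha> \<beta> (n - 1)" using n by simp
  finally show "z ^ n * poly_stieltjes \<alpha> \<beta> (monic_jacobi \<alpha> \<beta> (n - 1)) z =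
      poly_stieltjes \<alpha> \<beta> (monom 1 n * monic_jacobi \<alpha> \<beta> (n - 1)) z - jacobi_norm \<alpha> \<beta> (n - 1)"
    by (simp add: poly_stieltjes_shift[OF reg assms])
qed

lemma jacobi_Y_rh_infinity: "rh_infinity n (jacobi_Y \<alpha> \<beta> n)"
proof -
  let ?K = "1 / (2 * of_real pi * \<i>) :: complex" and ?c = "jacobi_c \<alpha> \<beta> n"
  let ?p = "monic_jacobi \<alpha> \<beta> n" and ?q = "monic_jacobi \<alpha> \<beta> (n - 1)"
  note pdeg = monic_jacobi_coeff[OF reg sum_reg, of n] and qdeg = monic_jacobi_coeff[OF reg sum_reg, of "n - 1"]
  \<comment> \<open>\<open>E\<close> is solved from the required factorization. In the second
    column, multiplying by z^n replaces the density p by t^n p, whose transform is O(1/z); in the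
    first, monicity cancels the leading term.\<close>
  define E :: "complex \<Rightarrow> complex^2^2" where "E = (\<lambda>z. vector
    [vector [poly (?p - monom 1 n) z / z ^ n, ?K * poly_stieltjes \<alpha> \<beta> (monom 1 n * ?p) z],
     vector [poly (smult ?c ?q) z / z ^ n, ?c * ?K * poly_stieltjes \<alpha> \<beta> (monom 1 n * ?q) z]])"
  have "(\<lambda>z. E z $ i $ j) \<in> O[at_infinity](\<lambda>z. inverse z)" for i j :: 2
  proof -
    have "\<forall>k\<ge>n. coeff (?p - monom 1 n) k = 0"
      using pdeg by (auto simp: coeff_eq_0 le_less)
    then have "(\<lambda>z. poly (?p - monom 1 n) z / z ^ n) \<in> O[at_infinity](\<lambda>z. inverse z)"
      by (rule poly_over_power_bigo[OF _ n])
    moreover have "\<forall>k\<ge>n. coeff (smult ?c ?q) k = 0"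
      using qdeg(1) n by (auto intro!: coeff_eq_0)
    then have "(\<lambda>z. poly (smult ?c ?q) z / z ^ n) \<in> O[at_infinity](\<lambda>z. inverse z)"
      by (rule poly_over_power_bigo[OF _ n])
    moreover have "(\<lambda>z. k * poly_stieltjes \<alpha> \<beta> r z) \<in> O[at_infinity](\<lambda>z. inverse z)" for k r
      using poly_stieltjes_bigo[OF reg, of r] by (cases "k = 0") auto
    ultimately show ?thesis
      using exhaust_2[of i] exhaust_2[of j]
      by (elim disjE) (simp_all only: E_def vector_2)
  qed
  moreover have "\<forall>\<^sub>F z in at_infinity. jacobi_Y \<alpha> \<beta> n z = (mat 1 + E z) **
      vector [vector [z ^ n, 0], vector [0, z powi (- int n)]]"
    using eventually_slit_plane_at_infinity
  proof eventually_elim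
    case (elim z)
    have z: "z \<noteq> 0" using elim by (rule slit_plane_ne_0)
    have pw: "z powi (- int n) = inverse (z ^ n)" by (simp add: power_int_minus)
    have K: "?c * ?K * (- jacobi_norm \<alpha> \<beta> (n - 1)) = 1"
      using jacobi_c_norm[OF reg sum_reg n] by (simp add: field_simps)
    show ?case
    proof (rule matrix_2_eqI; unfold infinity_matrix_components jacobi_Y_components pw)
      show "poly ?p z = ((if (1::2) = 1 then 1 else 0) + E z $ 1 $ 1) * z ^ n"
        using z by (simp add: E_def vector_2 poly_monom field_simps)
      show "?K * poly_stieltjes \<alpha> \<beta> ?p z = ((if (1::2) = 2 then 1 else 0) + E z $ 1 $ 2) * inverse (z ^ n)"
        using z by (simp add: E_def vector_2 flip: poly_stieltjes_monic_jacobi_shift(1)[OF elim])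
      show "?c * poly ?q z = ((if (2::2) = 1 then 1 else 0) + E z $ 2 $ 1) * z ^ n"
        using z by (simp add: E_def vector_2)
      have "z ^ n * (?c * (?K * poly_stieltjes \<alpha> \<beta> ?q z)) = ?c * ?K * (z ^ n * poly_stieltjes \<alpha> \<beta> ?q z)"
        by (simp only: mult_ac)
      also have "\<dots> = E z $ 2 $ 2 + ?c * ?K * (- jacobi_norm \<alpha> \<beta> (n - 1))"
        unfolding poly_stieltjes_monic_jacobi_shift(2)[OF elim] by (simp add: E_def vector_2 right_diff_distrib)
      finally have "z ^ n * (?c * (?K * poly_stieltjes \<alpha> \<beta> ?q z)) = 1 + E z $ 2 $ 2"
        unfolding K by simp
      moreover have "a = b * inverse (z ^ n)" if "z ^ n * a = b" for a b
        using that z by (auto simp: field_simps)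
      ultimately have "?c * (?K * poly_stieltjes \<alpha> \<beta> ?q z) = (1 + E z $ 2 $ 2) * inverse (z ^ n)" by blast
      then show "?c * (?K * poly_stieltjes \<alpha> \<beta> ?q z) = ((if (2::2) = 2 then 1 else 0) + E z $ 2 $ 2) * inverse (z ^ n)"
        by (simp only: if_True refl)
    qed
  qed
  ultimately show ?thesis unfolding rh_infinity_def by blast
qed

lemma poly_bounded_at:
  "poly (p :: complex poly) \<in> O[at a within S](\<lambda>_. 1)"
proof (rule tendsto_imp_bounded)
  show "(poly p \<longlongrightarrow> poly p a) (at a within S)" by (intro tendsto_intros)
qed

lemma cmult_poly_bounded_at: "(\<lambda>z. c * poly (p :: complex poly) z) \<in> O[at a within S](\<lambda>_. 1)"
proof -
  have "poly (smult c p) = (\<lambda>z. c * poly p z)" by auto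
  with poly_bounded_at[of "smult c p" a S] show ?thesis by (simp only:)
qed

lemma jacobi_Y_rh_solution:
  assumes "\<alpha> \<noteq> 0" "\<beta> \<noteq> 0"
  shows "rh_solution \<alpha> \<beta> n (jacobi_Y \<alpha> \<beta> n)"
proof -
  have "rh_zero \<alpha> (jacobi_Y \<alpha> \<beta> n)"
    unfolding rh_zero_def forall_2 jacobi_Y_components
    using assms by (intro conjI poly_bounded_at cmult_poly_bounded_at sing_at_0_cmult sing_poly_stieltjes reg)
  moreover have "rh_one \<beta> (jacobi_Y \<alpha> \<beta> n)"
    unfolding rh_one_def forall_2 jacobi_Y_components sing_at_1_iff
    using assms by (intro conjI poly_bounded_at cmult_poly_bounded_at sing_at_0_cmult sing_poly_stieltjes_1 reg)
  ultimately show ?thesis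
    unfolding rh_solution_def using jacobi_Y_rh_analytic jacobi_Y_rh_jump jacobi_Y_rh_infinity by blast
qed

section \<open>Uniqueness\<close>

text \<open>The jump matrix and the conditions at the endpoints and at infinity act on each row
  separately, so both rows are treated at once; they differ only in which entry of the identity
  matrix is 1.\<close>

lemma rh_solution_row:
  fixes Y :: "complex \<Rightarrow> complex^2^2" and i :: 2
  assumes Y: "rh_solution \<alpha> \<beta> n Y"
  obtains p where "degree p \<le> n" "coeff p n = (if i = 1 then 1 else 0)"
    "\<And>z. z \<in> slit_plane \<Longrightarrow> Y z $ i $ 1 = poly p z"
    "\<And>z. z \<in> slit_plane \<Longrightarrow> Y z $ i $ 2 = 1 / (2 * of_real pi * \<i>) * poly_stieltjes \<alpha> \<beta> p z"
    "\<And>j. j < n \<Longrightarrow> poly_moment \<alpha> \<beta> (monom 1 j * p) = (if j = n - 1 \<and> i = 2 then - (2 * of_real pi * \<i>) else 0)"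
proof -
  let ?K = "1 / (2 * of_real pi * \<i>) :: complex"
  have an: "(\<lambda>z. Y z $ i $ j) holomorphic_on slit_plane" for j
    using Y by (simp add: rh_solution_def rh_analytic_def analytic_imp_holomorphic)
  have bnd: "\<exists>U L. (Y \<longlongrightarrow> U) (upper_at x) \<and> (Y \<longlongrightarrow> L) (lower_at x) \<and>
      U = L ** vector [vector [1, jacobi_weight \<alpha> \<beta> (of_real x)], vector [0, 1]]" if x: "0 < x" "x < 1" for x
  proof -
    obtain U L where UL: "(Y \<longlongrightarrow> U) (upper_at x)" "(Y \<longlongrightarrow> L) (lower_at x)"
      using Y x by (auto simp: rh_solution_def rh_analytic_def)
    moreover have "Lim (upper_at x) Y = Lim (lower_at x) Y ** vector [vector [1, jacobi_weight \<alpha> \<beta> (of_real x)], vector [0, 1]]"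
      using Y x by (simp add: rh_solution_def rh_jump_def)
    ultimately show ?thesis
      using tendsto_Lim[OF upper_at_neq_bot UL(1)] tendsto_Lim[OF lower_at_neq_bot UL(2)] by metis
  qed
  have lim: "\<exists>a b. ((\<lambda>z. Y z $ i $ 1) \<longlongrightarrow> a) (upper_at x) \<and> ((\<lambda>z. Y z $ i $ 1) \<longlongrightarrow> a) (lower_at x) \<and>
      ((\<lambda>z. Y z $ i $ 2) \<longlongrightarrow> a * jacobi_weight \<alpha> \<beta> (of_real x) + b) (upper_at x) \<and> ((\<lambda>z. Y z $ i $ 2) \<longlongrightarrow> b) (lower_at x)"
    if x: "0 < x" "x < 1" for x
  proof -
    obtain U L where UL: "(Y \<longlongrightarrow> U) (upper_at x)" "(Y \<longlongrightarrow> L) (lower_at x)"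
      "U = L ** vector [vector [1, jacobi_weight \<alpha> \<beta> (of_real x)], vector [0, 1]]" using bnd[OF x] by blast
    have "((\<lambda>z. Y z $ i $ j) \<longlongrightarrow> U $ i $ j) (upper_at x)" "((\<lambda>z. Y z $ i $ j) \<longlongrightarrow> L $ i $ j) (lower_at x)" for j
      by (intro tendsto_vec_nth UL)+
    from this[of 1] this[of 2] show ?thesis unfolding UL(3) jump_matrix_components by blast
  qed
  have bd: "(\<lambda>z. Y z $ i $ 1) \<in> O[at 0 within slit_plane](\<lambda>_. 1)" "(\<lambda>z. Y (1 - z) $ i $ 1) \<in> O[at 0 within slit_plane](\<lambda>_. 1)"
    and sing: "sing_at_0 \<alpha> (\<lambda>z. Y z $ i $ 2)" "sing_at_0 \<beta> (\<lambda>z. Y (1 - z) $ i $ 2)"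
    using Y by (auto simp: rh_solution_def rh_zero_def rh_one_def bounded_at_1_iff sing_at_1_iff)
  obtain E :: "complex \<Rightarrow> complex^2^2" where "\<forall>i j. (\<lambda>z. E z $ i $ j) \<in> O[at_infinity](\<lambda>z. inverse z)"
    and E: "\<forall>\<^sub>F z in at_infinity. Y z = (mat 1 + E z) ** vector [vector [z ^ n, 0], vector [0, z powi (- int n)]]"
    using Y by (auto simp: rh_solution_def rh_infinity_def)
  then have E0: "((\<lambda>z. E z $ i $ j) \<longlongrightarrow> 0) at_infinity" for j
    by (intro bigo_inverse_tendsto_0) simp
  let ?d = "\<lambda>j::2. if i = j then 1 else 0 :: complex"
  have l: "((\<lambda>z. ?d j + E z $ i $ j) \<longlongrightarrow> ?d j + 0) at_infinity" for j by (intro tendsto_intros E0)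
  have "\<forall>\<^sub>F z in at_infinity. ?d 1 + E z $ i $ 1 = Y z $ i $ 1 / z ^ n \<and> ?d 2 + E z $ i $ 2 = z ^ n * Y z $ i $ 2"
    using E eventually_slit_plane_at_infinity
  proof eventually_elim
    case (elim z)
    have "z \<noteq> 0" using elim(2) by (rule slit_plane_ne_0)
    then show ?case unfolding elim(1) infinity_matrix_components by (simp add: power_int_minus)
  qed
  then have ev: "\<forall>\<^sub>F z in at_infinity. ?d 1 + E z $ i $ 1 = Y z $ i $ 1 / z ^ n" "\<forall>\<^sub>F z in at_infinity. ?d 2 + E z $ i $ 2 = z ^ n * Y z $ i $ 2"
    by (auto elim: eventually_mono)
  have inf: "((\<lambda>z. Y z $ i $ 1 / z ^ n) \<longlongrightarrow> ?d 1) at_infinity" "((\<lambda>z. z ^ n * Y z $ i $ 2) \<longlongrightarrow> ?d 2) at_infinity"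
    using Lim_transform_eventually[OF l[of 1] ev(1)] Lim_transform_eventually[OF l[of 2] ev(2)] by simp_all
  obtain g where g: "g holomorphic_on UNIV" "\<And>z. z \<in> slit_plane \<Longrightarrow> g z = Y z $ i $ 1"
  proof (rule entire_extension[OF reg an[of 1]])
    show "\<exists>L. ((\<lambda>z. Y z $ i $ 1) \<longlongrightarrow> L) (upper_at x) \<and> ((\<lambda>z. Y z $ i $ 1) \<longlongrightarrow> L) (lower_at x)" if "0 < x" "x < 1" for x
      using lim[OF that] by blast
  qed (use bd in \<open>auto intro!: bounded_imp_weak_sing_at_0\<close>)
  have "\<forall>\<^sub>F z in at_infinity. Y z $ i $ 1 / z ^ n = g z / z ^ n"
    using eventually_slit_plane_at_infinity by eventually_elim (simp add: g)
  from Lim_transform_eventually[OF inf(1) this] obtain p where p: "g = poly p" "degree p \<le> n" "coeff p n = ?d 1"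
    by (rule entire_power_asymptotic_imp_poly[OF g(1)])
  have Y1: "Y z $ i $ 1 = poly p z" if "z \<in> slit_plane" for z using g(2)[OF that] p(1) by simp
  let ?S = "poly_stieltjes \<alpha> \<beta> p"
  let ?F = "\<lambda>z. Y z $ i $ 2 - ?K * ?S z"
  obtain h where h: "h holomorphic_on UNIV" "\<And>z. z \<in> slit_plane \<Longrightarrow> h z = ?F z"
  proof (rule entire_extension[OF reg])
    show "?F holomorphic_on slit_plane"
      using an poly_stieltjes_holomorphic[OF reg] by (intro holomorphic_intros)
    show "\<exists>L. (?F \<longlongrightarrow> L) (upper_at x) \<and> (?F \<longlongrightarrow> L) (lower_at x)" if x: "0 < x" "x < 1" for x
    proof -
      let ?w = "jacobi_weight \<alpha> \<beta> (of_real x)"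
      obtain a b where ab: "((\<lambda>z. Y z $ i $ 1) \<longlongrightarrow> a) (upper_at x)"
        "((\<lambda>z. Y z $ i $ 2) \<longlongrightarrow> a * ?w + b) (upper_at x)" "((\<lambda>z. Y z $ i $ 2) \<longlongrightarrow> b) (lower_at x)"
        using lim[OF x] by blast
      obtain L where L: "(?S \<longlongrightarrow> L + 2 * of_real pi * \<i> * (poly p (of_real x) * ?w)) (upper_at x)" "(?S \<longlongrightarrow> L) (lower_at x)"
        using poly_stieltjes_boundary[OF reg x] by blast
      have "(poly p \<longlongrightarrow> poly p (of_real x)) (upper_at x)" unfolding upper_at_def by (intro tendsto_intros)
      moreover have "\<forall>\<^sub>F z in upper_at x. poly p z = Y z $ i $ 1"
        unfolding upper_at_def eventually_at_filter using Y1 in_slit_plane_Im by (auto intro!: always_eventually)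
      ultimately have "((\<lambda>z. Y z $ i $ 1) \<longlongrightarrow> poly p (of_real x)) (upper_at x)" by (rule Lim_transform_eventually)
      \<comment> \<open>Identifying the boundary value of the first entry with p(x) makes the jump
        of the second entry equal to that of the transform of p, up to the factor 2 pi i.\<close>
      with ab(1) have a: "a = poly p (of_real x)" by (rule tendsto_unique[OF upper_at_neq_bot])
      have up: "(?F \<longlongrightarrow> a * ?w + b - ?K * (L + 2 * of_real pi * \<i> * (poly p (of_real x) * ?w))) (upper_at x)"
        by (intro tendsto_intros ab L)
      have eq: "a * ?w + b - ?K * (L + 2 * of_real pi * \<i> * (poly p (of_real x) * ?w)) = b - ?K * L"
        by (simp add: a field_simps)
      have "(?F \<longlongrightarrow> b - ?K * L) (lower_at x)" by (intro tendsto_intros ab L)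
      with up[unfolded eq] show ?thesis by blast
    qed
    show "weak_sing_at_0 \<alpha> ?F"
      by (intro weak_sing_at_0_linear sing_imp_weak_sing_at_0 sing weak_sing_poly_stieltjes reg)
    show "weak_sing_at_0 \<beta> (\<lambda>z. ?F (1 - z))"
      by (intro weak_sing_at_0_linear sing_imp_weak_sing_at_0 sing weak_sing_poly_stieltjes_1 reg)
  qed (assumption | rule that)+
  have "(h \<longlongrightarrow> 0) at_infinity"
  proof (rule Lim_transform_eventually)
    \<comment> \<open>The condition at infinity controls z^n times the entry, so n \<ge> 1 makes the
      entry itself tend to 0.\<close>
    have "((\<lambda>z. (z ^ n * Y z $ i $ 2) * inverse z ^ n - ?K * ?S z) \<longlongrightarrow> ?d 2 * 0 ^ n - ?K * 0) at_infinity"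
      by (intro tendsto_intros inf(2) tendsto_inverse_0 poly_stieltjes_at_infinity reg)
    then show "((\<lambda>z. (z ^ n * Y z $ i $ 2) * inverse z ^ n - ?K * ?S z) \<longlongrightarrow> 0) at_infinity"
      using n by (simp add: power_0_left)
    show "\<forall>\<^sub>F z in at_infinity. (z ^ n * Y z $ i $ 2) * inverse z ^ n - ?K * ?S z = h z"
      using eventually_slit_plane_at_infinity
      by eventually_elim (use h(2) slit_plane_ne_0 in \<open>simp add: power_inverse\<close>)
  qed
  then have "h z = 0" for z by (rule Liouville_weak_0[OF h(1)])
  then have Y2: "Y z $ i $ 2 = ?K * ?S z" if "z \<in> slit_plane" for z using h(2)[OF that] by simp
  have "((\<lambda>z. (2 * of_real pi * \<i>) * (z ^ n * Y z $ i $ 2)) \<longlongrightarrow> (2 * of_real pi * \<i>) * ?d 2) at_infinity"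
    by (intro tendsto_intros inf(2))
  moreover have "\<forall>\<^sub>F z in at_infinity. (2 * of_real pi * \<i>) * (z ^ n * Y z $ i $ 2) = z ^ n * ?S z"
    using eventually_slit_plane_at_infinity by eventually_elim (simp add: Y2)
  ultimately have "((\<lambda>z. z ^ n * ?S z) \<longlongrightarrow> (2 * of_real pi * \<i>) * ?d 2) at_infinity"
    by (rule Lim_transform_eventually)
  from poly_moments_from_decay[OF reg this]
  have mom: "poly_moment \<alpha> \<beta> (monom 1 j * p) = (if j = n - 1 \<and> i = 2 then - (2 * of_real pi * \<i>) else 0)" if "j < n" for j
    using that by simp
  show thesis by (rule that[OF p(2,3) Y1 Y2 mom])
qed

text \<open>The problem does not constrain the values of Y on [0,1], so agreement can be claimed
  only off the slit. In each row the difference of polynomials has degree below n and is orthogonal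
  to all degrees below n.\<close>

lemma rh_solution_unique:
  assumes Y: "rh_solution \<alpha> \<beta> n Y" and z: "z \<in> slit_plane"
  shows "Y z = jacobi_Y \<alpha> \<beta> n z"
proof -
  let ?p = "monic_jacobi \<alpha> \<beta> n" and ?q = "monic_jacobi \<alpha> \<beta> (n - 1)" and ?c = "jacobi_c \<alpha> \<beta> n"
  note mono = poly_moment_monom_monic_jacobi[OF reg sum_reg]
  note pdeg = monic_jacobi_coeff[OF reg sum_reg, of n] and qdeg = monic_jacobi_coeff[OF reg sum_reg, of "n - 1"]
  obtain p where p: "degree p \<le> n" "coeff p n = 1"
    "\<And>z. z \<in> slit_plane \<Longrightarrow> Y z $ 1 $ 1 = poly p z"
    "\<And>z. z \<in> slit_plane \<Longrightarrow> Y z $ 1 $ 2 = 1 / (2 * of_real pi * \<i>) * poly_stieltjes \<alpha> \<beta> p z"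
    "\<And>j. j < n \<Longrightarrow> poly_moment \<alpha> \<beta> (monom 1 j * p) = 0"
    by (rule rh_solution_row[OF Y, of 1]) (auto intro: that)
  obtain q where q: "degree q \<le> n" "coeff q n = 0"
    "\<And>z. z \<in> slit_plane \<Longrightarrow> Y z $ 2 $ 1 = poly q z"
    "\<And>z. z \<in> slit_plane \<Longrightarrow> Y z $ 2 $ 2 = 1 / (2 * of_real pi * \<i>) * poly_stieltjes \<alpha> \<beta> q z"
    "\<And>j. j < n \<Longrightarrow> poly_moment \<alpha> \<beta> (monom 1 j * q) = (if j = n - 1 then - (2 * of_real pi * \<i>) else 0)"
    by (rule rh_solution_row[OF Y, of 2]) (auto intro: that)
  have "p - ?p = 0"
  proof (rule orthogonal_imp_0[OF reg sum_reg])
    show "poly_moment \<alpha> \<beta> (monom 1 j * (p - ?p)) = 0" if "j < n" for j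
      using that p(5) mono[of j n] by (simp add: right_diff_distrib poly_moment_diff[OF reg])
    show "\<forall>k\<ge>n. coeff (p - ?p) k = 0"
      using p(1,2) pdeg by (auto simp: coeff_eq_0 le_less)
  qed
  then have "p = ?p" by simp
  \<comment> \<open>The moment of t^(n-1) q is prescribed as -2 pi i, which by
    \<open>jacobi_c_norm\<close> is also the moment for c_n times the monic polynomial of degree n -
    1.\<close>
  have "q - smult ?c ?q = 0"
  proof (rule orthogonal_imp_0[OF reg sum_reg])
    show "poly_moment \<alpha> \<beta> (monom 1 j * (q - smult ?c ?q)) = 0" if "j < n" for j
    proof -
      have "j \<le> n - 1" using that by simp
      then show ?thesis
        using that q(5) mono[of j "n - 1"] jacobi_c_norm[OF reg sum_reg n]
        by (simp add: right_diff_distrib poly_moment_diff[OF reg] poly_moment_smult[OF reg])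
    qed
    show "\<forall>k\<ge>n. coeff (q - smult ?c ?q) k = 0"
    proof (intro allI impI)
      fix k assume "k \<ge> n"
      then have "coeff q k = 0" using q(1,2) by (cases "k = n") (auto intro!: coeff_eq_0)
      moreover have "coeff ?q k = 0" using qdeg(1) n \<open>k \<ge> n\<close> by (intro coeff_eq_0) simp
      ultimately show "coeff (q - smult ?c ?q) k = 0" by simp
    qed
  qed
  then have "q = smult ?c ?q" by simp
  show ?thesis
    by (rule matrix_2_eqI; unfold jacobi_Y_components)
       (simp_all add: p(3,4)[OF z] q(3,4)[OF z] \<open>p = ?p\<close> \<open>q = smult ?c ?q\<close> poly_stieltjes_smult[OF reg z])
qed

end

theorem theorem13:
  fixes \<alpha> \<beta> :: complex and n :: nat
  assumes "\<forall>k::nat. k \<ge> 1 \<longrightarrow> \<alpha> \<noteq> - of_nat k"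
    and "\<forall>k::nat. k \<ge> 1 \<longrightarrow> \<beta> \<noteq> - of_nat k"
    and "\<forall>k::nat. k \<ge> 2 \<longrightarrow> \<alpha> + \<beta> \<noteq> - of_nat k"
    and "n \<ge> 1"
  shows "(\<alpha> \<noteq> 0 \<and> \<beta> \<noteq> 0 \<longrightarrow> rh_solution \<alpha> \<beta> n (jacobi_Y \<alpha> \<beta> n)) \<and>
    (\<forall>Y. rh_solution \<alpha> \<beta> n Y \<longrightarrow> (\<forall>z\<in>slit_plane. Y z = jacobi_Y \<alpha> \<beta> n z))"
proof -
  have reg: "regular_exponent \<alpha>" "regular_exponent \<beta>"
    using assms(1,2) by (simp_all only: regular_exponent_iff)
  show ?thesis
    by (intro conjI allI impI ballI)
       (rule jacobi_Y_rh_solution[OF reg assms(3,4)] rh_solution_unique[OF reg assms(3,4)]; simp)+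
qed

end
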